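(* Let $(S,\mathcal A,P)$ be a probability space, $f:\mathbb R^p\times S\to\mathbb R$ and $D:\mathbb R^p\times S\rightrightarrows\mathbb R^p$ a nonempty compact valued map such that for $P$-almost all $s$, $f(\cdot,s)$ is locally Lipschitz continuous and $D(\cdot,s)$ is a convex-valued conservative gradient for $f(\cdot,s)$. Assume: (i) for all $w\in\mathbb R^p$, $f(w,\cdot)$ is $P$-integrable, and $\mathcal J(w):=\mathbb E_{\xi\sim P}[f(w,\xi)]$ is bounded below; (ii) $D$ is jointly measurable; (iii) there exist $\kappa:S\to\mathbb R_+$ square integrable with respect to $P$ and $q_0\in\mathbb N$ such that for $P$-almost all $s$, for all $w\in\mathbb R^p$, $\|D(w,s)\|:=\sup_{y\in D(w,s)}\|y\|\le\kappa(s)(1+\|w\|^{q_0})$; (iv) $\alpha_k>0$ for all $k$, $\sum_{k}\alpha_k=\infty$, $\alpha_k\to0$; (v) $v:\mathbb R^p\times S\to\mathbb R^p$ is jointly measurable and for all $w\in\mathbb R^p$, for $P$-almost all $s\in S$, $v(w,s)\in D(w,s)$; (vi) $(w_k)$ is defined by $w_0\in\mathbb R^p$, $w_{k+1}=w_k-\alpha_kv(w_k,\xi_k)$, with $(\xi_k)_{k\in\mathbb N}$ i.i.d. of law $P$, and $\sup_k\|w_k\|<\infty$ almost surely. Let $D_{\mathcal J}(w):=\mathbb E_{\xi\sim P}[D(w,\xi)]$ (Aumann integral). Then almost surely all essential accumulation points $\bar w$ of $(w_k)_{k\in\mathbb N}$ satisfy $0\in D_{\mathcal J}(\bar w)$.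 If in addition $\mathcal J(\operatorname{crit}D_{\mathcal J})$ has empty interior in $\mathbb R$, where $\operatorname{crit}D_{\mathcal J}=\{x\in\mathbb R^p: 0\in D_{\mathcal J}(x)\}$, and at least one of the following holds: (A) $\sum_{k}\alpha_k^2<\infty$; (B) $w\mapsto\sup_{s\in\operatorname{supp}P}\|v(w,s)\|$ is locally bounded and $\alpha_k=o(1/\log k)$; then, almost surely, $\mathcal J(w_k)$ converges as $k\to\infty$, all accumulation points $\bar w$ of $(w_k)_{k\in\mathbb N}$ satisfy $0\in D_{\mathcal J}(\bar w)$, and the set of accumulation points is connected.
   Context: Conservative gradient. For $g:\mathbb R^p\to\mathbb R$ locally Lipschitz, a set-valued map $E:\mathbb R^p\rightrightarrows\mathbb R^p$ that is nonempty valued, locally bounded and graph closed is a conservative gradient for $g$ if for every absolutely continuous curve $\gamma:[0,1]\to\mathbb R^p$, for almost all $t\in[0,1]$, $\frac{d}{dt}(g\circ\gamma)(t)=\langle v,\dot\gamma(t)\rangle$ for all $v\in E(\gamma(t))$. Measurability. A nonempty compact valued map is measurable if it is measurable as a map into the space of nonempty compact subsets of $\mathbb R^p$ with the Borel $\sigma$-algebra of the Hausdorff distance; joint measurability is with respect to $\mathcal B(\mathbb R^p)\otimes\mathcal A$. Aumann integral. $\mathbb E_{\xi\sim P}[F(\xi)]:=\{\int_Su\,dP: u\ P\text{-integrable},\ u(s)\in F(s)\text{ for all }s\in S\}$. Essential accumulation point. For a realization of the sequence, an accumulation point $\bar w$ of $(w_k)$ is essential if for every neighborhood $U$ of $\bar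 w$, $\limsup_{k\to\infty}\frac{\sum_{i=0}^k\alpha_i\mathbf 1_{\{w_i\in U\}}}{\sum_{i=0}^k\alpha_i}>0$. $\operatorname{supp}P$ is the support of $P$; in case (B), $S$ is understood to be a topological space with its Borel structure (e.g. $\mathbb R^m$) for which the support is defined and $P(\operatorname{supp}P)=1$. *)

theory Defs
  imports "HOL-Probability.Probability"
begin

definition nonempty_compacts :: "'a::topological_space set set" where
  "nonempty_compacts = {K. K \<noteq> {} \<and> compact K}"

text \<open>The value outside \<^const>\<open>nonempty_compacts\<close> is irrelevant; \<open>0\<close> is chosen because the
  locale \<^locale>\<open>Metric_space\<close> asks for symmetry and nonnegativity on the whole type.\<close>

definition hausdist :: "'a::metric_space set \<Rightarrow> 'a set \<Rightarrow> real" where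
  "hausdist A B =
    (if A \<in> nonempty_compacts \<and> B \<in> nonempty_compacts
     then max (SUP x\<in>A. infdist x B) (SUP y\<in>B. infdist y A) else 0)"

lemma hausdist_le_iff:
  assumes "A \<in> nonempty_compacts" "B \<in> nonempty_compacts"
  shows "hausdist A B \<le> r \<longleftrightarrow> (\<forall>x\<in>A. infdist x B \<le> r) \<and> (\<forall>y\<in>B. infdist y A \<le> r)"
proof -
  have "bdd_above ((\<lambda>x. infdist x E) ` C)" if "C \<in> nonempty_compacts" for C E :: "'a set"
  proof -
    have "compact ((\<lambda>x. infdist x E) ` C)"
      using that by (intro compact_continuous_image continuous_intros)
        (auto simp: nonempty_compacts_def)
    then show ?thesis
      by (intro bounded_imp_bdd_above compact_imp_bounded)
  qed
  with assms show ?thesis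
    by (auto simp: hausdist_def cSUP_le_iff nonempty_compacts_def)
qed

lemma Metric_space_hausdist:
  "Metric_space (nonempty_compacts :: 'a::metric_space set set) hausdist"
proof
  fix A B :: "'a set"
  show "hausdist A B = hausdist B A"
    by (auto simp: hausdist_def max.commute)
  show nonneg: "0 \<le> hausdist A B"
  proof (cases "A \<in> nonempty_compacts \<and> B \<in> nonempty_compacts")
    case True
    then obtain x where "x \<in> A"
      by (auto simp: nonempty_compacts_def)
    moreover have "infdist x B \<le> hausdist A B"
      using hausdist_le_iff[of A B "hausdist A B"] True \<open>x \<in> A\<close> by auto
    ultimately show ?thesis
      using infdist_nonneg[of x B] by linarith
  qed (auto simp: hausdist_def)
  assume A: "A \<in> nonempty_compacts" and B: "B \<in> nonempty_compacts"
  have closed: "closed A" "A \<noteq> {}" "closed B" "B \<noteq> {}"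
    using A B by (auto simp: nonempty_compacts_def compact_imp_closed)
  have le0: "infdist x E \<le> 0 \<longleftrightarrow> x \<in> E" if "closed E" "E \<noteq> {}" for x and E :: "'a set"
    using in_closed_iff_infdist_zero[OF that, of x] infdist_nonneg[of x E] by auto
  have "hausdist A B \<le> 0 \<longleftrightarrow> A = B"
    using closed by (auto simp: hausdist_le_iff[OF A B] le0)
  with nonneg show "hausdist A B = 0 \<longleftrightarrow> A = B"
    by simp
next
  fix A B C :: "'a set"
  assume mem: "A \<in> nonempty_compacts" "B \<in> nonempty_compacts" "C \<in> nonempty_compacts"
  have *: "infdist x E \<le> hausdist A' B' + hausdist B' E"
    if *: "A' \<in> nonempty_compacts" "B' \<in> nonempty_compacts" "E \<in> nonempty_compacts" "x \<in> A'"
    for x and A' B' E :: "'a set"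
  proof -
    have B': "B' \<noteq> {}" "compact B'"
      using that by (auto simp: nonempty_compacts_def)
    obtain y where y: "y \<in> B'" "\<forall>z\<in>B'. dist x y \<le> dist x z"
      using continuous_attains_inf[OF B'(2,1), of "dist x"]
        continuous_on_dist[OF continuous_on_const[of B' x] continuous_on_id] by blast
    then have xy: "dist x y \<le> infdist x B'"
      using B' by (auto simp: infdist_notempty intro!: cINF_greatest)
    have "infdist x E \<le> infdist y E + dist x y"
      by (rule infdist_triangle)
    moreover have "infdist x B' \<le> hausdist A' B'"
      using hausdist_le_iff[of A' B' "hausdist A' B'"] that by auto
    moreover have "infdist y E \<le> hausdist B' E"
      using hausdist_le_iff[of B' E "hausdist B' E"] that y by auto
    ultimately show ?thesis
      using xy by linarith
  qed
  have comm: "hausdist X Y = hausdist Y X" for X Y :: "'a set"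
    by (auto simp: hausdist_def max.commute)
  show "hausdist A C \<le> hausdist A B + hausdist B C"
    unfolding hausdist_le_iff[OF mem(1,3)]
    using *[OF mem] *[OF mem(3,2,1)] comm[of C B] comm[of B A] by fastforce
qed

definition hausdorff_borel :: "'a::metric_space set measure" where
  "hausdorff_borel =
    sigma nonempty_compacts {U. openin (Metric_space.mtopology nonempty_compacts hausdist) U}"

lemma openin_hausdist_subset:
  "{U. openin (Metric_space.mtopology nonempty_compacts hausdist) U}
    \<subseteq> Pow (nonempty_compacts :: 'a::metric_space set set)"
  using openin_subset Metric_space.topspace_mtopology[OF Metric_space_hausdist] by blast

lemma space_hausdorff_borel: "space hausdorff_borel = nonempty_compacts"
  by (simp add: hausdorff_borel_def openin_hausdist_subset)

lemma sets_hausdorff_borel: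
  "sets hausdorff_borel = sigma_sets nonempty_compacts
    {U. openin (Metric_space.mtopology nonempty_compacts hausdist) U}"
  by (simp add: hausdorff_borel_def openin_hausdist_subset)

definition locally_lipschitz :: "('a::metric_space \<Rightarrow> 'b::metric_space) \<Rightarrow> bool" where
  "locally_lipschitz g \<longleftrightarrow> (\<forall>x. \<exists>\<epsilon>>0. \<exists>L. L-lipschitz_on (ball x \<epsilon>) g)"

definition absolutely_continuous_curve :: "real set \<Rightarrow> (real \<Rightarrow> 'a::metric_space) \<Rightarrow> bool" where
  "absolutely_continuous_curve I \<gamma> \<longleftrightarrow>
    (\<forall>\<epsilon>>0. \<exists>\<delta>>0. \<forall>(n::nat) a b.
      (\<forall>i<n. a i \<le> b i \<and> {a i..b i} \<subseteq> I) \<longrightarrow>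
      disjoint_family_on (\<lambda>i. {a i<..<b i}) {..<n} \<longrightarrow>
      (\<Sum>i<n. b i - a i) < \<delta> \<longrightarrow> (\<Sum>i<n. dist (\<gamma> (a i)) (\<gamma> (b i))) < \<epsilon>)"

text \<open>Since the values of a conservative gradient are nonempty, the last clause includes the
  differentiability of \<open>g \<circ> \<gamma>\<close> at almost every \<open>t\<close>.\<close>

definition conservative_gradient ::
    "('a::euclidean_space \<Rightarrow> real) \<Rightarrow> ('a \<Rightarrow> 'a set) \<Rightarrow> bool" where
  "conservative_gradient g E \<longleftrightarrow>
    (\<forall>x. E x \<noteq> {}) \<and>
    (\<forall>x. \<exists>\<epsilon>>0. bounded (\<Union>y\<in>ball x \<epsilon>. E y)) \<and>
    closed {(x, v). v \<in> E x} \<and>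
    (\<forall>\<gamma>. absolutely_continuous_curve {0..1} \<gamma> \<longrightarrow>
      (AE t in lebesgue_on {0..1}.
        \<exists>\<gamma>'. (\<gamma> has_vector_derivative \<gamma>') (at t within {0..1}) \<and>
          (\<forall>v\<in>E (\<gamma> t). ((g \<circ> \<gamma>) has_real_derivative v \<bullet> \<gamma>') (at t within {0..1}))))"

definition set_norm :: "'a::real_normed_vector set \<Rightarrow> real" where
  "set_norm A = (SUP y\<in>A. norm y)"

definition aumann_integral ::
    "'s measure \<Rightarrow> ('s \<Rightarrow> 'a::{banach, second_countable_topology} set) \<Rightarrow> 'a set" where
  "aumann_integral P F =
    {\<integral>s. u s \<partial>P | u. integrable P u \<and> (\<forall>s\<in>space P. u s \<in> F s)}"

definition expected_fun :: "'s measure \<Rightarrow> ('a \<Rightarrow> 's \<Rightarrow> real) \<Rightarrow> 'a \<Rightarrow> real" where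
  "expected_fun P f w = (\<integral>s. f w s \<partial>P)"

definition expected_map ::
    "'s measure \<Rightarrow> ('w \<Rightarrow> 's \<Rightarrow> 'a::{banach, second_countable_topology} set) \<Rightarrow> 'w \<Rightarrow> 'a set"
  where "expected_map P D w = aumann_integral P (D w)"

definition crit :: "('a \<Rightarrow> 'b::zero set) \<Rightarrow> 'a set" where
  "crit E = {x. 0 \<in> E x}"

definition accumulation_point :: "(nat \<Rightarrow> 'a::topological_space) \<Rightarrow> 'a \<Rightarrow> bool" where
  "accumulation_point w x \<longleftrightarrow> (\<exists>r. strict_mono r \<and> (w \<circ> r) \<longlonglongrightarrow> x)"

definition essential_accumulation_point ::
    "(nat \<Rightarrow> real) \<Rightarrow> (nat \<Rightarrow> 'a::topological_space) \<Rightarrow> 'a \<Rightarrow> bool" where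
  "essential_accumulation_point \<alpha> w x \<longleftrightarrow>
    accumulation_point w x \<and>
    (\<forall>U. open U \<and> x \<in> U \<longrightarrow>
      limsup (\<lambda>k. ereal ((\<Sum>i\<le>k. \<alpha> i * indicator U (w i)) / (\<Sum>i\<le>k. \<alpha> i))) > 0)"

definition borel_structure :: "'s topology \<Rightarrow> 's measure \<Rightarrow> bool" where
  "borel_structure T P \<longleftrightarrow>
    topspace T = space P \<and> sets P = sigma_sets (space P) {U. openin T U}"

definition measure_support :: "'s topology \<Rightarrow> 's measure \<Rightarrow> 's set" where
  "measure_support T P = {s \<in> topspace T. \<forall>U. openin T U \<and> s \<in> U \<longrightarrow> emeasure P U > 0}"

definition locally_bounded_above :: "('a::metric_space \<Rightarrow> ereal) \<Rightarrow> bool" where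
  "locally_bounded_above h \<longleftrightarrow> (\<forall>x. \<exists>\<epsilon>>0. \<exists>C::real. \<forall>y\<in>ball x \<epsilon>. h y \<le> ereal C)"

end

theory Submission
  imports Defs "HOL-Complex_Analysis.Great_Picard"
begin

text \<open>
  Everything about \<open>D\<^sub>J(x) = E[D(x, \<xi>)]\<close> is read off its support function \<open>g x p = E[sup {u \<bullet> p | u \<in> D(x, \<xi>)}]\<close>:
  the condition \<open>0 \<in> D\<^sub>J(x)\<close> becomes \<open>0 \<le> g x p\<close> for all \<open>p\<close>, and \<open>g\<close> is upper semicontinuous in \<open>x\<close>.
  Integrating the chain rule for \<open>f(\<cdot>, s)\<close> over \<open>s\<close> shows that along a Lipschitz curve with
  \<open>- \<gamma>'(t) \<in> D\<^sub>J(\<gamma>(t))\<close> the value \<open>J\<close> decreases at least as \<open>\<integral> |\<gamma>'|\<^sup>2\<close>, so a curve that does not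
  decrease is constant and critical.

  Cut time into windows of unit length \<open>\<Sum> \<alpha>\<^sub>i \<approx> 1\<close>. By Arzela--Ascoli, windows on which the accumulated
  martingale noise tends to \<open>0\<close> converge, along subsequences, to such curves. Hence late quiet
  windows never raise \<open>J\<close> by a fixed amount, and those meeting a small neighbourhood of a noncritical
  point lower it by a fixed amount.
  Doob's maximal inequality bounds the conditional probability of a loud window. It tends to \<open>0\<close>, so
  loud windows have density \<open>0\<close>; telescoping \<open>J\<close> over the windows, noncritical points are visited
  with density \<open>0\<close>. Under (A), by the second moment, or (B), by exponential moments, these
  probabilities are summable, so almost surely all late windows are quiet; then \<open>J\<close> cannot
  cross a noncritical level upwards infinitely often.
\<close>

section \<open>Lipschitz curves and accumulation points\<close>

text \<open>Two obstacles shape the argument. The averaged direction \<open>H x\<close> integrates a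
  field that lies in \<open>D x s\<close> only almost everywhere, and the values of the Aumann
  integral are not known beforehand to be closed. So no membership is used along the path: the
  dynamics are phrased by inequalities \<open>h k \<bullet> p \<le> g (w k) p\<close>, which survive
  limits and integration over the samples. Only at the very end does \<open>0 \<le> g x p\<close>
  for all \<open>p\<close> have to produce a selection whose integral is exactly 0. The noise has
  only two moments, and their bound depends on the position. It is therefore truncated to a ball
  whose radius is chosen after the path is known to be bounded, all natural radii being treated at
  once. When the steps merely vanish, loud windows may recur forever; essential accumulation points
  tolerate this because they disregard visits of zero density in time. Differentiability of the
  limit curves comes from the definition of a conservative gradient itself, which asserts it along
  every absolutely continuous curve. The condition on critical values only serves to supply a
  noncritical level inside every interval.\<close>

abbreviation unit_interval :: "real measure" where
  "unit_interval \<equiv> restrict_space lborel {0<..<1}"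

lemma prob_space_unit_interval: "prob_space unit_interval"
  by (rule prob_spaceI) (simp add: emeasure_restrict_space space_restrict_space)

text \<open>Completing a measure does not change almost everywhere statements, so the Lebesgue
  measure in the definition of conservative gradients can be exchanged for a Borel one. The
  endpoints are dropped to have two-sided derivatives.\<close>

lemma AE_unit_intervalI:
  assumes "AE t in lebesgue_on {0..1}. Q t"
  shows "AE t in unit_interval. Q t"
proof -
  have "AE t in lebesgue. t \<in> {0..1} \<longrightarrow> Q t"
    using assms by (subst (asm) AE_restrict_space_iff) auto
  then have "AE t in lborel. t \<in> {0..1} \<longrightarrow> Q t"
    by (simp only: AE_completion_iff)
  then show ?thesis
    by (subst AE_restrict_space_iff) (auto elim!: eventually_mono)
qed

text \<open>Extends a curve by constants beyond both endpoints, so that difference quotients with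
  positive increments and Borel measurability make sense on the whole line.\<close>

lemma lipschitz_on_clamp:
  fixes c :: "real \<Rightarrow> 'a::metric_space"
  assumes "L-lipschitz_on {0..1} c"
  shows "L-lipschitz_on UNIV (\<lambda>t. c (max 0 (min 1 t)))"
proof (rule lipschitz_onI)
  show "0 \<le> L"
    using assms by (rule lipschitz_on_nonneg)
  fix x y :: real
  have "dist (c (max 0 (min 1 x))) (c (max 0 (min 1 y))) \<le> L * dist (max 0 (min 1 x)) (max 0 (min 1 y))"
    using assms by (rule lipschitz_onD) auto
  also have "\<dots> \<le> L * dist x y"
    using \<open>0 \<le> L\<close> by (intro mult_left_mono) (auto simp: dist_real_def max_def min_def)
  finally show "dist (c (max 0 (min 1 x))) (c (max 0 (min 1 y))) \<le> L * dist x y" .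
qed

text \<open>Difference quotients converge boundedly to the derivative, and their integrals telescope.\<close>

lemma lipschitz_integral_derivative:
  fixes c :: "real \<Rightarrow> real"
  assumes lip: "L-lipschitz_on {0..1} c"
    and [measurable]: "d \<in> borel_measurable unit_interval"
    and deriv: "AE t in unit_interval. (c has_real_derivative d t) (at t)"
  shows "(\<integral>t. d t \<partial>unit_interval) = c 1 - c 0"
proof -
  interpret U: prob_space unit_interval
    by (rule prob_space_unit_interval)
  define C where "C = (\<lambda>t. c (max 0 (min 1 t)))"
  have lipC: "L-lipschitz_on UNIV C"
    unfolding C_def using lip by (rule lipschitz_on_clamp)
  have contC: "continuous_on S C" for S
    using lipschitz_on_continuous_on[OF lipC] continuous_on_subset by blast
  have [measurable]: "C \<in> borel_measurable borel"
    using contC by (rule borel_measurable_continuous_onI)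
  define h where "h n = 1 / real (Suc n)" for n
  have h: "0 < h n" "h n \<le> 1" "h n \<noteq> 0" for n
    by (auto simp: h_def)
  have h0: "h \<longlonglongrightarrow> 0"
    unfolding h_def by (rule lim_const_over_n[THEN LIMSEQ_Suc])
  define q where "q n t = (C (t + h n) - C t) / h n" for n t
  have [measurable]: "q n \<in> borel_measurable borel" for n
    unfolding q_def by measurable
  have q_lim: "AE t in unit_interval. (\<lambda>n. q n t) \<longlonglongrightarrow> d t"
  proof -
    have "(\<lambda>n. q n t) \<longlonglongrightarrow> d t" if t: "t \<in> {0<..<1}" and der: "(c has_real_derivative d t) (at t)" for t
    proof -
      have "(C has_real_derivative d t) (at t)"
        by (rule has_field_derivative_transform_within_open[OF der, of "{0<..<1}"])
          (use t in \<open>auto simp: C_def\<close>)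
      then have "((\<lambda>e. (C (t + e) - C t) / e) \<longlongrightarrow> d t) (at 0)"
        by (simp add: DERIV_def)
      moreover have "filterlim h (at 0) sequentially"
        unfolding filterlim_at using h0 h by simp
      ultimately show ?thesis
        unfolding q_def by (rule filterlim_compose)
    qed
    moreover have "AE t in unit_interval. t \<in> {0<..<1}"
      by (rule AE_I2) (auto simp: space_restrict_space)
    ultimately show ?thesis
      using deriv by (auto elim!: eventually_elim2)
  qed
  have q_bound: "norm (q n t) \<le> L" for n t
    using lipschitz_onD[OF lipC, of "t + h n" t] h[of n]
    by (auto simp: q_def dist_real_def field_simps)
  have 1: "(\<lambda>n. \<integral>t. q n t \<partial>unit_interval) \<longlonglongrightarrow> (\<integral>t. d t \<partial>unit_interval)"
    by (rule integral_dominated_convergence[where w = "\<lambda>_. L"])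
      (use q_lim q_bound in \<open>auto intro!: measurable_restrict_space1\<close>)
  \<comment> \<open>An interval this large keeps \<open>t\<close> and \<open>t + h n\<close> in its
    interior for \<open>t\<close> in \<open>{0..1}\<close>, since
    \<open>h n \<le> 1\<close>.\<close>
  obtain F where "\<And>x. x \<in> {-1..3} \<Longrightarrow> (F has_vector_derivative C x) (at x within {-1..3})"
    using antiderivative_continuous[OF contC, of "-1" 3] by auto
  then have F: "(F has_vector_derivative C x) (at x)" if "-1 < x" "x < 3" for x
    using that by (metis at_within_Icc_at atLeastAtMost_iff less_imp_le)
  have q_int: "(\<integral>t. q n t \<partial>unit_interval) = (F (1 + h n) - F 1) / h n - (F (0 + h n) - F 0) / h n" for n
  proof -
    have "(\<integral>t. q n t \<partial>unit_interval) = (LBINT t. indicat_real {0<..<1} t *\<^sub>R q n t)"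
      by (subst integral_restrict_space) auto
    also have "\<dots> = (LBINT t. indicat_real {0..1} t *\<^sub>R q n t)"
      by (rule integral_cong_AE)
        (use AE_lborel_singleton[of 0] AE_lborel_singleton[of 1] in \<open>auto elim!: eventually_elim2 split: split_indicator\<close>)
    also have "\<dots> = (\<lambda>t. (F (t + h n) - F t) / h n) 1 - (\<lambda>t. (F (t + h n) - F t) / h n) 0"
    proof (rule integral_FTC_Icc)
      fix x :: real assume x: "0 \<le> x" "x \<le> 1"
      have "((\<lambda>t. F (t + h n)) has_vector_derivative C (x + h n)) (at x)"
        using F[of "x + h n"] x h[of n] DERIV_shift[of F "C (x + h n)" x "h n"]
        by (auto simp: has_real_derivative_iff_has_vector_derivative)
      then have "((\<lambda>t. F (t + h n) - F t) has_vector_derivative C (x + h n) - C x) (at x)"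
        by (rule has_vector_derivative_diff) (use x in \<open>auto intro: F\<close>)
      then have "((\<lambda>t. (F (t + h n) - F t) / h n) has_vector_derivative q n x) (at x)"
        unfolding q_def by (rule has_vector_derivative_divide)
      then show "((\<lambda>t. (F (t + h n) - F t) / h n) has_vector_derivative q n x) (at x within {0..1})"
        by (rule has_vector_derivative_at_within)
    next
      have "continuous_on {0..1} (\<lambda>t. C (t + h n))"
        by (rule continuous_on_compose2[OF contC[of UNIV]]) (auto intro!: continuous_intros)
      then show "continuous_on {0..1} (q n)"
        unfolding q_def using h[of n] by (intro continuous_intros contC) auto
    qed auto
    finally show ?thesis
      by (simp add: diff_divide_distrib)
  qed
  have F_lim: "(\<lambda>n. (F (x + h n) - F x) / h n) \<longlonglongrightarrow> C x" if "-1 < x" "x < 3" for x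
  proof -
    have "((\<lambda>e. (F (x + e) - F x) / e) \<longlongrightarrow> C x) (at 0)"
      using F[OF that] by (simp add: has_real_derivative_iff_has_vector_derivative[symmetric] DERIV_def)
    moreover have "filterlim h (at 0) sequentially"
      unfolding filterlim_at using h0 h by simp
    ultimately show ?thesis
      by (rule filterlim_compose)
  qed
  have "(\<lambda>n. \<integral>t. q n t \<partial>unit_interval) \<longlonglongrightarrow> C 1 - C 0"
    unfolding q_int using F_lim[of 1] F_lim[of 0] by (intro tendsto_diff) auto
  from LIMSEQ_unique[OF 1 this] show ?thesis
    by (simp add: C_def)
qed

lemma lipschitz_imp_absolutely_continuous_curve:
  assumes lip: "L-lipschitz_on I \<gamma>"
  shows "absolutely_continuous_curve I \<gamma>"
  unfolding absolutely_continuous_curve_def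
proof (intro allI impI)
  fix \<epsilon> :: real assume "\<epsilon> > 0"
  have L: "L \<ge> 0" using lip by (rule lipschitz_on_nonneg)
  show "\<exists>\<delta>>0. \<forall>(n::nat) a b.
      (\<forall>i<n. a i \<le> b i \<and> {a i..b i} \<subseteq> I) \<longrightarrow>
      disjoint_family_on (\<lambda>i. {a i<..<b i}) {..<n} \<longrightarrow>
      (\<Sum>i<n. b i - a i) < \<delta> \<longrightarrow> (\<Sum>i<n. dist (\<gamma> (a i)) (\<gamma> (b i))) < \<epsilon>"
  proof (intro exI[of _ "\<epsilon> / (L + 1)"] conjI allI impI)
    fix n :: nat and a b :: "nat \<Rightarrow> real"
    assume ab: "\<forall>i<n. a i \<le> b i \<and> {a i..b i} \<subseteq> I" and small: "(\<Sum>i<n. b i - a i) < \<epsilon> / (L + 1)"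
    have "dist (\<gamma> (a i)) (\<gamma> (b i)) \<le> (L + 1) * (b i - a i)" if "i < n" for i
    proof -
      have i: "a i \<le> b i" "a i \<in> I" "b i \<in> I"
        using ab that by (auto simp: subset_iff)
      then have "dist (\<gamma> (a i)) (\<gamma> (b i)) \<le> L * dist (a i) (b i)"
        using lipschitz_onD[OF lip] by blast
      also have "\<dots> \<le> (L + 1) * (b i - a i)"
        using i by (auto simp: dist_real_def algebra_simps)
      finally show ?thesis .
    qed
    then have "(\<Sum>i<n. dist (\<gamma> (a i)) (\<gamma> (b i))) \<le> (L + 1) * (\<Sum>i<n. b i - a i)"
      unfolding sum_distrib_left by (intro sum_mono) auto
    also have "\<dots> < \<epsilon>"
      using small L by (simp add: field_simps)
    finally show "(\<Sum>i<n. dist (\<gamma> (a i)) (\<gamma> (b i))) < \<epsilon>" .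
  qed (use L \<open>\<epsilon> > 0\<close> in auto)
qed

lemma accumulation_point_iff_frequently:
  fixes w :: "nat \<Rightarrow> 'a::metric_space"
  shows "accumulation_point w x \<longleftrightarrow> (\<forall>e>0. \<exists>\<^sub>F n in sequentially. dist (w n) x < e)"
proof
  assume "accumulation_point w x"
  then obtain r where r: "strict_mono r" "(w \<circ> r) \<longlonglongrightarrow> x"
    unfolding accumulation_point_def by auto
  show "\<forall>e>0. \<exists>\<^sub>F n in sequentially. dist (w n) x < e"
  proof (intro allI impI)
    fix e :: real assume "e > 0"
    with r(2) have "\<exists>\<^sub>F n in sequentially. dist (w (r n)) x < e"
      by (intro eventually_frequently) (auto dest!: tendstoD)
    then show "\<exists>\<^sub>F n in sequentially. dist (w n) x < e"
      using filterlim_subseq[OF r(1)] unfolding filterlim_iff frequently_def by blast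
  qed
next
  assume fr: "\<forall>e>0. \<exists>\<^sub>F n in sequentially. dist (w n) x < e"
  have "\<exists>r. \<forall>n. dist (w (r n)) x < 1 / real (Suc n) \<and> r n < r (Suc n)"
  proof (intro dependent_nat_choice)
    show "\<exists>k. dist (w k) x < 1 / real (Suc 0)"
      using fr[rule_format, of 1] by (auto dest: frequently_ex)
    fix k :: nat and n :: nat
    have "\<exists>\<^sub>F m in sequentially. dist (w m) x < 1 / real (Suc (Suc n)) \<and> k < m"
      using fr by (intro frequently_eventually_frequently) (auto intro: eventually_gt_at_top)
    then show "\<exists>m. dist (w m) x < 1 / real (Suc (Suc n)) \<and> k < m"
      by (auto dest: frequently_ex)
  qed
  then obtain r where r: "\<And>n. dist (w (r n)) x < 1 / real (Suc n)" "\<And>n. r n < r (Suc n)"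
    by auto
  have "strict_mono r"
    using r(2) by (rule strict_mono_Suc_iff[THEN iffD2, rule_format])
  moreover have "(\<lambda>n. w (r n)) \<longlonglongrightarrow> x"
  proof (rule metric_tendsto_imp_tendsto)
    show "(\<lambda>n. 1 / real (Suc n)) \<longlonglongrightarrow> 0"
      by (rule lim_const_over_n[THEN LIMSEQ_Suc])
    show "\<forall>\<^sub>F n in sequentially. dist (w (r n)) x \<le> dist (1 / real (Suc n)) 0"
      using r(1) by (auto intro!: always_eventually less_imp_le)
  qed
  ultimately show "accumulation_point w x"
    unfolding accumulation_point_def o_def by blast
qed

lemma frequently_subseq:
  assumes "\<exists>\<^sub>F n in sequentially. Q n"
  shows "\<exists>r::nat \<Rightarrow> nat. strict_mono r \<and> (\<forall>n. Q (r n))"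
proof -
  have "infinite {n. Q n}"
    using assms by (simp add: INFM_iff_infinite cofinite_eq_sequentially[symmetric])
  then show ?thesis
    using infinite_enumerate[of "{n. Q n}"] by auto
qed

lemma closed_accumulation_points:
  fixes w :: "nat \<Rightarrow> 'a::metric_space"
  shows "closed {x. accumulation_point w x}"
proof (rule closed_sequential_limits[THEN iffD2], intro allI impI, elim conjE)
  fix X x assume X: "\<forall>n. X n \<in> {x. accumulation_point w x}" and lim: "X \<longlonglongrightarrow> x"
  have "\<exists>\<^sub>F n in sequentially. dist (w n) x < e" if "e > 0" for e
  proof -
    have "\<forall>\<^sub>F k in sequentially. dist (X k) x < e / 2"
      by (rule tendstoD[OF lim]) (use that in simp)
    then obtain k where k: "dist (X k) x < e / 2"
      by (auto simp: eventually_sequentially)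
    have "\<exists>\<^sub>F n in sequentially. dist (w n) (X k) < e / 2"
      using X that by (auto simp: accumulation_point_iff_frequently simp del: divide_less_eq less_divide_eq_numeral1)
    then show ?thesis
    proof (rule frequently_elim1)
      fix n assume "dist (w n) (X k) < e / 2"
      then show "dist (w n) x < e"
        using k dist_triangle[of "w n" x "X k"] by linarith
    qed
  qed
  then show "x \<in> {x. accumulation_point w x}"
    by (simp add: accumulation_point_iff_frequently)
qed

lemma bounded_frequently_accumulation:
  fixes w :: "nat \<Rightarrow> 'a::euclidean_space"
  assumes "bounded (range w)" "\<exists>\<^sub>F n in sequentially. Q n"
  shows "\<exists>(r::nat \<Rightarrow> nat) x. strict_mono r \<and> (\<forall>n. Q (r n)) \<and> (\<lambda>n. w (r n)) \<longlonglongrightarrow> x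
    \<and> accumulation_point w x"
proof -
  obtain r :: "nat \<Rightarrow> nat" where r: "strict_mono r" "\<And>n. Q (r n)"
    using frequently_subseq[OF assms(2)] by auto
  have "bounded (range (w \<circ> r))"
    using assms(1) by (rule bounded_subset) auto
  then obtain x s where s: "strict_mono s" "((w \<circ> r) \<circ> s) \<longlonglongrightarrow> x"
    using bounded_imp_convergent_subsequence by blast
  have rs: "strict_mono (r \<circ> s)"
    using r(1) s(1) by (rule strict_mono_o)
  show ?thesis
    by (rule exI[of _ "r \<circ> s"], rule exI[of _ x]) (use rs r s in \<open>auto simp: o_def accumulation_point_def\<close>)
qed

text \<open>If the set split into closed pieces \<open>B\<close> and \<open>C\<close>, the Lipschitz
  function \<open>\<phi>\<close> would be negative on \<open>B\<close> and positive on
  \<open>C\<close>. The sequence would then change sign recurrently with vanishing steps, and so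
  accumulate at a zero of \<open>\<phi>\<close>, which lies in neither piece.\<close>

lemma connected_accumulation_points:
  fixes w :: "nat \<Rightarrow> 'a::euclidean_space"
  assumes bdd: "bounded (range w)" and step: "(\<lambda>n. dist (w (Suc n)) (w n)) \<longlonglongrightarrow> 0"
  shows "connected {x. accumulation_point w x}" (is "connected ?A")
proof (rule ccontr)
  assume "\<not> connected ?A"
  then obtain B C where BC: "closed B" "closed C" "B \<noteq> {}" "C \<noteq> {}" "B \<union> C = ?A" "B \<inter> C = {}"
    using connected_closed_set[OF closed_accumulation_points[of w]] by auto
  define \<phi> where "\<phi> x = infdist x B - infdist x C" for x
  have \<phi>_cont: "continuous_on UNIV \<phi>"
    unfolding \<phi>_def by (intro continuous_intros)
  have \<phi>_lip: "\<bar>\<phi> x - \<phi> y\<bar> \<le> 2 * dist x y" for x y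
    using infdist_triangle_abs[of x B y] infdist_triangle_abs[of x C y] by (simp add: \<phi>_def)
  have \<phi>_nz: "\<phi> x \<noteq> 0" if "accumulation_point w x" for x
  proof -
    have "x \<in> B \<union> C"
      unfolding BC(5) using that by simp
    then consider "x \<in> B" "x \<notin> C" | "x \<in> C" "x \<notin> B"
      using BC(6) by blast
    then show ?thesis
      by cases (use BC infdist_pos_not_in_closed[of B x] infdist_pos_not_in_closed[of C x] in \<open>auto simp: \<phi>_def\<close>)
  qed
  have neg: "\<exists>\<^sub>F n in sequentially. \<phi> (w n) < 0"
  proof -
    obtain x where x: "x \<in> B" using BC by blast
    then have "\<phi> x < 0"
      using BC infdist_pos_not_in_closed[of C x] by (auto simp: \<phi>_def)
    have "\<exists>\<^sub>F n in sequentially. dist (w n) x < - \<phi> x / 4"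
      by (rule accumulation_point_iff_frequently[THEN iffD1, rule_format])
        (use x BC(5)[symmetric] \<open>\<phi> x < 0\<close> in auto)
    then show ?thesis
    proof (elim frequently_elim1)
      fix n assume "dist (w n) x < - \<phi> x / 4"
      then show "\<phi> (w n) < 0"
        using \<phi>_lip[of "w n" x] \<open>\<phi> x < 0\<close> by (auto simp: abs_le_iff)
    qed
  qed
  have pos: "\<exists>\<^sub>F n in sequentially. \<phi> (w n) > 0"
  proof -
    obtain x where x: "x \<in> C" using BC by blast
    then have "\<phi> x > 0"
      using BC infdist_pos_not_in_closed[of B x] by (auto simp: \<phi>_def)
    have "\<exists>\<^sub>F n in sequentially. dist (w n) x < \<phi> x / 4"
      by (rule accumulation_point_iff_frequently[THEN iffD1, rule_format])
        (use x BC(5)[symmetric] \<open>\<phi> x > 0\<close> in auto)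
    then show ?thesis
    proof (elim frequently_elim1)
      fix n assume "dist (w n) x < \<phi> x / 4"
      then show "\<phi> (w n) > 0"
        using \<phi>_lip[of "w n" x] \<open>\<phi> x > 0\<close> by (auto simp: abs_le_iff)
    qed
  qed
  \<comment> \<open>Otherwise the sequence, once at a nonpositive value, would stay there, against
    \<open>pos\<close>.\<close>
  have "\<exists>\<^sub>F n in sequentially. \<phi> (w n) \<le> 0 \<and> 0 \<le> \<phi> (w (Suc n))"
    unfolding frequently_sequentially
  proof
    fix N
    obtain a where a: "a \<ge> N" "\<phi> (w a) < 0"
      using neg unfolding frequently_sequentially by blast
    obtain b where b: "b \<ge> a" "\<phi> (w b) > 0"
      using pos unfolding frequently_sequentially by blast
    show "\<exists>n\<ge>N. \<phi> (w n) \<le> 0 \<and> 0 \<le> \<phi> (w (Suc n))"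
    proof (rule ccontr)
      assume *: "\<not> ?thesis"
      have "\<phi> (w n) \<le> 0" if "n \<ge> a" for n
        using that by (induction n rule: dec_induct) (use a * in force)+
      with b show False by force
    qed
  qed
  then obtain r :: "nat \<Rightarrow> nat" and x where r: "strict_mono r" "\<And>n. \<phi> (w (r n)) \<le> 0 \<and> 0 \<le> \<phi> (w (Suc (r n)))"
      "(\<lambda>n. w (r n)) \<longlonglongrightarrow> x" "accumulation_point w x"
    using bounded_frequently_accumulation[OF bdd, of "\<lambda>n. \<phi> (w n) \<le> 0 \<and> 0 \<le> \<phi> (w (Suc n))"] by auto
  have "(\<lambda>n. 2 * dist (w (Suc (r n))) (w (r n))) \<longlonglongrightarrow> 2 * 0"
    by (intro tendsto_intros LIMSEQ_subseq_LIMSEQ[OF step r(1), unfolded o_def])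
  moreover have "norm (\<phi> (w (r n))) \<le> 2 * dist (w (Suc (r n))) (w (r n))" for n
    using \<phi>_lip[of "w (Suc (r n))" "w (r n)"] r(2)[of n] by (simp add: abs_le_iff)
  ultimately have "(\<lambda>n. \<phi> (w (r n))) \<longlonglongrightarrow> 0"
    using Lim_null_comparison[of "\<lambda>n. \<phi> (w (r n))" "\<lambda>n. 2 * dist (w (Suc (r n))) (w (r n))" sequentially]
    by simp
  moreover have "(\<lambda>n. \<phi> (w (r n))) \<longlonglongrightarrow> \<phi> x"
    using continuous_on_tendsto_compose[OF \<phi>_cont r(3)] by auto
  ultimately show False
    using \<phi>_nz[OF r(4)] LIMSEQ_unique by blast
qed

section \<open>Windows of a perturbed descent\<close>

text \<open>Interface to the chain rule. \<open>g x\<close> stands for the support function of the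
  expected gradient map at \<open>x\<close>, so the premise of \<open>descent\<close>, taken over
  all \<open>p\<close>, is the differential inclusion for the negative derivative, scaled by
  \<open>\<tau>\<close>. Here \<open>\<tau>\<close> is the duration that has been rescaled to the
  unit interval; the value 0 covers windows that shrink to a point. Only times with a classical
  derivative are tested.\<close>

locale descent_pair =
  fixes J :: "'a::euclidean_space \<Rightarrow> real" and g :: "'a \<Rightarrow> 'a \<Rightarrow> real"
  assumes J_continuous: "continuous_on UNIV J"
    and g_usc: "\<And>x p e. e > 0 \<Longrightarrow> \<exists>d>0. \<forall>y. dist y x < d \<longrightarrow> g y p \<le> g x p + e"
    and descent: "\<And>\<gamma> L \<tau>. L-lipschitz_on {0..1} \<gamma> \<Longrightarrow> 0 \<le> \<tau> \<Longrightarrow>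
        (\<And>t d p. t \<in> {0<..<1} \<Longrightarrow> (\<gamma> has_vector_derivative d) (at t) \<Longrightarrow> - d \<bullet> p \<le> \<tau> * g (\<gamma> t) p) \<Longrightarrow>
        J (\<gamma> 1) \<le> J (\<gamma> 0) \<and>
        (J (\<gamma> 1) = J (\<gamma> 0) \<longrightarrow> 0 < \<tau> \<longrightarrow> (\<forall>t\<in>{0..1}. \<gamma> t = \<gamma> 0) \<and> (\<forall>p. 0 \<le> g (\<gamma> 0) p))"

section \<open>Time scale of the step sizes and windows of unit length\<close>

locale step_sizes =
  fixes \<alpha> :: "nat \<Rightarrow> real"
  assumes \<alpha>_pos: "\<And>k. \<alpha> k > 0" and \<alpha>_null: "\<alpha> \<longlonglongrightarrow> 0"
    and \<alpha>_sum: "filterlim (\<lambda>n. \<Sum>k<n. \<alpha> k) at_top sequentially"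
begin

definition T :: "nat \<Rightarrow> real" where
  "T k = (\<Sum>i<k. \<alpha> i)"

definition noise :: "(nat \<Rightarrow> 'a::real_vector) \<Rightarrow> nat \<Rightarrow> nat \<Rightarrow> 'a" where
  "noise \<eta> k j = (\<Sum>i\<in>{k..<j}. \<alpha> i *\<^sub>R \<eta> i)"

definition nxt :: "nat \<Rightarrow> nat" where
  "nxt k = (LEAST l. T k + 1 \<le> T l)"

definition win :: "nat \<Rightarrow> nat" where
  "win n = (nxt ^^ n) 0"

lemma T_Suc: "T (Suc k) = T k + \<alpha> k"
  by (simp add: T_def)

lemma T_mono: "i \<le> j \<Longrightarrow> T i \<le> T j"
  unfolding T_def using \<alpha>_pos by (intro sum_mono2) (auto intro: less_imp_le)

lemma T_diff: "i \<le> j \<Longrightarrow> T j - T i = (\<Sum>n\<in>{i..<j}. \<alpha> n)"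
  unfolding T_def lessThan_atLeast0 by (subst sum_diff_nat_ivl[symmetric]) auto

lemma noise_add: "k \<le> i \<Longrightarrow> i \<le> j \<Longrightarrow> noise \<eta> k j = noise \<eta> k i + noise \<eta> i j"
  unfolding noise_def by (simp add: sum.atLeastLessThan_concat)

lemma T_nxt: "T k + 1 \<le> T (nxt k)"
proof -
  have "\<exists>l. T k + 1 \<le> T l"
    using \<alpha>_sum unfolding T_def filterlim_at_top eventually_sequentially by blast
  then show ?thesis
    unfolding nxt_def by (rule LeastI_ex)
qed

lemma T_less_nxt: "j < nxt k \<Longrightarrow> T j < T k + 1"
  using not_less_Least[of j "\<lambda>l. T k + 1 \<le> T l"] by (simp add: nxt_def not_le)

lemma nxt_gt: "k < nxt k"
proof (rule ccontr)
  assume "\<not> k < nxt k"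
  then show False using T_mono[of "nxt k" k] T_nxt[of k] by simp
qed

lemma T_nxt_le: "T (nxt k) - T k \<le> 1 + \<alpha> (nxt k - 1)"
proof -
  obtain j where "nxt k = Suc j" using nxt_gt[of k] by (cases "nxt k") auto
  then show ?thesis using T_less_nxt[of j k] by (simp add: T_Suc)
qed

text \<open>The overshoot beyond length one is at most the last step of the window, whose index is
  at least \<open>k n\<close>.\<close>

lemma tendsto_T_nxt:
  assumes "filterlim k at_top sequentially"
  shows "(\<lambda>n. T (nxt (k n)) - T (k n)) \<longlonglongrightarrow> 1"
proof (rule tendsto_sandwich[of "\<lambda>_. 1" _ _ "\<lambda>n. 1 + \<alpha> (nxt (k n) - 1)"])
  have "filterlim (\<lambda>n. nxt (k n) - 1) at_top sequentially"
  proof (rule filterlim_at_top_mono[OF assms])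
    show "\<forall>\<^sub>F n in sequentially. k n \<le> nxt (k n) - 1"
      using nxt_gt by (intro always_eventually) (metis Suc_pred' diff_is_0_eq' less_Suc_eq_le less_imp_le not_less0 not_gr0)
  qed
  from filterlim_compose[OF \<alpha>_null this] show "(\<lambda>n. 1 + \<alpha> (nxt (k n) - 1)) \<longlonglongrightarrow> 1"
    by (intro tendsto_eq_intros) auto
  show "\<forall>\<^sub>F n in sequentially. 1 \<le> T (nxt (k n)) - T (k n)"
    using T_nxt by (intro always_eventually) (auto simp: le_diff_eq add.commute)
  show "\<forall>\<^sub>F n in sequentially. T (nxt (k n)) - T (k n) \<le> 1 + \<alpha> (nxt (k n) - 1)"
    using T_nxt_le by (intro always_eventually) auto
qed simp

lemma win_0 [simp]: "win 0 = 0" and win_Suc: "win (Suc n) = nxt (win n)"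
  by (simp_all add: win_def)

lemma strict_mono_win: "strict_mono win"
  by (simp add: strict_mono_Suc_iff win_Suc nxt_gt)

lemma win_ge: "n \<le> win n"
  using strict_mono_win by (rule strict_mono_imp_increasing)

lemma win_le_Suc: "win n \<le> win (Suc n)"
  using nxt_gt[of "win n"] by (simp add: win_Suc)

lemma T_win: "T (win n) \<ge> real n"
proof (induction n)
  case (Suc n)
  then show ?case using T_nxt[of "win n"] by (simp add: win_Suc)
qed (simp add: T_def)

lemma \<alpha>_bounded: "\<exists>b>0. \<forall>k. \<alpha> k \<le> b"
proof -
  obtain b where "b > 0" "\<And>k. norm (\<alpha> k) \<le> b"
    using convergent_imp_Bseq[OF convergentI[OF \<alpha>_null]] by (auto simp: Bseq_def)
  then show ?thesis by (metis abs_le_D1 real_norm_def)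
qed

lemma window_exists: "\<exists>n. win n \<le> k \<and> k < win (Suc n)"
proof (induction k)
  case 0
  show ?case using nxt_gt[of 0] by (intro exI[of _ 0]) (simp add: win_Suc)
next
  case (Suc k)
  then obtain n where n: "win n \<le> k" "k < win (Suc n)" by blast
  show ?case
  proof (cases "Suc k < win (Suc n)")
    case True
    then show ?thesis using n by (intro exI[of _ n]) auto
  next
    case False
    then have "Suc k = win (Suc n)" using n by auto
    then show ?thesis using nxt_gt[of "win (Suc n)"] by (intro exI[of _ "Suc n"]) (simp add: win_Suc)
  qed
qed

end

text \<open>One realization, stripped of probability: \<open>h k\<close> is the mean direction at
  \<open>w k\<close>, known only through its support inequality, and \<open>\<eta> k\<close> is the
  centred noise. The bound \<open>L\<close> on the mean directions makes the noiseless polygons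
  uniformly Lipschitz.\<close>

locale perturbed_descent = descent_pair J g + step_sizes \<alpha>
  for J :: "'a::euclidean_space \<Rightarrow> real" and g :: "'a \<Rightarrow> 'a \<Rightarrow> real" and \<alpha> :: "nat \<Rightarrow> real" +
  fixes w h \<eta> :: "nat \<Rightarrow> 'a" and R L :: real
  assumes w_Suc: "\<And>k. w (Suc k) = w k - \<alpha> k *\<^sub>R (h k + \<eta> k)"
    and w_le: "\<And>k. norm (w k) \<le> R" and h_le: "\<And>k. norm (h k) \<le> L"
    and h_support: "\<And>k p. h k \<bullet> p \<le> g (w k) p"
begin

section \<open>Noiseless polygons and limit curves of windows\<close>

definition clock :: "nat \<Rightarrow> real \<Rightarrow> real" where
  "clock j u = min u (T (Suc j)) - min u (T j)"

text \<open>The noiseless polygon started at time index \<open>k\<close>, stopped at index \<open>l\<close>: each \<open>clock j\<close> grows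
  with unit speed exactly on the time interval between \<open>T j\<close> and \<open>T (Suc j)\<close>.\<close>

definition polygon :: "nat \<Rightarrow> nat \<Rightarrow> real \<Rightarrow> 'a" where
  "polygon k l u = w k - (\<Sum>j\<in>{k..<l}. clock j u *\<^sub>R h j)"

lemma L_nonneg: "0 \<le> L"
  using h_le[of 0] norm_ge_zero[of "h 0"] by linarith

lemma sum_clock: "k \<le> l \<Longrightarrow> (\<Sum>j\<in>{k..<l}. clock j u) = min u (T l) - min u (T k)"
  unfolding clock_def by (rule sum_Suc_diff')

lemma clock_mono: "u \<le> u' \<Longrightarrow> clock j u \<le> clock j u'"
  using \<alpha>_pos[of j] by (auto simp: clock_def T_Suc)

text \<open>Only steps whose time interval meets the one between \<open>u\<close> and
  \<open>u'\<close> contribute to an increment of the polygon, so the bound \<open>G\<close> in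
  \<open>polygon_inclusion\<close> has to hold for just those.\<close>

lemma clock_strict:
  assumes "clock j u < clock j u'" "u \<le> u'"
  shows "u < T (Suc j)" "T j < u'"
  using assms \<alpha>_pos[of j] by (auto simp: clock_def T_Suc min_def split: if_splits)

lemma polygon_diff: "polygon k l u - polygon k l u' = (\<Sum>j\<in>{k..<l}. (clock j u' - clock j u) *\<^sub>R h j)"
  by (simp add: polygon_def sum_subtractf[symmetric] scaleR_diff_left)

lemma polygon_lipschitz:
  assumes "k \<le> l" "T k \<le> u" "u \<le> u'"
  shows "norm (polygon k l u - polygon k l u') \<le> L * (u' - u)"
proof -
  have "norm (polygon k l u - polygon k l u') \<le> (\<Sum>j\<in>{k..<l}. (clock j u' - clock j u) * L)"
    unfolding polygon_diff
    by (rule order_trans[OF norm_sum], rule sum_mono)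
      (use clock_mono[OF assms(3)] h_le in \<open>auto intro!: mult_mono\<close>)
  also have "\<dots> = L * (min u' (T l) - min u' (T k) - (min u (T l) - min u (T k)))"
    unfolding sum_clock[OF assms(1), symmetric] by (simp add: sum_distrib_left sum_subtractf[symmetric] mult.commute)
  also have "\<dots> \<le> L * (u' - u)"
    using assms L_nonneg by (intro mult_left_mono) (auto simp: min_def)
  finally show ?thesis .
qed

lemma polygon_at_T:
  assumes "k \<le> j" "j \<le> l"
  shows "polygon k l (T j) = w j + noise \<eta> k j"
proof -
  have "clock i (T j) = (if i < j then \<alpha> i else 0)" for i
    using T_mono[of i j] T_mono[of "Suc i" j] T_mono[of j i] \<alpha>_pos[of i]
    by (cases "i < j") (auto simp: clock_def T_Suc min_def)
  then have "(\<Sum>i\<in>{k..<l}. clock i (T j) *\<^sub>R h i) = (\<Sum>i\<in>{k..<l}. if i < j then \<alpha> i *\<^sub>R h i else 0)"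
    by (intro sum.cong) auto
  also have "\<dots> = (\<Sum>i\<in>{k..<j}. \<alpha> i *\<^sub>R h i)"
    using assms by (subst sum.inter_filter[symmetric]) (auto intro!: sum.cong)
  finally have "polygon k l (T j) = w k - (\<Sum>i\<in>{k..<j}. \<alpha> i *\<^sub>R h i)"
    by (simp add: polygon_def)
  moreover have "w j = w k - (\<Sum>i\<in>{k..<j}. \<alpha> i *\<^sub>R h i) - noise \<eta> k j"
    using assms(1)
    by (induction j rule: dec_induct) (auto simp: noise_def w_Suc algebra_simps)
  ultimately show ?thesis by simp
qed

text \<open>Integrated form of the differential inclusion: the increment is a combination of the
  \<open>h j\<close> with nonnegative weights of total mass \<open>u' - u\<close>.\<close>

lemma polygon_inclusion:
  assumes "k \<le> l" "T k \<le> u" "u \<le> u'" "u' \<le> T l"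
    and G: "\<And>j. k \<le> j \<Longrightarrow> j < l \<Longrightarrow> u < T (Suc j) \<Longrightarrow> T j < u' \<Longrightarrow> g (w j) p \<le> G"
  shows "(polygon k l u - polygon k l u') \<bullet> p \<le> G * (u' - u)"
proof -
  have "(polygon k l u - polygon k l u') \<bullet> p = (\<Sum>j\<in>{k..<l}. (clock j u' - clock j u) * (h j \<bullet> p))"
    by (simp add: polygon_diff inner_sum_left)
  also have "\<dots> \<le> (\<Sum>j\<in>{k..<l}. (clock j u' - clock j u) * G)"
  proof (rule sum_mono)
    fix j assume j: "j \<in> {k..<l}"
    show "(clock j u' - clock j u) * (h j \<bullet> p) \<le> (clock j u' - clock j u) * G"
    proof (cases "clock j u < clock j u'")
      case True
      have "h j \<bullet> p \<le> g (w j) p" by (rule h_support)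
      also have "\<dots> \<le> G"
        using j clock_strict[OF True assms(3)] by (intro G) auto
      finally show ?thesis
        using True by (intro mult_left_mono) auto
    next
      case False
      then show ?thesis
        using clock_mono[OF assms(3), of j] by auto
    qed
  qed
  also have "\<dots> = G * (min u' (T l) - min u' (T k) - (min u (T l) - min u (T k)))"
    unfolding sum_clock[OF assms(1), symmetric] by (simp add: sum_distrib_left sum_subtractf[symmetric] mult.commute)
  also have "\<dots> = G * (u' - u)"
    using assms by (auto simp: min_def)
  finally show ?thesis .
qed

text \<open>The grid time \<open>T j\<close> lies between \<open>u - \<alpha> j\<close> and
  \<open>u'\<close>, so the Lipschitz bound of the polygon is applied over a time of at most
  \<open>u' - u + \<alpha> j\<close>; the noise is the gap between polygon and iterate at
  \<open>T j\<close>.\<close>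

lemma polygon_near:
  assumes "k \<le> j" "j < l" "u < T (Suc j)" "T j < u'" "T k \<le> u" "u \<le> u'"
  shows "dist (w j) (polygon k l u) \<le> norm (noise \<eta> k j) + L * (u' - u + \<alpha> j)"
proof -
  have "norm (polygon k l (T j) - polygon k l u) \<le> L * (u' - u + \<alpha> j)"
  proof (cases "u \<le> T j")
    case True
    have "norm (polygon k l u - polygon k l (T j)) \<le> L * (T j - u)"
      by (rule polygon_lipschitz) (use assms True in auto)
    also have "\<dots> \<le> L * (u' - u + \<alpha> j)"
      using assms L_nonneg \<alpha>_pos[of j] by (intro mult_left_mono) auto
    finally show ?thesis by (simp add: norm_minus_commute)
  next
    case False
    have "norm (polygon k l (T j) - polygon k l u) \<le> L * (u - T j)"
      by (rule polygon_lipschitz) (use assms False T_mono[of k j] in auto)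
    also have "\<dots> \<le> L * (u' - u + \<alpha> j)"
      using assms L_nonneg T_Suc[of j] by (intro mult_left_mono) auto
    finally show ?thesis .
  qed
  moreover have eq: "w j - polygon k l u = polygon k l (T j) - polygon k l u - noise \<eta> k j"
    using assms by (simp add: polygon_at_T)
  ultimately show ?thesis
    unfolding dist_norm eq using norm_triangle_ineq4[of "polygon k l (T j) - polygon k l u" "noise \<eta> k j"] by linarith
qed

text \<open>Rescaled to the unit interval, the polygons share a bound and a Lipschitz constant, so a
  subsequence converges uniformly; as the noise vanishes, their values at grid times follow the
  iterates. The inclusion passes to the limit in integrated form over short intervals, where upper
  semicontinuity bounds \<open>g (w j) p\<close> by \<open>g (\<gamma> t) p + e\<close>, and the
  derivative is recovered afterwards. The index \<open>i\<close> marks one more iterate in each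
  window, whose limit is located on the curve.\<close>

lemma window_limit:
  fixes k l i :: "nat \<Rightarrow> nat"
  assumes k: "filterlim k at_top sequentially" and kil: "\<And>n. k n \<le> i n" "\<And>n. i n \<le> l n"
    and \<tau>: "(\<lambda>n. T (l n) - T (k n)) \<longlonglongrightarrow> \<tau>"
    and noise: "\<And>e. e > 0 \<Longrightarrow> \<forall>\<^sub>F n in sequentially. \<forall>j\<in>{k n..l n}. norm (noise \<eta> (k n) j) \<le> e"
  shows "\<exists>r \<gamma> C \<theta>. strict_mono r \<and> C-lipschitz_on {0..1} \<gamma> \<and> \<theta> \<in> {0..1}
    \<and> (\<lambda>n. w (k (r n))) \<longlonglongrightarrow> \<gamma> 0 \<and> (\<lambda>n. w (l (r n))) \<longlonglongrightarrow> \<gamma> 1 \<and> (\<lambda>n. w (i (r n))) \<longlonglongrightarrow> \<gamma> \<theta>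
    \<and> (\<forall>t\<in>{0<..<1}. \<forall>d p. (\<gamma> has_vector_derivative d) (at t) \<longrightarrow> - d \<bullet> p \<le> \<tau> * g (\<gamma> t) p)"
proof -
  have kl: "k n \<le> l n" for n
    using kil order_trans by blast
  define D where "D n = T (l n) - T (k n)" for n
  have D: "D \<longlonglongrightarrow> \<tau>" "D n \<ge> 0" for n
    using \<tau> T_mono[OF kl] by (auto simp: D_def[abs_def])
  obtain B where B: "\<And>n. D n \<le> B" "B \<ge> 0"
  proof -
    obtain B where B: "\<And>n. norm (D n) \<le> B"
      using convergent_imp_Bseq[OF convergentI[OF D(1)]] by (auto simp: Bseq_def)
    show thesis
    proof (rule that)
      show "D n \<le> B" for n using B[of n] by simp
      show "0 \<le> B" using order_trans[OF norm_ge_zero B] .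
    qed
  qed
  define Z where "Z n t = polygon (k n) (l n) (T (k n) + D n * t)" for n t
  have Z_lip: "norm (Z n t - Z n t') \<le> L * D n * \<bar>t' - t\<bar>" if "0 \<le> t" "0 \<le> t'" for n t t'
  proof -
    have *: "norm (Z n t - Z n t') \<le> L * D n * (t' - t)" if "0 \<le> t" "t \<le> t'" for t t'
    proof -
      have "D n * t \<le> D n * t'" "0 \<le> D n * t"
        using that D(2)[of n] by (auto intro: mult_left_mono)
      then have "norm (Z n t - Z n t') \<le> L * (D n * t' - D n * t)"
        using polygon_lipschitz[OF kl[of n], of "T (k n) + D n * t" "T (k n) + D n * t'"] by (simp add: Z_def)
      then show ?thesis
        by (simp add: right_diff_distrib mult.assoc)
    qed
    show ?thesis
    proof (cases "t \<le> t'")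
      case True
      then show ?thesis using *[of t t'] that by simp
    next
      case False
      then show ?thesis using *[of t' t] that by (simp add: norm_minus_commute)
    qed
  qed
  have Z_lipB: "norm (Z n t - Z n t') \<le> L * B * \<bar>t' - t\<bar>" if "0 \<le> t" "0 \<le> t'" for n t t'
    using Z_lip[OF that, of n] B(1)[of n] L_nonneg
    by (elim order_trans) (intro mult_right_mono mult_left_mono, auto)
  have Z0: "Z n 0 = w (k n)" for n
    using polygon_at_T[of "k n" "k n" "l n"] kl[of n] by (simp add: Z_def noise_def)
  have Z_bdd: "norm (Z n t) \<le> R + L * B" if "t \<in> {0..1}" for n t
  proof -
    have "norm (Z n t) \<le> norm (Z n 0) + norm (Z n t - Z n 0)"
      using norm_triangle_sub by blast
    also have "norm (Z n t - Z n 0) \<le> L * B * 1"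
      using Z_lipB[of t 0 n] that L_nonneg B(2) mult_left_mono[of t 1 "L * B"] by auto
    finally show ?thesis
      using w_le[of "k n"] by (simp add: Z0)
  qed
  obtain \<gamma> and s :: "nat \<Rightarrow> nat" where s: "strict_mono s"
    and unif: "\<And>e. 0 < e \<Longrightarrow> \<exists>N. \<forall>n x. n \<ge> N \<and> x \<in> {0..1} \<longrightarrow> norm (Z (s n) x - \<gamma> x) < e"
  proof (rule Arzela_Ascoli[of "{0..1::real}" Z "R + L * B"])
    fix x e :: real assume "x \<in> {0..1}" "0 < e"
    have LB: "0 < L * B + 1"
      using L_nonneg B(2) by (simp add: add_nonneg_pos)
    have "norm (Z n x - Z n y) < e" if "y \<in> {0..1}" "norm (x - y) < e / (L * B + 1)" for n y
    proof -
      have "norm (Z n x - Z n y) \<le> L * B * \<bar>y - x\<bar>"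
        by (rule Z_lipB) (use that \<open>x \<in> {0..1}\<close> in auto)
      also have "\<dots> \<le> (L * B + 1) * norm (x - y)"
        by (simp add: algebra_simps abs_minus_commute)
      also have "\<dots> < e"
        using that(2) LB by (simp add: pos_less_divide_eq mult.commute)
      finally show ?thesis .
    qed
    then show "\<exists>d. 0 < d \<and> (\<forall>n y. y \<in> {0..1} \<and> norm (x - y) < d \<longrightarrow> norm (Z n x - Z n y) < e)"
      using LB \<open>0 < e\<close> by (intro exI[of _ "e / (L * B + 1)"]) (auto intro!: divide_pos_pos)
  qed (use Z_bdd in auto)
  have pw: "(\<lambda>n. Z (s n) x) \<longlonglongrightarrow> \<gamma> x" if "x \<in> {0..1}" for x
    unfolding LIMSEQ_iff using unif that by blast
  \<comment> \<open>Relative position of \<open>i n\<close> in its window. For a window of zero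
    duration the quotient is 0 by convention, which is still consistent with
    \<open>\<theta>_mult\<close>.\<close>
  define \<theta> where "\<theta> n = (T (i n) - T (k n)) / D n" for n
  have Ti: "T (k n) \<le> T (i n)" "T (i n) \<le> T (l n)" for n
    using T_mono kil by auto
  have \<theta>_mult: "D n * \<theta> n = T (i n) - T (k n)" for n
    using Ti[of n] by (auto simp: \<theta>_def D_def)
  have \<theta>01: "\<theta> n \<in> {0..1}" for n
    using Ti[of n] by (auto simp: \<theta>_def D_def divide_simps)
  obtain \<theta>' and s' :: "nat \<Rightarrow> nat" where s': "\<theta>' \<in> {0..1}" "strict_mono s'" "(\<theta> \<circ> s \<circ> s') \<longlonglongrightarrow> \<theta>'"
    using compact_Icc[of 0 "1::real", unfolded compact_def, rule_format, of "\<theta> \<circ> s"] \<theta>01 by auto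
  define r where "r = s \<circ> s'"
  have r: "strict_mono r"
    unfolding r_def using s s'(2) by (rule strict_mono_o)
  have r_at_top: "filterlim r at_top sequentially"
    using r by (rule filterlim_subseq)
  have pwr: "(\<lambda>n. Z (r n) x) \<longlonglongrightarrow> \<gamma> x" if "x \<in> {0..1}" for x
    using LIMSEQ_subseq_LIMSEQ[OF pw[OF that] s'(2)] by (simp add: r_def o_def)
  have noise_r: "(\<lambda>n. noise \<eta> (k (r n)) (j (r n))) \<longlonglongrightarrow> 0" if "\<And>n. j n \<in> {k n..l n}" for j
  proof (rule tendstoI)
    fix e :: real assume "e > 0"
    then have "\<forall>\<^sub>F n in sequentially. \<forall>j\<in>{k n..l n}. norm (noise \<eta> (k n) j) \<le> e / 2"
      by (intro noise) auto
    then have "\<forall>\<^sub>F n in sequentially. \<forall>j\<in>{k (r n)..l (r n)}. norm (noise \<eta> (k (r n)) j) \<le> e / 2"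
      using r_at_top by (rule eventually_compose_filterlim)
    then show "\<forall>\<^sub>F n in sequentially. dist (noise \<eta> (k (r n)) (j (r n))) 0 < e"
    proof (rule eventually_mono)
      fix n assume "\<forall>j\<in>{k (r n)..l (r n)}. norm (noise \<eta> (k (r n)) j) \<le> e / 2"
      then have "norm (noise \<eta> (k (r n)) (j (r n))) \<le> e / 2" using that by blast
      then show "dist (noise \<eta> (k (r n)) (j (r n))) 0 < e" using \<open>e > 0\<close> by (simp add: field_simps)
    qed
  qed
  have \<gamma>_lip: "(L * B)-lipschitz_on {0..1} \<gamma>"
  proof (rule lipschitz_onI)
    fix x y :: real assume xy: "x \<in> {0..1}" "y \<in> {0..1}"
    have "(\<lambda>n. norm (Z (r n) x - Z (r n) y)) \<longlonglongrightarrow> norm (\<gamma> x - \<gamma> y)"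
      by (intro tendsto_intros pwr xy)
    moreover have "norm (Z (r n) x - Z (r n) y) \<le> L * B * dist x y" for n
      using Z_lipB[of x y "r n"] xy by (simp add: dist_real_def abs_minus_commute)
    ultimately show "dist (\<gamma> x) (\<gamma> y) \<le> L * B * dist x y"
      unfolding dist_norm[of "\<gamma> x"] by (intro LIMSEQ_le_const2) auto
  qed (use L_nonneg B in auto)
  have lim_k: "(\<lambda>n. w (k (r n))) \<longlonglongrightarrow> \<gamma> 0"
    using pwr[of 0] by (simp add: Z0)
  have lim_l: "(\<lambda>n. w (l (r n))) \<longlonglongrightarrow> \<gamma> 1"
  proof -
    have "w (l n) = Z n 1 - noise \<eta> (k n) (l n)" for n
      using polygon_at_T[of "k n" "l n" "l n"] kl[of n] by (simp add: Z_def D_def)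
    then show ?thesis
      using tendsto_diff[OF pwr[of 1] noise_r[of l]] kl by simp
  qed
  have lim_i: "(\<lambda>n. w (i (r n))) \<longlonglongrightarrow> \<gamma> \<theta>'"
  proof -
    have eq: "w (i n) = Z n (\<theta> n) - noise \<eta> (k n) (i n)" for n
      using polygon_at_T[of "k n" "i n" "l n"] kil[of n] \<theta>_mult[of n] by (simp add: Z_def)
    have "(\<lambda>n. Z (r n) (\<theta> (r n)) - Z (r n) \<theta>') \<longlonglongrightarrow> 0"
    proof (rule Lim_null_comparison)
      show "\<forall>\<^sub>F n in sequentially. norm (Z (r n) (\<theta> (r n)) - Z (r n) \<theta>') \<le> L * B * \<bar>\<theta>' - \<theta> (r n)\<bar>"
        using Z_lipB \<theta>01 s'(1) by (intro always_eventually) auto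
      have "(\<lambda>n. L * B * \<bar>\<theta>' - \<theta> (r n)\<bar>) \<longlonglongrightarrow> L * B * \<bar>\<theta>' - \<theta>'\<bar>"
        using s'(3) by (intro tendsto_intros) (simp add: r_def o_def)
      then show "(\<lambda>n. L * B * \<bar>\<theta>' - \<theta> (r n)\<bar>) \<longlonglongrightarrow> 0" by simp
    qed
    from tendsto_add[OF this pwr[OF s'(1)]] have "(\<lambda>n. Z (r n) (\<theta> (r n))) \<longlonglongrightarrow> \<gamma> \<theta>'" by simp
    from tendsto_diff[OF this noise_r[of i]] show ?thesis
      using kil by (simp add: eq)
  qed
  have "- d \<bullet> p \<le> \<tau> * g (\<gamma> t) p"
    if t: "t \<in> {0<..<1}" and der: "(\<gamma> has_vector_derivative d) (at t)" for t d p
  proof (rule field_le_epsilon)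
    fix e' :: real assume "e' > 0"
    \<comment> \<open>The error \<open>\<tau> * e\<close> is then at most \<open>e'\<close>, since
      \<open>\<tau> \<le> B\<close>.\<close>
    define e where "e = e' / (B + 1)"
    have "e > 0" using \<open>e' > 0\<close> B(2) by (auto simp: e_def)
    obtain \<delta> where \<delta>: "\<delta> > 0" "\<And>y. dist y (\<gamma> t) < \<delta> \<Longrightarrow> g y p \<le> g (\<gamma> t) p + e"
      using g_usc[OF \<open>e > 0\<close>] by blast
    define G where "G = g (\<gamma> t) p + e"
    \<comment> \<open>Four quarters of \<open>\<delta>\<close> are spent on the noise, the motion of
      the polygon during a time of at most \<open>x\<close>, a single step, and the distance of
      \<open>Z (r n) t\<close> from \<open>\<gamma> t\<close>. The summand 1 keeps the denominator
      positive.\<close>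
    define x where "x = \<delta> / (4 * (L * B + 1))"
    have "x > 0" "L * B * x < \<delta> / 4"
    proof -
      show "x > 0" using \<delta>(1) L_nonneg B(2) by (auto simp: x_def intro!: divide_pos_pos add_nonneg_pos)
      moreover have "(L * B + 1) * x = \<delta> / 4"
      proof -
        define K where "K = L * B + 1"
        have "K > 0" using L_nonneg B(2) by (simp add: K_def add_nonneg_pos)
        then show ?thesis unfolding x_def K_def[symmetric] by simp
      qed
      ultimately show "L * B * x < \<delta> / 4" by (simp add: algebra_simps)
    qed
    have quotient: "(\<gamma> t - \<gamma> t') \<bullet> p \<le> G * \<tau> * (t' - t)" if t': "t < t'" "t' < 1" "t' \<le> t + x" for t'
    proof (rule tendsto_le[of sequentially])
      show "(\<lambda>n. (Z (r n) t - Z (r n) t') \<bullet> p) \<longlonglongrightarrow> (\<gamma> t - \<gamma> t') \<bullet> p"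
        using t t' by (intro tendsto_intros pwr) auto
      show "(\<lambda>n. G * D (r n) * (t' - t)) \<longlonglongrightarrow> G * \<tau> * (t' - t)"
        by (intro tendsto_intros LIMSEQ_subseq_LIMSEQ[OF D(1) r, unfolded o_def])
      have a: "\<forall>\<^sub>F n in sequentially. \<forall>j\<in>{k (r n)..l (r n)}. norm (noise \<eta> (k (r n)) j) \<le> \<delta> / 4"
        by (rule eventually_compose_filterlim[OF noise r_at_top]) (use \<delta>(1) in simp)
      have b: "\<forall>\<^sub>F n in sequentially. dist (Z (r n) t) (\<gamma> t) < \<delta> / 4"
        by (rule tendstoD[OF pwr]) (use t \<delta>(1) in auto)
      have c: "\<forall>\<^sub>F n in sequentially. \<forall>j\<ge>k (r n). L * \<alpha> j < \<delta> / 4"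
      proof -
        have "(\<lambda>j. L * \<alpha> j) \<longlonglongrightarrow> L * 0" by (intro tendsto_intros \<alpha>_null)
        then have "\<forall>\<^sub>F j in sequentially. L * \<alpha> j < \<delta> / 4"
          using \<delta>(1) by (intro order_tendstoD) auto
        then obtain N where N: "\<And>j. j \<ge> N \<Longrightarrow> L * \<alpha> j < \<delta> / 4"
          by (auto simp: eventually_sequentially)
        have "\<forall>\<^sub>F n in sequentially. N \<le> k (r n)"
          using filterlim_compose[OF k r_at_top] by (auto simp: filterlim_at_top)
        then show ?thesis by (rule eventually_mono) (use N in auto)
      qed
      show "\<forall>\<^sub>F n in sequentially. (Z (r n) t - Z (r n) t') \<bullet> p \<le> G * D (r n) * (t' - t)"
        using a b c
      proof eventually_elim
        case (elim n)
        let ?n = "r n"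
        let ?u = "T (k ?n) + D ?n * t" and ?u' = "T (k ?n) + D ?n * t'"
        have u: "T (k ?n) \<le> ?u" "?u \<le> ?u'" "?u' \<le> T (l ?n)"
        proof -
          have "D ?n * t \<le> D ?n * t'" "0 \<le> D ?n * t" "D ?n * t' \<le> D ?n * 1"
            using t t' D(2)[of ?n] by (auto intro!: mult_left_mono mult_nonneg_nonneg simp del: mult_1_right)
          then show "T (k ?n) \<le> ?u" "?u \<le> ?u'" "?u' \<le> T (l ?n)"
            by (auto simp: D_def)
        qed
        have "(Z ?n t - Z ?n t') \<bullet> p \<le> G * (?u' - ?u)"
          unfolding Z_def
        proof (rule polygon_inclusion[OF kl u])
          fix j assume j: "k ?n \<le> j" "j < l ?n" "?u < T (Suc j)" "T j < ?u'"
          have "dist (w j) (Z ?n t) \<le> norm (noise \<eta> (k ?n) j) + L * (?u' - ?u + \<alpha> j)"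
            unfolding Z_def by (rule polygon_near) (use j u in auto)
          moreover have "norm (noise \<eta> (k ?n) j) \<le> \<delta> / 4"
            using elim(1) j by auto
          moreover have "L * (?u' - ?u) \<le> L * B * x"
          proof -
            have "D ?n * (t' - t) \<le> B * x"
              using B t' D(2) by (intro mult_mono) auto
            from mult_left_mono[OF this L_nonneg] show ?thesis
              by (simp add: algebra_simps)
          qed
          moreover have "L * \<alpha> j < \<delta> / 4"
            using elim(3) j by auto
          ultimately have "dist (w j) (\<gamma> t) < \<delta>"
            using elim(2) \<open>L * B * x < \<delta> / 4\<close> dist_triangle[of "w j" "\<gamma> t" "Z ?n t"]
            unfolding distrib_left by linarith
          then show "g (w j) p \<le> G"
            unfolding G_def by (rule \<delta>(2))
        qed
        then show ?case by (simp add: algebra_simps)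
      qed
    qed simp
    \<comment> \<open>Divide the integrated inclusion by the length of the interval and let its
      right end approach \<open>t\<close>.\<close>
    have "- d \<bullet> p \<le> G * \<tau>"
    proof (rule tendsto_le[of "at_right t"])
      have "((\<lambda>y. \<gamma> y \<bullet> p) has_real_derivative d \<bullet> p) (at t)"
        using bounded_linear.has_vector_derivative[OF bounded_linear_inner_left der]
        by (simp add: has_real_derivative_iff_has_vector_derivative)
      from DERIV_minus[OF this]
      have "((\<lambda>y. - (\<gamma> y \<bullet> p)) has_real_derivative - d \<bullet> p) (at t within {t<..})"
        by (simp add: has_field_derivative_at_within)
      then show "((\<lambda>y. (- (\<gamma> y \<bullet> p) - - (\<gamma> t \<bullet> p)) / (y - t)) \<longlongrightarrow> - d \<bullet> p) (at_right t)"
        by (simp add: has_field_derivative_iff)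
      show "((\<lambda>_. G * \<tau>) \<longlongrightarrow> G * \<tau>) (at_right t)" by simp
      have "\<forall>\<^sub>F y in at_right t. y \<in> {t<..<min 1 (t + x)}"
        using t \<open>x > 0\<close> by (intro eventually_at_right_real) auto
      then show "\<forall>\<^sub>F y in at_right t. (- (\<gamma> y \<bullet> p) - - (\<gamma> t \<bullet> p)) / (y - t) \<le> G * \<tau>"
      proof (rule eventually_mono)
        fix y assume y: "y \<in> {t<..<min 1 (t + x)}"
        then show "(- (\<gamma> y \<bullet> p) - - (\<gamma> t \<bullet> p)) / (y - t) \<le> G * \<tau>"
          using quotient[of y] by (simp add: divide_le_eq inner_diff_left)
      qed
    qed simp
    also have "\<dots> \<le> \<tau> * g (\<gamma> t) p + e'"
    proof -
      have "\<tau> \<le> B" by (rule LIMSEQ_le_const2[OF D(1)]) (use B in auto)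
      then have "\<tau> * e \<le> B * e" using \<open>e > 0\<close> by simp
      also have "\<dots> \<le> e'" using B(2) \<open>e' > 0\<close> by (simp add: e_def field_simps)
      finally show ?thesis by (simp add: G_def algebra_simps)
    qed
    finally show "- d \<bullet> p \<le> \<tau> * g (\<gamma> t) p + e'" .
  qed
  then show ?thesis
    by (intro exI[of _ r] exI[of _ \<gamma>] exI[of _ "L * B"] exI[of _ \<theta>'] conjI r \<gamma>_lip s'(1) lim_k lim_l lim_i) blast
qed

end

text \<open>A bounded sequence has an accumulation point \<open>z\<close>. Failing to converge to it
  means leaving the radius \<open>3 * e / 4\<close> recurrently while returning within
  \<open>e / 2\<close>; on one side this gives two distinct levels crossed recurrently, which
  \<open>osc\<close> forbids.\<close>

lemma bounded_real_convergentI: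
  fixes y :: "nat \<Rightarrow> real"
  assumes bdd: "bounded (range y)"
    and osc: "\<And>a b. a < b \<Longrightarrow> \<exists>\<^sub>F n in sequentially. y n < a \<Longrightarrow> \<exists>\<^sub>F n in sequentially. b < y n \<Longrightarrow> False"
  shows "convergent y"
proof -
  obtain z :: real where acc: "accumulation_point y z"
    using bounded_frequently_accumulation[OF bdd, of "\<lambda>_. True"] by auto
  have "y \<longlonglongrightarrow> z"
  proof (rule tendstoI, rule ccontr)
    fix e :: real assume "e > 0"
    assume "\<not> (\<forall>\<^sub>F n in sequentially. dist (y n) z < e)"
    then have "\<exists>\<^sub>F n in sequentially. z + e * 3 / 4 < y n \<or> y n < z - e * 3 / 4"
      unfolding not_eventually
    proof (rule frequently_elim1)
      fix n assume "\<not> dist (y n) z < e"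
      then show "z + e * 3 / 4 < y n \<or> y n < z - e * 3 / 4"
        using \<open>e > 0\<close> unfolding dist_real_def by linarith
    qed
    moreover have near: "\<exists>\<^sub>F n in sequentially. dist (y n) z < e / 2"
      by (rule accumulation_point_iff_frequently[THEN iffD1, OF acc, rule_format]) (use \<open>e > 0\<close> in simp)
    have "\<exists>\<^sub>F n in sequentially. y n < z + e / 2" "\<exists>\<^sub>F n in sequentially. z - e / 2 < y n"
      by (rule frequently_elim1[OF near], unfold dist_real_def, linarith)+
    ultimately show False
      using osc[of "z + e / 2" "z + e * 3 / 4"] osc[of "z - e * 3 / 4" "z - e / 2"] \<open>e > 0\<close>
      unfolding frequently_disj_iff by auto
  qed
  then show ?thesis by (rule convergentI)
qed

section \<open>Descent on quiet windows and essential accumulation points\<close>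

context perturbed_descent
begin

lemma J_lim: "X \<longlonglongrightarrow> x \<Longrightarrow> (\<lambda>n. J (X n)) \<longlonglongrightarrow> J x"
  using continuous_on_tendsto_compose[OF J_continuous] by auto

lemma w_bounded: "bounded (range w)"
  using w_le by (auto simp: bounded_iff)

lemma J_bounded: "\<exists>K>0. \<forall>k. \<bar>J (w k)\<bar> \<le> K"
proof -
  have "compact (J ` cball 0 R)"
    using J_continuous continuous_on_subset by (intro compact_continuous_image) auto
  then obtain K where "K > 0" "\<forall>x\<in>J ` cball 0 R. norm x \<le> K"
    using compact_imp_bounded bounded_pos by blast
  then show ?thesis using w_le by (intro exI[of _ K]) auto
qed

text \<open>The limit curve does not lower \<open>J\<close>, hence is constant and critical by the
  equality case of \<open>descent\<close>; the tracked point \<open>x\<close> is therefore its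
  starting point.\<close>

lemma window_critical:
  fixes k l i :: "nat \<Rightarrow> nat"
  assumes k: "filterlim k at_top sequentially" and kil: "\<And>n. k n \<le> i n" "\<And>n. i n \<le> l n"
    and \<tau>: "(\<lambda>n. T (l n) - T (k n)) \<longlonglongrightarrow> \<tau>" "\<tau> > 0"
    and noise: "\<And>e. e > 0 \<Longrightarrow> \<forall>\<^sub>F n in sequentially. \<forall>j\<in>{k n..l n}. norm (noise \<eta> (k n) j) \<le> e"
    and x: "(\<lambda>n. w (i n)) \<longlonglongrightarrow> x"
    and no_descent: "\<And>c. c > 0 \<Longrightarrow> \<forall>\<^sub>F n in sequentially. J (w (l n)) - J (w (k n)) \<ge> - c"
  shows "0 \<le> g x p"
proof -
  obtain r \<gamma> C \<theta> where r: "strict_mono r" and \<gamma>: "C-lipschitz_on {0..1} \<gamma>" and \<theta>: "\<theta> \<in> {0..1}"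
    and lims: "(\<lambda>n. w (k (r n))) \<longlonglongrightarrow> \<gamma> 0" "(\<lambda>n. w (l (r n))) \<longlonglongrightarrow> \<gamma> 1" "(\<lambda>n. w (i (r n))) \<longlonglongrightarrow> \<gamma> \<theta>"
    and incl: "\<forall>t\<in>{0<..<1}. \<forall>d p. (\<gamma> has_vector_derivative d) (at t) \<longrightarrow> - d \<bullet> p \<le> \<tau> * g (\<gamma> t) p"
    using window_limit[OF k kil \<tau>(1) noise] by auto
  have lim: "(\<lambda>n. J (w (l (r n))) - J (w (k (r n)))) \<longlonglongrightarrow> J (\<gamma> 1) - J (\<gamma> 0)"
    by (intro tendsto_diff J_lim lims)
  have lower: "J (\<gamma> 1) - J (\<gamma> 0) \<ge> - c" if "c > 0" for c
  proof (rule tendsto_lowerbound[OF lim])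
    show "\<forall>\<^sub>F n in sequentially. J (w (l (r n))) - J (w (k (r n))) \<ge> - c"
      by (rule eventually_compose_filterlim[OF no_descent[OF that] filterlim_subseq[OF r]])
  qed simp
  have "J (\<gamma> 1) \<ge> J (\<gamma> 0)"
  proof (rule field_le_epsilon)
    fix c :: real assume "c > 0"
    from lower[OF this] show "J (\<gamma> 0) \<le> J (\<gamma> 1) + c" by simp
  qed
  moreover have "J (\<gamma> 1) \<le> J (\<gamma> 0) \<and>
      (J (\<gamma> 1) = J (\<gamma> 0) \<longrightarrow> 0 < \<tau> \<longrightarrow> (\<forall>t\<in>{0..1}. \<gamma> t = \<gamma> 0) \<and> (\<forall>p. 0 \<le> g (\<gamma> 0) p))"
    by (rule descent[OF \<gamma>]) (use \<tau> incl in auto)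
  ultimately have "(\<forall>t\<in>{0..1}. \<gamma> t = \<gamma> 0) \<and> (\<forall>p. 0 \<le> g (\<gamma> 0) p)"
    using \<tau>(2) by (meson order.antisym)
  then have "\<gamma> \<theta> = \<gamma> 0" "0 \<le> g (\<gamma> 0) p"
    using \<theta> by blast+
  moreover have "\<gamma> \<theta> = x"
    using LIMSEQ_unique[OF lims(3) LIMSEQ_subseq_LIMSEQ[OF x r, unfolded o_def]] .
  ultimately show ?thesis by simp
qed

text \<open>The durations are only bounded, so a subsequence with converging durations is taken
  first. Their limit may be 0, which is why \<open>descent\<close> admits
  \<open>\<tau> = 0\<close>.\<close>

lemma window_descent:
  fixes k l :: "nat \<Rightarrow> nat"
  assumes k: "filterlim k at_top sequentially" and kl: "\<And>n. k n \<le> l n"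
    and B: "\<forall>\<^sub>F n in sequentially. T (l n) - T (k n) \<le> B"
    and noise: "\<And>e. e > 0 \<Longrightarrow> \<forall>\<^sub>F n in sequentially. \<forall>j\<in>{k n..l n}. norm (noise \<eta> (k n) j) \<le> e"
    and "e > 0"
  shows "\<forall>\<^sub>F n in sequentially. J (w (l n)) - J (w (k n)) < e"
proof (rule ccontr)
  assume "\<not> ?thesis"
  then have "\<exists>\<^sub>F n in sequentially. \<not> J (w (l n)) - J (w (k n)) < e \<and> T (l n) - T (k n) \<le> B"
    unfolding not_eventually using B by (rule frequently_eventually_frequently)
  then obtain r :: "nat \<Rightarrow> nat" where r: "strict_mono r"
    "\<And>n. \<not> J (w (l (r n))) - J (w (k (r n))) < e \<and> T (l (r n)) - T (k (r n)) \<le> B"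
    using frequently_subseq by force
  have "\<forall>n. T (l (r n)) - T (k (r n)) \<in> {0..B}"
    using r(2) T_mono[OF kl] by auto
  then obtain \<tau> and s :: "nat \<Rightarrow> nat" where s: "\<tau> \<in> {0..B}" "strict_mono s"
      "((\<lambda>n. T (l (r n)) - T (k (r n))) \<circ> s) \<longlonglongrightarrow> \<tau>"
    using compact_Icc[of 0 B, unfolded compact_def, rule_format, of "\<lambda>n. T (l (r n)) - T (k (r n))"] by auto
  define q where "q = r \<circ> s"
  have q: "strict_mono q" unfolding q_def using r(1) s(2) by (rule strict_mono_o)
  have q_top: "filterlim q at_top sequentially" using q by (rule filterlim_subseq)
  have "\<exists>r \<gamma> C \<theta>. strict_mono r \<and> C-lipschitz_on {0..1} \<gamma> \<and> \<theta> \<in> {0..1}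
    \<and> (\<lambda>n. w (k (q (r n)))) \<longlonglongrightarrow> \<gamma> 0 \<and> (\<lambda>n. w (l (q (r n)))) \<longlonglongrightarrow> \<gamma> 1 \<and> (\<lambda>n. w (k (q (r n)))) \<longlonglongrightarrow> \<gamma> \<theta>
    \<and> (\<forall>t\<in>{0<..<1}. \<forall>d p. (\<gamma> has_vector_derivative d) (at t) \<longrightarrow> - d \<bullet> p \<le> \<tau> * g (\<gamma> t) p)"
  proof (rule window_limit)
    show "filterlim (\<lambda>n. k (q n)) at_top sequentially"
      using k q_top by (rule filterlim_compose)
    show "(\<lambda>n. T (l (q n)) - T (k (q n))) \<longlonglongrightarrow> \<tau>"
      using s(3) by (simp add: q_def o_def)
    show "\<forall>\<^sub>F n in sequentially. \<forall>j\<in>{k (q n)..l (q n)}. norm (noise \<eta> (k (q n)) j) \<le> e" if "e > 0" for e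
      by (rule eventually_compose_filterlim[OF noise[OF that] q_top])
  qed (use kl in auto)
  then obtain r' \<gamma> C \<theta> where r': "strict_mono r'" and \<gamma>: "C-lipschitz_on {0..1} \<gamma>"
    and lims: "(\<lambda>n. w (k (q (r' n)))) \<longlonglongrightarrow> \<gamma> 0" "(\<lambda>n. w (l (q (r' n)))) \<longlonglongrightarrow> \<gamma> 1"
    and incl: "\<forall>t\<in>{0<..<1}. \<forall>d p. (\<gamma> has_vector_derivative d) (at t) \<longrightarrow> - d \<bullet> p \<le> \<tau> * g (\<gamma> t) p"
    by blast
  have "(\<lambda>n. J (w (l (q (r' n)))) - J (w (k (q (r' n))))) \<longlonglongrightarrow> J (\<gamma> 1) - J (\<gamma> 0)"
    by (intro tendsto_diff J_lim lims)
  then have "e \<le> J (\<gamma> 1) - J (\<gamma> 0)"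
    by (rule LIMSEQ_le_const) (use r(2) in \<open>auto simp: q_def not_less\<close>)
  moreover have "J (\<gamma> 1) \<le> J (\<gamma> 0)"
    by (rule descent[OF \<gamma>, of \<tau>, THEN conjunct1]) (use s(1) incl in auto)
  ultimately show False using \<open>e > 0\<close> by simp
qed

abbreviation loud :: "real \<Rightarrow> nat \<Rightarrow> bool" where
  "loud e n \<equiv> \<exists>j\<in>{win n..win (Suc n)}. norm (noise \<eta> (win n) j) > e"

lemma quiet_subseq:
  assumes "\<And>q. \<not> loud (1 / real (Suc q)) (n q)" "e > 0"
  shows "\<forall>\<^sub>F q in sequentially. \<forall>j\<in>{win (n q)..win (Suc (n q))}. norm (noise \<eta> (win (n q)) j) \<le> e"
proof -
  have "(\<lambda>q. 1 / real (Suc q)) \<longlonglongrightarrow> 0"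
    by (rule lim_const_over_n[THEN LIMSEQ_Suc])
  then have "\<forall>\<^sub>F q in sequentially. 1 / real (Suc q) < e"
    using \<open>e > 0\<close> by (rule order_tendstoD)
  then show ?thesis
    by (rule eventually_mono) (use assms(1) in \<open>force simp: not_less\<close>)
qed

text \<open>If it failed, violating windows with thresholds \<open>1 / real (Suc q)\<close> would
  form a sequence with vanishing noise, to which \<open>window_descent\<close> applies.\<close>

lemma quiet_descent:
  assumes "e > 0"
  shows "\<exists>e'>0. \<exists>n0. \<forall>n\<ge>n0. \<not> loud e' n \<longrightarrow> J (w (win (Suc n))) - J (w (win n)) < e"
proof (rule ccontr)
  assume *: "\<not> ?thesis"
  have "\<exists>n\<ge>q. \<not> loud (1 / real (Suc q)) n \<and> \<not> J (w (win (Suc n))) - J (w (win n)) < e" for q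
  proof -
    have "1 / real (Suc q) > 0" by simp
    with * show ?thesis by blast
  qed
  then obtain n where n: "\<And>q. n q \<ge> q" "\<And>q. \<not> loud (1 / real (Suc q)) (n q)"
      "\<And>q. \<not> J (w (win (Suc (n q)))) - J (w (win (n q))) < e"
    by metis
  have top: "filterlim (\<lambda>q. win (n q)) at_top sequentially"
    by (rule filterlim_at_top_mono[OF filterlim_ident])
      (use n(1) win_ge in \<open>auto intro!: always_eventually intro: order_trans\<close>)
  have "(\<lambda>q. T (win (Suc (n q))) - T (win (n q))) \<longlonglongrightarrow> 1"
    unfolding win_Suc using tendsto_T_nxt[OF top] .
  then have "\<forall>\<^sub>F q in sequentially. T (win (Suc (n q))) - T (win (n q)) < 2"
    by (rule order_tendstoD) simp
  then have "\<forall>\<^sub>F q in sequentially. T (win (Suc (n q))) - T (win (n q)) \<le> 2"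
    by (rule eventually_mono) simp
  from window_descent[OF top win_le_Suc this quiet_subseq[OF n(2)] \<open>e > 0\<close>]
  have "\<forall>\<^sub>F q in sequentially. J (w (win (Suc (n q)))) - J (w (win (n q))) < e" by blast
  then show False
    using n(3) by (simp add: eventually_sequentially)
qed

text \<open>A diagonal argument with \<open>window_critical\<close>. The single constant
  \<open>c\<close> serves as noise threshold, as radius and as amount of descent, because all three
  are sent to 0 together.\<close>

lemma quiet_visit_descent:
  assumes x: "\<not> (\<forall>p. 0 \<le> g x p)"
  shows "\<exists>c>0. \<exists>n0. \<forall>n\<ge>n0. \<not> loud c n \<longrightarrow> (\<exists>i\<in>{win n..win (Suc n)}. dist (w i) x < c) \<longrightarrow>
    J (w (win (Suc n))) - J (w (win n)) \<le> - c"
proof (rule ccontr)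
  assume *: "\<not> ?thesis"
  have "\<exists>n\<ge>q. \<exists>i\<in>{win n..win (Suc n)}. \<not> loud (1 / real (Suc q)) n \<and> dist (w i) x < 1 / real (Suc q)
     \<and> \<not> J (w (win (Suc n))) - J (w (win n)) \<le> - (1 / real (Suc q))" for q
  proof -
    have "1 / real (Suc q) > 0" by simp
    with * have "\<not> (\<forall>n\<ge>q. \<not> loud (1 / real (Suc q)) n \<longrightarrow>
        (\<exists>i\<in>{win n..win (Suc n)}. dist (w i) x < 1 / real (Suc q)) \<longrightarrow>
        J (w (win (Suc n))) - J (w (win n)) \<le> - (1 / real (Suc q)))"
      by metis
    then show ?thesis by metis
  qed
  then obtain n i where n: "\<And>q. n q \<ge> q" "\<And>q. \<not> loud (1 / real (Suc q)) (n q)"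
      "\<And>q. i q \<in> {win (n q)..win (Suc (n q))}" "\<And>q. dist (w (i q)) x < 1 / real (Suc q)"
      "\<And>q. \<not> J (w (win (Suc (n q)))) - J (w (win (n q))) \<le> - (1 / real (Suc q))"
    by metis
  have null: "(\<lambda>q. 1 / real (Suc q)) \<longlonglongrightarrow> 0"
    by (rule lim_const_over_n[THEN LIMSEQ_Suc])
  have top: "filterlim (\<lambda>q. win (n q)) at_top sequentially"
    by (rule filterlim_at_top_mono[OF filterlim_ident])
      (use n(1) win_ge in \<open>auto intro!: always_eventually intro: order_trans\<close>)
  have "0 \<le> g x p" for p
  proof (rule window_critical[OF top, of i "\<lambda>q. win (Suc (n q))" 1])
    show "(\<lambda>q. T (win (Suc (n q))) - T (win (n q))) \<longlonglongrightarrow> 1"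
      unfolding win_Suc using tendsto_T_nxt[OF top] .
    show "(\<lambda>q. w (i q)) \<longlonglongrightarrow> x"
      by (rule metric_tendsto_imp_tendsto[OF null]) (use n(4) in \<open>auto intro!: always_eventually less_imp_le\<close>)
    show "\<forall>\<^sub>F q in sequentially. - c \<le> J (w (win (Suc (n q)))) - J (w (win (n q)))" if "c > 0" for c
    proof -
      have "\<forall>\<^sub>F q in sequentially. 1 / real (Suc q) < c"
        using null that by (rule order_tendstoD)
      then show ?thesis
        by (rule eventually_mono) (use n(5) in \<open>smt (verit)\<close>)
    qed
  qed (use n quiet_subseq in auto)
  with x show False by blast
qed

text \<open>Bookkeeping over windows: \<open>J\<close> is bounded along the path, every late quiet
  window near \<open>x\<close> costs at least \<open>c\<close>, the other late quiet windows gain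
  less than \<open>e\<close>, and loud windows are too rare to compensate. So visits have density 0
  among the windows. Since a window carries at least unit time and at most \<open>1 + a\<close>,
  this density controls the weighted frequency in the definition of essential points.\<close>

lemma essential_accumulation_critical:
  assumes quiet: "\<And>e. e > 0 \<Longrightarrow> (\<lambda>N. real (card {n. n < N \<and> loud e n}) / real N) \<longlonglongrightarrow> 0"
    and ess: "essential_accumulation_point \<alpha> w x"
  shows "0 \<le> g x p"
proof (rule ccontr)
  assume "\<not> 0 \<le> g x p"
  then obtain c n1 where c: "c > 0" and n1: "\<And>n. n \<ge> n1 \<Longrightarrow> \<not> loud c n \<Longrightarrow>
      \<exists>i\<in>{win n..win (Suc n)}. dist (w i) x < c \<Longrightarrow> J (w (win (Suc n))) - J (w (win n)) \<le> - c"
    using quiet_visit_descent[of x] by (metis (no_types, lifting))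
  define visit where "visit n \<longleftrightarrow> (\<exists>i\<in>{win n..win (Suc n)}. dist (w i) x < c)" for n
  define V where "V N = real (card {n. n < N \<and> visit n})" for N
  obtain K where K: "K > 0" "\<And>k. \<bar>J (w k)\<bar> \<le> K"
    using J_bounded by blast
  have V_bound: "\<forall>\<^sub>F N in sequentially. V N / real N < \<epsilon>" if "\<epsilon> > 0" for \<epsilon>
  proof -
    \<comment> \<open>Half of the budget \<open>c * \<epsilon>\<close> covers the drift
      \<open>e\<close> per quiet window, the other half the early and the loud windows.\<close>
    define e where "e = c * \<epsilon> / 2"
    have "e > 0" using c that by (simp add: e_def)
    obtain e' n2 where e': "e' > 0" and n2: "\<And>n. n \<ge> n2 \<Longrightarrow> \<not> loud e' n \<Longrightarrow> J (w (win (Suc n))) - J (w (win n)) < e"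
      using quiet_descent[OF \<open>e > 0\<close>] by blast
    \<comment> \<open>Quiet at level \<open>b\<close> means quiet at both levels, that of the visits
      and that of the drift.\<close>
    define b where "b = min c e'"
    define n0 where "n0 = max n1 n2"
    \<comment> \<open>\<open>2 * K\<close> bounds any change of \<open>J\<close>; the additional
      \<open>c\<close> offsets the term of a visit that falls into a loud or early window.\<close>
    define M where "M = 2 * K + c"
    have "M \<ge> 0" using K c by (simp add: M_def)
    define bd where "bd N = real (card {n. n < N \<and> loud b n})" for N
    have step: "J (w (win (Suc n))) - J (w (win n)) \<le>
        - c * of_bool (visit n) + e + M * of_bool (loud b n) + M * of_bool (n < n0)" for n
    proof -
      have K2: "J (w (win (Suc n))) - J (w (win n)) \<le> 2 * K"
        using K(2)[of "win n"] K(2)[of "win (Suc n)"] by (simp add: abs_le_iff)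
      show ?thesis
      proof (cases "loud b n \<or> n < n0")
        case True
        then show ?thesis
          using K2 c \<open>e > 0\<close> K(1) by (auto simp: M_def of_bool_def)
      next
        case False
        then have small: "\<forall>j\<in>{win n..win (Suc n)}. norm (noise \<eta> (win n) j) \<le> b"
          by (auto simp: not_less)
        have "b \<le> c" "b \<le> e'" by (auto simp: b_def)
        with small have "\<not> loud c n" "\<not> loud e' n" by (force simp: not_less)+
        moreover have "n \<ge> n1" "n \<ge> n2" using False by (auto simp: n0_def)
        ultimately show ?thesis
          using n1[of n] n2[of n] False \<open>e > 0\<close> by (cases "visit n") (auto simp: visit_def of_bool_def)
      qed
    qed
    have count: "(\<Sum>n<N. of_bool (Q n) :: real) = real (card {n. n < N \<and> Q n})" for N :: nat and Q
    proof -
      have "{..<N} \<inter> Collect Q = {n. n < N \<and> Q n}" by auto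
      then show ?thesis by (subst sum_of_bool_eq) auto
    qed
    have tel: "J (w (win N)) - J (w (win 0)) \<le> - c * V N + e * real N + M * bd N + M * real n0" for N
    proof -
      have "J (w (win N)) - J (w (win 0)) = (\<Sum>n<N. J (w (win (Suc n))) - J (w (win n)))"
        by (rule sum_lessThan_telescope[symmetric])
      also have "\<dots> \<le> (\<Sum>n<N. - c * of_bool (visit n) + e + M * of_bool (loud b n) + M * of_bool (n < n0))"
        by (rule sum_mono) (rule step)
      also have "\<dots> = - c * V N + e * real N + M * bd N + M * real (card {n. n < N \<and> n < n0})"
        unfolding V_def bd_def count[symmetric] by (simp only: sum.distrib sum_distrib_left) simp
      also have "\<dots> \<le> - c * V N + e * real N + M * bd N + M * real n0"
      proof -
        have "card {n. n < N \<and> n < n0} \<le> card {..<n0}" by (rule card_mono) auto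
        then show ?thesis using \<open>M \<ge> 0\<close> by (simp add: mult_left_mono)
      qed
      finally show ?thesis .
    qed
    have main: "c * (V N / real N) \<le> e + ((2 * K + M * real n0) / real N + M * (bd N / real N))" if "N > 0" for N
    proof -
      have "c * V N \<le> e * real N + (2 * K + M * real n0) + M * bd N"
        using tel[of N] K(2)[of "win 0"] K(2)[of "win N"] by (simp add: abs_le_iff)
      then have "c * V N / real N \<le> (e * real N + (2 * K + M * real n0) + M * bd N) / real N"
        by (rule divide_right_mono) simp
      then show ?thesis using that by (simp add: add_divide_distrib)
    qed
    have "(\<lambda>N. (2 * K + M * real n0) / real N + M * (bd N / real N)) \<longlonglongrightarrow> 0 + M * 0"
      unfolding bd_def by (intro tendsto_intros quiet lim_const_over_n) (use c e' in \<open>simp add: b_def\<close>)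
    then have "\<forall>\<^sub>F N in sequentially. (2 * K + M * real n0) / real N + M * (bd N / real N) < e"
      using \<open>e > 0\<close> by (intro order_tendstoD) auto
    then show ?thesis
      using eventually_gt_at_top[of 0]
    proof eventually_elim
      case (elim N)
      then have "c * (V N / real N) < e + e"
        using main[of N] by linarith
      also have "e + e = c * \<epsilon>" by (simp add: e_def)
      finally have "c * (V N / real N) < c * \<epsilon>" .
      then show ?case by (rule mult_less_cancel_left_pos[OF c, THEN iffD1])
    qed
  qed
  have V_lim: "(\<lambda>N. V N / real N) \<longlonglongrightarrow> 0"
  proof (rule tendstoI)
    fix \<epsilon> :: real assume "\<epsilon> > 0"
    from V_bound[OF this] show "\<forall>\<^sub>F N in sequentially. dist (V N / real N) 0 < \<epsilon>"
      by (rule eventually_mono) (simp add: V_def dist_real_def)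
  qed
  obtain a where a: "a > 0" "\<And>k. \<alpha> k \<le> a"
    using \<alpha>_bounded by blast
  define I where "I i = (indicator (ball x c) (w i) :: real)" for i
  have S_win: "(\<Sum>i<win N. \<alpha> i * I i) \<le> (1 + a) * V N" for N
  proof (induction N)
    case (Suc N)
    have "(\<Sum>i\<in>{win N..<win (Suc N)}. \<alpha> i * I i) \<le> (1 + a) * of_bool (visit N)"
    proof (cases "visit N")
      case True
      have "(\<Sum>i\<in>{win N..<win (Suc N)}. \<alpha> i * I i) \<le> (\<Sum>i\<in>{win N..<win (Suc N)}. \<alpha> i)"
        using \<alpha>_pos by (intro sum_mono) (auto simp: I_def indicator_def less_imp_le)
      also have "\<dots> \<le> 1 + a"
        using T_diff[OF win_le_Suc] T_nxt_le[of "win N"] a(2)[of "nxt (win N) - 1"] by (simp add: win_Suc)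
      finally show ?thesis using True by simp
    next
      case False
      then have "I i = 0" if "i \<in> {win N..<win (Suc N)}" for i
        using that by (auto simp: visit_def I_def indicator_def dist_commute)
      then show ?thesis using False by simp
    qed
    moreover have "V (Suc N) = V N + of_bool (visit N)"
    proof -
      have "{n. n < Suc N \<and> visit n} = {n. n < N \<and> visit n} \<union> (if visit N then {N} else {})"
        by (auto simp: less_Suc_eq)
      then show ?thesis by (auto simp: V_def)
    qed
    moreover have "(\<Sum>i<win (Suc N). \<alpha> i * I i) = (\<Sum>i<win N. \<alpha> i * I i) + (\<Sum>i\<in>{win N..<win (Suc N)}. \<alpha> i * I i)"
      unfolding lessThan_atLeast0 by (rule sum.atLeastLessThan_concat[symmetric]) (use win_le_Suc in auto)
    ultimately show ?case
      using Suc.IH by (simp add: distrib_left)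
  qed (simp add: V_def)
  obtain m where m: "\<And>k. win (m k) \<le> k" "\<And>k. k < win (Suc (m k))"
    using window_exists by metis
  have m_top: "filterlim m at_top sequentially"
    unfolding filterlim_at_top
  proof
    fix Z
    show "\<forall>\<^sub>F k in sequentially. Z \<le> m k"
      using eventually_ge_at_top[of "win Z"]
    proof eventually_elim
      case (elim k)
      show ?case
      proof (rule ccontr)
        assume "\<not> Z \<le> m k"
        then have "win (Suc (m k)) \<le> win Z"
          using strict_mono_less_eq[OF strict_mono_win] by simp
        then show False using m(2)[of k] elim by simp
      qed
    qed
  qed
  define \<rho> where "\<rho> k = (\<Sum>i\<le>k. \<alpha> i * I i) / (\<Sum>i\<le>k. \<alpha> i)" for k
  \<comment> \<open>Up to index \<open>k\<close> only \<open>m k\<close> windows are certainly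
    complete, while the numerator may reach into the next one; the factor
    \<open>1 + 1 / real (m k)\<close> is the ratio of the two counts.\<close>
  have \<rho>_le: "\<rho> k \<le> (1 + a) * (V (Suc (m k)) / real (Suc (m k)) * (1 + 1 / real (m k)))" if "m k > 0" for k
  proof -
    have "(\<Sum>i\<le>k. \<alpha> i * I i) \<le> (\<Sum>i<win (Suc (m k)). \<alpha> i * I i)"
      using m(2)[of k] \<alpha>_pos by (intro sum_mono2) (auto simp: I_def less_imp_le)
    also have "\<dots> \<le> (1 + a) * V (Suc (m k))" by (rule S_win)
    finally have 1: "(\<Sum>i\<le>k. \<alpha> i * I i) \<le> (1 + a) * V (Suc (m k))" .
    have "real (m k) \<le> T (win (m k))" by (rule T_win)
    also have "\<dots> \<le> (\<Sum>i\<le>k. \<alpha> i)"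
      unfolding T_def using m(1)[of k] \<alpha>_pos by (intro sum_mono2) (auto simp: less_imp_le)
    finally have 2: "real (m k) \<le> (\<Sum>i\<le>k. \<alpha> i)" .
    have "\<rho> k \<le> (1 + a) * V (Suc (m k)) / real (m k)"
      unfolding \<rho>_def using 1 2 that a(1) by (intro frac_le) (auto simp: V_def)
    also have "\<dots> = (1 + a) * (V (Suc (m k)) / real (Suc (m k)) * (1 + 1 / real (m k)))"
    proof -
      have "1 / real (m k) = 1 / real (Suc (m k)) * (1 + 1 / real (m k))"
        using that by (simp add: divide_simps)
      then show ?thesis by (metis (no_types, lifting) mult.assoc mult.right_neutral times_divide_eq_right)
    qed
    finally show ?thesis .
  qed
  have "\<rho> \<longlonglongrightarrow> 0"
  proof (rule tendsto_sandwich[where f = "\<lambda>_. 0"])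
    have "(\<lambda>k. (1 + a) * (V (Suc (m k)) / real (Suc (m k)) * (1 + 1 / real (m k)))) \<longlonglongrightarrow> (1 + a) * (0 * (1 + 0))"
      by (intro tendsto_intros filterlim_compose[OF LIMSEQ_Suc[OF V_lim] m_top]
          filterlim_compose[OF lim_const_over_n m_top])
    then show "(\<lambda>k. (1 + a) * (V (Suc (m k)) / real (Suc (m k)) * (1 + 1 / real (m k)))) \<longlonglongrightarrow> 0" by simp
    show "\<forall>\<^sub>F k in sequentially. \<rho> k \<le> (1 + a) * (V (Suc (m k)) / real (Suc (m k)) * (1 + 1 / real (m k)))"
      using eventually_compose_filterlim[OF eventually_gt_at_top[of 0] m_top]
      by eventually_elim (rule \<rho>_le)
    show "\<forall>\<^sub>F k in sequentially. 0 \<le> \<rho> k"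
      unfolding \<rho>_def
      by (intro always_eventually allI divide_nonneg_nonneg sum_nonneg mult_nonneg_nonneg)
        (auto simp: I_def less_imp_le[OF \<alpha>_pos])
  qed simp
  then have "(\<lambda>k. ereal (\<rho> k)) \<longlonglongrightarrow> ereal 0"
    by (simp only: tendsto_ereal)
  then have "limsup (\<lambda>k. ereal (\<rho> k)) = ereal 0"
    by (intro lim_imp_Limsup) auto
  moreover have "limsup (\<lambda>k. ereal (\<rho> k)) > 0"
    unfolding \<rho>_def I_def
    by (rule ess[unfolded essential_accumulation_point_def, THEN conjunct2, rule_format]) (use c in simp)
  ultimately show False by simp
qed

end

section \<open>Paths on which all late windows are quiet\<close>

context perturbed_descent
begin

context
  assumes quiet: "\<And>e. e > 0 \<Longrightarrow> \<forall>\<^sub>F n in sequentially. \<not> loud e n"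
begin

text \<open>Passes from the fixed windows to arbitrary starting indices and durations up to 2, as
  needed for windows that begin at a prescribed iterate.\<close>

lemma noise_small:
  assumes "e > 0"
  shows "\<forall>\<^sub>F k in sequentially. \<forall>j\<ge>k. T j - T k \<le> 2 \<longrightarrow> norm (noise \<eta> k j) \<le> e"
proof -
  \<comment> \<open>The stretch from \<open>win n\<close> to \<open>j\<close> lies in three
    consecutive windows, and the part before \<open>k\<close> in the first of them: three errors
    plus one.\<close>
  define e' where "e' = e / 4"
  have "e' > 0" using assms by (simp add: e'_def)
  obtain N where "\<forall>n\<ge>N. \<not> loud e' n"
    using quiet[OF \<open>e' > 0\<close>] unfolding eventually_sequentially by blast
  then have N: "norm (noise \<eta> (win n) j) \<le> e'" if "n \<ge> N" "j \<in> {win n..win (Suc n)}" for n j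
    using that by (force simp: not_less)
  have multi: "norm (noise \<eta> (win n) j) \<le> real q * e'" if "n \<ge> N" "win n \<le> j" "j \<le> win (n + q)" for n j q
    using that(2,3)
  proof (induction q arbitrary: j)
    case 0
    then show ?case by (simp add: noise_def)
  next
    case (Suc q)
    show ?case
    proof (cases "j \<le> win (n + q)")
      case True
      then have "norm (noise \<eta> (win n) j) \<le> real q * e'" using Suc by blast
      also have "\<dots> \<le> real (Suc q) * e'" using \<open>e' > 0\<close> by simp
      finally show ?thesis .
    next
      case False
      have le: "win n \<le> win (n + q)" using strict_mono_less_eq[OF strict_mono_win] by simp
      have "noise \<eta> (win n) j = noise \<eta> (win n) (win (n + q)) + noise \<eta> (win (n + q)) j"
        by (rule noise_add) (use le False in auto)
      moreover have "norm (noise \<eta> (win n) (win (n + q))) \<le> real q * e'"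
        using le by (intro Suc.IH) auto
      moreover have "norm (noise \<eta> (win (n + q)) j) \<le> e'"
        using False Suc.prems that(1) by (intro N) auto
      ultimately show ?thesis
        using norm_triangle_ineq[of "noise \<eta> (win n) (win (n + q))" "noise \<eta> (win (n + q)) j"]
        by (simp add: algebra_simps)
    qed
  qed
  show ?thesis
    using eventually_ge_at_top[of "win N"]
  proof eventually_elim
    case (elim k)
    obtain n where n: "win n \<le> k" "k < win (Suc n)" using window_exists by blast
    have "N \<le> n"
    proof (rule ccontr)
      assume "\<not> N \<le> n"
      then have "win (Suc n) \<le> win N" using strict_mono_less_eq[OF strict_mono_win] by simp
      then show False using n elim by simp
    qed
    show ?case
    proof (intro allI impI)
      fix j assume j: "k \<le> j" "T j - T k \<le> 2"
      have "T j \<le> T k + 2" using j by simp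
      also have "\<dots> \<le> T (win (Suc n)) + 2" using T_mono[of k "win (Suc n)"] n by simp
      also have "\<dots> \<le> T (win (n + 3))"
        using T_nxt[of "win (n + 1)"] T_nxt[of "win (n + 2)"] by (simp add: win_Suc[symmetric] numeral_3_eq_3)
      finally have "T j \<le> T (win (n + 3))" .
      moreover have "T (win (n + 3)) < T j" if "win (n + 3) < j"
      proof -
        have "T (Suc (win (n + 3))) \<le> T j" using that by (intro T_mono) simp
        then show ?thesis using \<alpha>_pos[of "win (n + 3)"] by (simp add: T_Suc)
      qed
      ultimately have "j \<le> win (n + 3)" by (metis not_less)
      then have 1: "norm (noise \<eta> (win n) j) \<le> real 3 * e'"
        using \<open>N \<le> n\<close> n j by (intro multi) auto
      have 2: "norm (noise \<eta> (win n) k) \<le> e'"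
        using \<open>N \<le> n\<close> n by (intro N) auto
      have "noise \<eta> k j = noise \<eta> (win n) j - noise \<eta> (win n) k"
        using noise_add[of "win n" k j \<eta>] n j by simp
      then have "norm (noise \<eta> k j) \<le> real 3 * e' + e'"
        using norm_triangle_ineq4[of "noise \<eta> (win n) j" "noise \<eta> (win n) k"] 1 2 by simp
      then show "norm (noise \<eta> k j) \<le> e" by (simp add: e'_def)
    qed
  qed
qed

lemma window_noise_small:
  assumes k: "filterlim k at_top sequentially" and "\<forall>\<^sub>F n in sequentially. T (l n) - T (k n) \<le> 2" "e > 0"
  shows "\<forall>\<^sub>F n in sequentially. \<forall>j\<in>{k n..l n}. norm (noise \<eta> (k n) j) \<le> e"
  using eventually_compose_filterlim[OF noise_small[OF \<open>e > 0\<close>] k] assms(2)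
proof eventually_elim
  case (elim n)
  then show ?case
    by (meson T_mono atLeastAtMost_iff diff_right_mono order_trans)
qed

lemma T_nxt_le_2:
  assumes "filterlim k at_top sequentially"
  shows "\<forall>\<^sub>F n in sequentially. T (nxt (k n)) - T (k n) \<le> 2"
proof -
  have "\<forall>\<^sub>F n in sequentially. T (nxt (k n)) - T (k n) < 2"
    using tendsto_T_nxt[OF assms] by (rule order_tendstoD) simp
  then show ?thesis by (rule eventually_mono) simp
qed

text \<open>A single step is itself a stretch of duration \<open>\<alpha> n\<close>, so its noise is
  controlled by \<open>noise_small\<close>.\<close>

lemma steps_vanish: "(\<lambda>n. dist (w (Suc n)) (w n)) \<longlonglongrightarrow> 0"
proof (rule Lim_null_comparison)
  show "\<forall>\<^sub>F n in sequentially. norm (dist (w (Suc n)) (w n)) \<le> \<alpha> n * L + norm (noise \<eta> n (Suc n))"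
  proof (intro always_eventually allI)
    fix n
    have "w (Suc n) - w n = - (\<alpha> n *\<^sub>R h n) - noise \<eta> n (Suc n)"
      by (simp add: w_Suc noise_def scaleR_add_right)
    then have "norm (w (Suc n) - w n) \<le> norm (\<alpha> n *\<^sub>R h n) + norm (noise \<eta> n (Suc n))"
      using norm_triangle_ineq4[of "- (\<alpha> n *\<^sub>R h n)" "noise \<eta> n (Suc n)"] by simp
    also have "norm (\<alpha> n *\<^sub>R h n) \<le> \<alpha> n * L"
      using \<alpha>_pos[of n] h_le[of n] by simp
    finally show "norm (dist (w (Suc n)) (w n)) \<le> \<alpha> n * L + norm (noise \<eta> n (Suc n))"
      by (simp add: dist_norm)
  qed
  have "(\<lambda>n. norm (noise \<eta> n (Suc n))) \<longlonglongrightarrow> 0"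
  proof (rule tendstoI)
    fix e :: real assume "e > 0"
    then have "e / 2 > 0" by simp
    have "\<forall>\<^sub>F n in sequentially. \<alpha> n < 2"
      using \<alpha>_null by (rule order_tendstoD) simp
    with noise_small[OF \<open>e / 2 > 0\<close>]
    show "\<forall>\<^sub>F n in sequentially. dist (norm (noise \<eta> n (Suc n))) 0 < e"
    proof eventually_elim
      case (elim n)
      then have "norm (noise \<eta> n (Suc n)) \<le> e / 2" by (simp add: T_Suc)
      then show ?case using \<open>e > 0\<close> by simp
    qed
  qed
  from tendsto_add[OF tendsto_mult_right[OF \<alpha>_null, of L] this]
  show "(\<lambda>n. \<alpha> n * L + norm (noise \<eta> n (Suc n))) \<longlonglongrightarrow> 0" by simp
qed

lemma window_critical_nxt:
  assumes k: "filterlim k at_top sequentially" and x: "(\<lambda>n. w (k n)) \<longlonglongrightarrow> x"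
    and "\<And>c. c > 0 \<Longrightarrow> \<forall>\<^sub>F n in sequentially. J (w (nxt (k n))) - J (w (k n)) \<ge> - c"
  shows "0 \<le> g x p"
  by (rule window_critical[OF k _ _ tendsto_T_nxt[OF k] _ window_noise_small[OF k T_nxt_le_2[OF k]] x])
    (use assms nxt_gt in \<open>auto intro: less_imp_le\<close>)

text \<open>At a level that is not a critical value no upcrossing can recur: a window starting at that
  level can neither rise by a fixed amount nor avoid descending.\<close>

lemma J_convergent:
  assumes crit: "interior (J ` {x. \<forall>p. 0 \<le> g x p}) = {}"
  shows "convergent (\<lambda>k. J (w k))"
proof (rule bounded_real_convergentI)
  show "bounded (range (\<lambda>k. J (w k)))"
    using J_bounded by (auto simp: bounded_iff)
  fix a b :: real assume "a < b" and low: "\<exists>\<^sub>F n in sequentially. J (w n) < a"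
    and high: "\<exists>\<^sub>F n in sequentially. b < J (w n)"
  \<comment> \<open>The hypothesis on critical values enters here: the interval must contain a level
    \<open>c\<close> attained by no critical point.\<close>
  have "\<not> {a<..<b} \<subseteq> J ` {x. \<forall>p. 0 \<le> g x p}"
  proof
    assume "{a<..<b} \<subseteq> J ` {x. \<forall>p. 0 \<le> g x p}"
    then have "{a<..<b} \<subseteq> {}"
      unfolding crit[symmetric] by (rule interior_maximal) simp
    then show False using dense[OF \<open>a < b\<close>] by auto
  qed
  then obtain c where c: "a < c" "c < b" "c \<notin> J ` {x. \<forall>p. 0 \<le> g x p}"
    unfolding subset_iff greaterThanLessThan_iff by blast
  have "\<exists>k q. n \<le> k \<and> k < q \<and> J (w k) \<le> c \<and> b < J (w q) \<and> (\<forall>j. k < j \<and> j \<le> q \<longrightarrow> c < J (w j))" for n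
  proof -
    obtain p where p: "p \<ge> n" "J (w p) < a" using low unfolding frequently_sequentially by blast
    obtain q where q: "q \<ge> p" "b < J (w q)" using high unfolding frequently_sequentially by blast
    define Q where "Q j \<longleftrightarrow> p \<le> j \<and> j \<le> q \<and> J (w j) \<le> c" for j
    \<comment> \<open>The last passage at or below level \<open>c\<close> before \<open>J\<close>
      exceeds \<open>b\<close>.\<close>
    define k where "k = (GREATEST j. Q j)"
    have "Q p" using p q c by (auto simp: Q_def)
    have Q_le: "j \<le> q" if "Q j" for j using that by (simp add: Q_def)
    have k: "Q k" "\<And>j. Q j \<Longrightarrow> j \<le> k"
      unfolding k_def by (rule GreatestI_nat[of Q, OF \<open>Q p\<close> Q_le], assumption)
        (rule Greatest_le_nat[of Q, OF _ Q_le])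
    have "k \<noteq> q" using k(1) q c by (auto simp: Q_def)
    moreover have "c < J (w j)" if "k < j" "j \<le> q" for j
    proof (rule ccontr)
      assume "\<not> c < J (w j)"
      then have "Q j" using that k(1) by (simp add: Q_def)
      from k(2)[OF this] show False using that by simp
    qed
    ultimately show ?thesis
      using k(1) p q by (intro exI[of _ k] exI[of _ q]) (auto simp: Q_def)
  qed
  then obtain k q where kq: "\<And>n. n \<le> k n" "\<And>n. k n < q n" "\<And>n. J (w (k n)) \<le> c" "\<And>n. b < J (w (q n))"
      "\<And>n j. k n < j \<Longrightarrow> j \<le> q n \<Longrightarrow> c < J (w j)"
    by metis
  have "bounded (range (w \<circ> k))"
    using w_bounded by (rule bounded_subset) auto
  then obtain x r where r: "strict_mono r" "((w \<circ> k) \<circ> r) \<longlonglongrightarrow> x"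
    using bounded_imp_convergent_subsequence by blast
  define k' where "k' n = k (r n)" for n
  define q' where "q' n = q (r n)" for n
  have k'_top: "filterlim k' at_top sequentially"
    by (rule filterlim_at_top_mono[OF filterlim_subseq[OF r(1)]]) (use kq(1) in \<open>auto simp: k'_def\<close>)
  have lim: "(\<lambda>n. w (k' n)) \<longlonglongrightarrow> x"
    using r(2) by (simp add: k'_def o_def)
  have "(\<lambda>n. w (Suc (k' n)) - w (k' n)) \<longlonglongrightarrow> 0"
    using filterlim_compose[OF steps_vanish k'_top] by (simp add: dist_norm tendsto_norm_zero_iff)
  from tendsto_add[OF this lim] have lim': "(\<lambda>n. w (Suc (k' n))) \<longlonglongrightarrow> x" by simp
  \<comment> \<open>The iterate \<open>k' n\<close> is at or below \<open>c\<close>, its successor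
    is above, and the step between them vanishes; so the limit sits exactly at the level.\<close>
  have "J x \<le> c"
    by (rule LIMSEQ_le_const2[OF J_lim[OF lim]]) (use kq(3) in \<open>auto simp: k'_def\<close>)
  moreover have "c \<le> J x"
  proof (rule LIMSEQ_le_const[OF J_lim[OF lim']], intro exI[of _ 0] allI impI)
    show "c \<le> J (w (Suc (k' n)))" for n
      using kq(5)[of "r n" "Suc (k (r n))"] kq(2)[of "r n"] by (simp add: k'_def)
  qed
  ultimately have "J x = c" by simp
  \<comment> \<open>If the unit window reached \<open>q' n\<close>, the shortened window would raise
    \<open>J\<close> from at most \<open>c\<close> to above \<open>b\<close>, against
    \<open>window_descent\<close>. So it ends earlier, while \<open>J\<close> is still above
    \<open>c\<close>, and has not descended.\<close>
  define l where "l n = min (q' n) (nxt (k' n))" for n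
  have kl: "k' n \<le> l n" for n
    using kq(2)[of "r n"] nxt_gt[of "k' n"] by (auto simp: l_def k'_def q'_def)
  have "\<forall>\<^sub>F n in sequentially. T (l n) - T (k' n) \<le> 2"
    using T_nxt_le_2[OF k'_top]
  proof eventually_elim
    case (elim n)
    then show ?case using T_mono[of "l n" "nxt (k' n)"] by (simp add: l_def)
  qed
  then have "\<forall>\<^sub>F n in sequentially. J (w (l n)) - J (w (k' n)) < b - c"
    using window_noise_small[OF k'_top] c by (intro window_descent[OF k'_top kl]) auto
  then have "\<forall>\<^sub>F n in sequentially. J (w (nxt (k' n))) - J (w (k' n)) \<ge> 0"
  proof eventually_elim
    case (elim n)
    have "nxt (k' n) < q' n"
    proof (rule ccontr)
      assume "\<not> nxt (k' n) < q' n"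
      then have "l n = q' n" by (simp add: l_def)
      then show False using elim kq(3)[of "r n"] kq(4)[of "r n"] by (simp add: k'_def q'_def)
    qed
    then have "c < J (w (nxt (k' n)))"
      using kq(5)[of "r n" "nxt (k' n)"] nxt_gt[of "k' n"] by (simp add: k'_def q'_def)
    then show ?case using kq(3)[of "r n"] by (simp add: k'_def)
  qed
  then have "0 \<le> g x p" for p
    by (intro window_critical_nxt[OF k'_top lim]) (auto elim: eventually_mono)
  with c(3) \<open>J x = c\<close> show False by blast
qed

text \<open>Convergence of \<open>J\<close> along the path leaves no room for a fixed descent on the
  unit windows that start near \<open>x\<close>.\<close>

lemma accumulation_critical:
  assumes conv: "convergent (\<lambda>k. J (w k))" and x: "accumulation_point w x"
  shows "0 \<le> g x p"
proof -
  obtain r where r: "strict_mono r" "(\<lambda>n. w (r n)) \<longlonglongrightarrow> x"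
    using x by (auto simp: accumulation_point_def o_def)
  have r_top: "filterlim r at_top sequentially" using r(1) by (rule filterlim_subseq)
  obtain z where z: "(\<lambda>k. J (w k)) \<longlonglongrightarrow> z" using conv by (auto simp: convergent_def)
  have n_top: "filterlim (\<lambda>n. nxt (r n)) at_top sequentially"
    by (rule filterlim_at_top_mono[OF r_top]) (use nxt_gt in \<open>auto intro!: always_eventually less_imp_le\<close>)
  have "(\<lambda>n. J (w (nxt (r n))) - J (w (r n))) \<longlonglongrightarrow> z - z"
    by (intro tendsto_diff filterlim_compose[OF z r_top] filterlim_compose[OF z n_top])
  then have lim: "(\<lambda>n. J (w (nxt (r n))) - J (w (r n))) \<longlonglongrightarrow> 0" by simp
  show ?thesis
  proof (rule window_critical_nxt[OF r_top r(2)])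
    fix c :: real assume "c > 0"
    then have "\<forall>\<^sub>F n in sequentially. - c < J (w (nxt (r n))) - J (w (r n))"
      using lim by (intro order_tendstoD) auto
    then show "\<forall>\<^sub>F n in sequentially. - c \<le> J (w (nxt (r n))) - J (w (r n))"
      by (rule eventually_mono) simp
  qed
qed

end
end

section \<open>Maximal inequalities for the noise\<close>

locale iid_sequence = prob_space M + P: prob_space P for M :: "'o measure" and P :: "'s measure" +
  fixes \<xi> :: "nat \<Rightarrow> 'o \<Rightarrow> 's"
  assumes \<xi>_indep: "indep_vars (\<lambda>_. P) \<xi> UNIV" and \<xi>_law: "\<And>k. distr M P (\<xi> k) = P"
begin

text \<open>The filtration generated by the samples with index below \<open>k\<close>. The sample
  \<open>\<xi> k\<close> is excluded, matching the fact that \<open>w k\<close> is determined before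
  \<open>\<xi> k\<close> is drawn.\<close>

definition past :: "nat \<Rightarrow> 'o measure" where
  "past k = vimage_algebra (space M) (\<lambda>\<omega>. \<lambda>i\<in>{..<k}. \<xi> i \<omega>) (PiM {..<k} (\<lambda>_. P))"

lemma space_past [simp]: "space (past k) = space M"
  by (simp add: past_def)

lemma \<xi>_measurable [measurable]: "\<xi> k \<in> M \<rightarrow>\<^sub>M P"
  using \<xi>_indep unfolding indep_vars_def2 by blast

lemma history_measurable: "(\<lambda>\<omega>. \<lambda>i\<in>{..<k}. \<xi> i \<omega>) \<in> M \<rightarrow>\<^sub>M PiM {..<k} (\<lambda>_. P)"
  by (rule measurable_restrict) simp

lemma id_measurable_past: "(\<lambda>\<omega>. \<omega>) \<in> M \<rightarrow>\<^sub>M past k"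
  unfolding past_def by (rule measurable_vimage_algebra2) (simp, rule history_measurable)

lemma measurable_past: "X \<in> past k \<rightarrow>\<^sub>M N \<Longrightarrow> X \<in> M \<rightarrow>\<^sub>M N"
  by (rule measurable_compose[OF id_measurable_past])

lemma \<xi>_measurable_past: "i < k \<Longrightarrow> \<xi> i \<in> past k \<rightarrow>\<^sub>M P"
proof -
  assume "i < k"
  have "(\<lambda>\<omega>. \<lambda>i\<in>{..<k}. \<xi> i \<omega>) \<in> past k \<rightarrow>\<^sub>M PiM {..<k} (\<lambda>_. P)"
    unfolding past_def
    by (rule measurable_vimage_algebra1) (use measurable_space[OF history_measurable] in auto)
  from measurable_compose[OF this measurable_component_singleton, of i]
  show ?thesis using \<open>i < k\<close> by simp
qed

lemma past_mono: "i \<le> k \<Longrightarrow> X \<in> past i \<rightarrow>\<^sub>M N \<Longrightarrow> X \<in> past k \<rightarrow>\<^sub>M N"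
proof -
  assume "i \<le> k" and X: "X \<in> past i \<rightarrow>\<^sub>M N"
  have "(\<lambda>\<omega>. \<omega>) \<in> past k \<rightarrow>\<^sub>M past i"
    unfolding past_def[of i]
    by (rule measurable_vimage_algebra2)
      (use \<open>i \<le> k\<close> in \<open>auto intro!: measurable_restrict \<xi>_measurable_past\<close>)
  from measurable_compose[OF this X] show ?thesis by simp
qed

lemma prob_past_fresh:
  assumes A: "A \<in> sets (past k)" and B: "B \<in> sets P"
  shows "prob (A \<inter> (\<xi> k -` B \<inter> space M)) = prob A * prob (\<xi> k -` B \<inter> space M)"
proof -
  let ?H = "\<lambda>\<omega>. \<lambda>i\<in>{..<k}. \<xi> i \<omega>" and ?X = "\<lambda>\<omega>. \<lambda>i\<in>{k}. \<xi> i \<omega>"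
  have ind: "indep_var (PiM {..<k} (\<lambda>_. P)) ?H (PiM {k} (\<lambda>_. P)) ?X"
    by (rule indep_var_restrict[OF \<xi>_indep]) auto
  obtain A' where A': "A' \<in> sets (PiM {..<k} (\<lambda>_. P))" "A = ?H -` A' \<inter> space M"
    using A unfolding past_def
    by (subst (asm) sets_vimage_algebra2) (use measurable_space[OF history_measurable] in auto)
  define B' where "B' = (\<lambda>f. f k) -` B \<inter> space (PiM {k} (\<lambda>_. P))"
  have B': "B' \<in> sets (PiM {k} (\<lambda>_. P))"
    unfolding B'_def by (rule measurable_sets[OF measurable_component_singleton[of k "{k}" "\<lambda>_. P"] B]) simp
  have eq: "\<xi> k -` B \<inter> space M = ?X -` B' \<inter> space M"
    using measurable_space[OF \<xi>_measurable] by (auto simp: B'_def space_PiM)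
  have "A \<inter> (\<xi> k -` B \<inter> space M) = (\<lambda>\<omega>. (?H \<omega>, ?X \<omega>)) -` (A' \<times> B') \<inter> space M"
    unfolding eq A'(2) by auto
  then show ?thesis
    using indep_varD[OF ind A'(1) B'] unfolding eq A'(2) by simp
qed

text \<open>Independence in product form; it is enough to compare the two measures on
  rectangles.\<close>

lemma distr_past_fresh:
  "distr M (past k) (\<lambda>\<omega>. \<omega>) \<Otimes>\<^sub>M P = distr M (past k \<Otimes>\<^sub>M P) (\<lambda>\<omega>. (\<omega>, \<xi> k \<omega>))"
proof (rule pair_measure_eqI)
  note [measurable] = id_measurable_past
  interpret past: prob_space "distr M (past k) (\<lambda>\<omega>. \<omega>)"
    by (rule prob_space_distr) (rule id_measurable_past)
  show "sigma_finite_measure (distr M (past k) (\<lambda>\<omega>. \<omega>))" "sigma_finite_measure P"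
    by unfold_locales
  show "sets (distr M (past k) (\<lambda>\<omega>. \<omega>) \<Otimes>\<^sub>M P) = sets (distr M (past k \<Otimes>\<^sub>M P) (\<lambda>\<omega>. (\<omega>, \<xi> k \<omega>)))"
    by (simp cong: sets_pair_measure_cong)
  fix A B assume "A \<in> sets (distr M (past k) (\<lambda>\<omega>. \<omega>))" and B: "B \<in> sets P"
  then have A: "A \<in> sets (past k)" by simp
  have AM: "A \<in> sets M"
    using measurable_sets[OF id_measurable_past A] sets.sets_into_space[OF A] by (simp add: Int_absorb2)
  have "emeasure (distr M (past k \<Otimes>\<^sub>M P) (\<lambda>\<omega>. (\<omega>, \<xi> k \<omega>))) (A \<times> B) = emeasure M (A \<inter> (\<xi> k -` B \<inter> space M))"
    using A B by (subst emeasure_distr) (auto intro!: arg_cong[where f = "emeasure M"])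
  also have "\<dots> = ennreal (prob A * prob (\<xi> k -` B \<inter> space M))"
    by (simp add: emeasure_eq_measure prob_past_fresh[OF A B])
  also have "\<dots> = emeasure M A * emeasure (distr M P (\<xi> k)) B"
    using B by (simp add: emeasure_eq_measure ennreal_mult emeasure_distr)
  also have "\<dots> = emeasure (distr M (past k) (\<lambda>\<omega>. \<omega>)) A * emeasure P B"
    using A AM sets.sets_into_space[OF AM] by (simp add: \<xi>_law emeasure_distr Int_absorb2)
  finally show "emeasure (distr M (past k) (\<lambda>\<omega>. \<omega>)) A * emeasure P B =
      emeasure (distr M (past k \<Otimes>\<^sub>M P) (\<lambda>\<omega>. (\<omega>, \<xi> k \<omega>))) (A \<times> B)" ..
qed

text \<open>Stands in for conditional expectation given \<open>past k\<close>: the fresh sample is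
  integrated out by Fubini with the past frozen.\<close>

lemma nn_integral_fresh:
  assumes h [measurable]: "h \<in> borel_measurable (past k \<Otimes>\<^sub>M P)"
  shows "(\<integral>\<^sup>+\<omega>. h (\<omega>, \<xi> k \<omega>) \<partial>M) = (\<integral>\<^sup>+\<omega>. (\<integral>\<^sup>+s. h (\<omega>, s) \<partial>P) \<partial>M)"
proof -
  note [measurable] = id_measurable_past
  have "(\<integral>\<^sup>+\<omega>. h (\<omega>, \<xi> k \<omega>) \<partial>M) = (\<integral>\<^sup>+x. h x \<partial>(distr M (past k) (\<lambda>\<omega>. \<omega>) \<Otimes>\<^sub>M P))"
    unfolding distr_past_fresh by (simp add: nn_integral_distr)
  also have "\<dots> = (\<integral>\<^sup>+\<omega>. (\<integral>\<^sup>+s. h (\<omega>, s) \<partial>P) \<partial>distr M (past k) (\<lambda>\<omega>. \<omega>))"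
    by (rule P.nn_integral_fst[symmetric]) (simp add: h cong: measurable_cong_sets sets_pair_measure_cong)
  also have "\<dots> = (\<integral>\<^sup>+\<omega>. (\<integral>\<^sup>+s. h (\<omega>, s) \<partial>P) \<partial>M)"
    by (rule nn_integral_distr) auto
  finally show ?thesis .
qed

end

section \<open>Martingale noise and Doob's maximal inequality\<close>

locale adapted_noise = iid_sequence M P \<xi> + step_sizes \<alpha>
  for M :: "'o measure" and P :: "'s measure" and \<xi> and \<alpha> +
  fixes w :: "nat \<Rightarrow> 'o \<Rightarrow> 'a::euclidean_space" and N :: "'a \<Rightarrow> 's \<Rightarrow> 'a"
  assumes w_past: "\<And>k. w k \<in> past k \<rightarrow>\<^sub>M borel"
    and N_measurable [measurable]: "(\<lambda>(z, s). N z s) \<in> borel \<Otimes>\<^sub>M P \<rightarrow>\<^sub>M borel"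
    and N_integrable: "\<And>z. integrable P (N z)" and N_mean: "\<And>z. (\<integral>s. N z s \<partial>P) = 0"
begin

definition S :: "nat \<Rightarrow> nat \<Rightarrow> 'o \<Rightarrow> 'a" where
  "S a j \<omega> = noise (\<lambda>i. N (w i \<omega>) (\<xi> i \<omega>)) a j"

lemma S_same [simp]: "S a a \<omega> = 0"
  by (simp add: S_def noise_def)

lemma S_Suc: "a \<le> j \<Longrightarrow> S a (Suc j) \<omega> = S a j \<omega> + \<alpha> j *\<^sub>R N (w j \<omega>) (\<xi> j \<omega>)"
  by (simp add: S_def noise_def)

lemma S_past: "S a j \<in> past j \<rightarrow>\<^sub>M borel"
proof -
  have "(\<lambda>\<omega>. N (w i \<omega>) (\<xi> i \<omega>)) \<in> past j \<rightarrow>\<^sub>M borel" if "i < j" for i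
    using measurable_compose[OF measurable_Pair[OF past_mono[OF less_imp_le[OF that] w_past] \<xi>_measurable_past[OF that]] N_measurable]
    by simp
  then show ?thesis
    unfolding S_def noise_def by (intro borel_measurable_sum borel_measurable_scaleR) auto
qed

text \<open>One-step conditional expectation for a nonnegative test function \<open>\<Phi>\<close>
  and a weight \<open>X\<close> known at time \<open>b\<close>. It is used with squared norms and
  with exponentials.\<close>

lemma nn_integral_S_Suc:
  assumes X: "X \<in> borel_measurable (past b)" and [measurable]: "\<Phi> \<in> borel_measurable borel" and ab: "a \<le> b"
  shows "(\<integral>\<^sup>+\<omega>. X \<omega> * \<Phi> (S a (Suc b) \<omega>) \<partial>M) =
    (\<integral>\<^sup>+\<omega>. X \<omega> * (\<integral>\<^sup>+s. \<Phi> (S a b \<omega> + \<alpha> b *\<^sub>R N (w b \<omega>) s) \<partial>P) \<partial>M)"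
proof -
  note [measurable] = X S_past[of a b] w_past[of b]
  have N': "(\<lambda>x. N (w b (fst x)) (snd x)) \<in> past b \<Otimes>\<^sub>M P \<rightarrow>\<^sub>M borel"
    using measurable_compose[OF _ N_measurable, of "\<lambda>x. (w b (fst x), snd x)" "past b \<Otimes>\<^sub>M P"] by simp
  define h where "h = (\<lambda>x. X (fst x) * \<Phi> (S a b (fst x) + \<alpha> b *\<^sub>R N (w b (fst x)) (snd x)))"
  have [measurable]: "h \<in> borel_measurable (past b \<Otimes>\<^sub>M P)"
    unfolding h_def using N' by measurable
  have "(\<integral>\<^sup>+\<omega>. X \<omega> * \<Phi> (S a (Suc b) \<omega>) \<partial>M) = (\<integral>\<^sup>+\<omega>. h (\<omega>, \<xi> b \<omega>) \<partial>M)"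
    by (simp add: h_def S_Suc[OF ab])
  also have "\<dots> = (\<integral>\<^sup>+\<omega>. (\<integral>\<^sup>+s. h (\<omega>, s) \<partial>P) \<partial>M)"
    by (rule nn_integral_fresh) simp
  also have "\<dots> = (\<integral>\<^sup>+\<omega>. X \<omega> * (\<integral>\<^sup>+s. \<Phi> (S a b \<omega> + \<alpha> b *\<^sub>R N (w b \<omega>) s) \<partial>P) \<partial>M)"
  proof (rule nn_integral_cong)
    fix \<omega> assume "\<omega> \<in> space M"
    have "(\<lambda>s. N (w b \<omega>) s) \<in> borel_measurable P"
      using N_integrable by auto
    then show "(\<integral>\<^sup>+s. h (\<omega>, s) \<partial>P) = X \<omega> * (\<integral>\<^sup>+s. \<Phi> (S a b \<omega> + \<alpha> b *\<^sub>R N (w b \<omega>) s) \<partial>P)"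
      unfolding h_def by (subst nn_integral_cmult[symmetric]) auto
  qed
  finally show ?thesis .
qed

lemma threshold_le:
  fixes c x y :: ennreal
  assumes "\<omega> \<in> A \<Longrightarrow> c \<le> y"
  shows "c * (x * indicator A \<omega>) \<le> x * indicator A \<omega> * y"
proof (cases "\<omega> \<in> A")
  case True
  then have "x * c \<le> x * y"
    using assms by (intro mult_left_mono) auto
  then show ?thesis using True by (simp add: mult.commute)
qed simp

text \<open>Doob's inequality, \<open>sub\<close> being the submartingale property of
  \<open>\<Phi> (S a j)\<close>. The weight \<open>X\<close>, known at the start of the window,
  makes the bound conditional on the past, as the exponential moment of the number of loud windows
  requires.\<close>

lemma maximal_inequality:
  assumes X: "X \<in> borel_measurable (past a)" and \<Phi> [measurable]: "\<Phi> \<in> borel_measurable borel" and ab: "a \<le> b"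
    and sub: "\<And>j y z. \<Phi> y \<le> (\<integral>\<^sup>+s. \<Phi> (y + \<alpha> j *\<^sub>R N z s) \<partial>P)"
  shows "c * (\<integral>\<^sup>+\<omega>. X \<omega> * indicator {\<omega>\<in>space M. \<exists>j\<in>{a..b}. c \<le> \<Phi> (S a j \<omega>)} \<omega> \<partial>M)
    \<le> (\<integral>\<^sup>+\<omega>. X \<omega> * indicator {\<omega>\<in>space M. \<exists>j\<in>{a..b}. c \<le> \<Phi> (S a j \<omega>)} \<omega> * \<Phi> (S a b \<omega>) \<partial>M)"
  using ab
proof (induction b rule: dec_induct)
  case base
  have [measurable]: "X \<in> borel_measurable M" using X by (rule measurable_past)
  show ?case
    by (subst nn_integral_cmult[symmetric], simp, rule nn_integral_mono, rule threshold_le) auto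
next
  case (step b)
  define E where "E = (\<lambda>b. {\<omega>\<in>space M. \<exists>j\<in>{a..b}. c \<le> \<Phi> (S a j \<omega>)})"
  have "E b \<in> sets (past b)" for b
  proof -
    have "{\<omega>\<in>space (past b). c \<le> \<Phi> (S a j \<omega>)} \<in> sets (past b)" if "j \<le> b" for j
    proof -
      note [measurable] = past_mono[OF that S_past[of a j]]
      show ?thesis by measurable
    qed
    then have "(\<Union>j\<in>{a..b}. {\<omega>\<in>space (past b). c \<le> \<Phi> (S a j \<omega>)}) \<in> sets (past b)"
      by (intro sets.finite_UN) auto
    also have "(\<Union>j\<in>{a..b}. {\<omega>\<in>space (past b). c \<le> \<Phi> (S a j \<omega>)}) = E b"
      by (auto simp: E_def)
    finally show ?thesis .
  qed
  note E [measurable] = this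
  have Xb: "X \<in> borel_measurable (past b)" if "a \<le> b" for b using past_mono[OF that X] .
  have XE: "(\<lambda>\<omega>. X \<omega> * indicator (E b) \<omega>) \<in> borel_measurable (past b)" if "a \<le> b" for b
  proof -
    note [measurable] = Xb[OF that]
    show ?thesis by measurable
  qed
  have M_meas [measurable]: "X \<in> borel_measurable M" "E b \<in> sets M" "S a b \<in> borel_measurable M" for b
    using measurable_past[OF X] measurable_past[OF S_past] measurable_sets[OF id_measurable_past E[of b]]
    by (auto simp: E_def)
  \<comment> \<open>The event that the threshold is first reached at \<open>Suc b\<close>. On it the
    threshold itself is used, on \<open>E b\<close> the submartingale property.\<close>
  define G where "G = {\<omega>\<in>space M. c \<le> \<Phi> (S a (Suc b) \<omega>)} - E b"
  have [measurable]: "G \<in> sets M" unfolding G_def by measurable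
  have split: "indicator (E (Suc b)) \<omega> = (indicator (E b) \<omega> + indicator G \<omega> :: ennreal)" for \<omega>
    using step.hyps by (auto simp: E_def G_def indicator_def le_Suc_eq)
  have "c * (\<integral>\<^sup>+\<omega>. X \<omega> * indicator (E (Suc b)) \<omega> \<partial>M) =
      c * (\<integral>\<^sup>+\<omega>. X \<omega> * indicator (E b) \<omega> \<partial>M) + c * (\<integral>\<^sup>+\<omega>. X \<omega> * indicator G \<omega> \<partial>M)"
    unfolding split distrib_left by (subst nn_integral_add) (auto simp: distrib_left)
  also have "\<dots> \<le> (\<integral>\<^sup>+\<omega>. X \<omega> * indicator (E b) \<omega> * \<Phi> (S a (Suc b) \<omega>) \<partial>M)
      + (\<integral>\<^sup>+\<omega>. X \<omega> * indicator G \<omega> * \<Phi> (S a (Suc b) \<omega>) \<partial>M)"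
  proof (rule add_mono)
    have "c * (\<integral>\<^sup>+\<omega>. X \<omega> * indicator (E b) \<omega> \<partial>M) \<le> (\<integral>\<^sup>+\<omega>. X \<omega> * indicator (E b) \<omega> * \<Phi> (S a b \<omega>) \<partial>M)"
      using step.IH by (simp add: E_def)
    also have "\<dots> \<le> (\<integral>\<^sup>+\<omega>. X \<omega> * indicator (E b) \<omega> * \<Phi> (S a (Suc b) \<omega>) \<partial>M)"
      unfolding nn_integral_S_Suc[OF XE[OF step.hyps(1)] \<Phi> step.hyps(1)]
      by (intro nn_integral_mono mult_left_mono sub) auto
    finally show "c * (\<integral>\<^sup>+\<omega>. X \<omega> * indicator (E b) \<omega> \<partial>M)
        \<le> (\<integral>\<^sup>+\<omega>. X \<omega> * indicator (E b) \<omega> * \<Phi> (S a (Suc b) \<omega>) \<partial>M)" .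
    show "c * (\<integral>\<^sup>+\<omega>. X \<omega> * indicator G \<omega> \<partial>M) \<le> (\<integral>\<^sup>+\<omega>. X \<omega> * indicator G \<omega> * \<Phi> (S a (Suc b) \<omega>) \<partial>M)"
      by (subst nn_integral_cmult[symmetric], simp, rule nn_integral_mono, rule threshold_le) (auto simp: G_def)
  qed
  also have "\<dots> = (\<integral>\<^sup>+\<omega>. X \<omega> * indicator (E (Suc b)) \<omega> * \<Phi> (S a (Suc b) \<omega>) \<partial>M)"
    unfolding split distrib_left distrib_right by (subst nn_integral_add) auto
  finally show ?case unfolding E_def .
qed

end

context adapted_noise
begin

definition loud_set :: "real \<Rightarrow> nat \<Rightarrow> nat \<Rightarrow> 'o set" where
  "loud_set e a b = {\<omega>\<in>space M. \<exists>j\<in>{a..b}. e < norm (S a j \<omega>)}"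

lemma loud_set_past: "loud_set e a b \<in> sets (past b)"
proof -
  have "{\<omega>\<in>space (past b). e < norm (S a j \<omega>)} \<in> sets (past b)" if "j \<le> b" for j
  proof -
    note [measurable] = past_mono[OF that S_past[of a j]]
    show ?thesis by measurable
  qed
  then have "(\<Union>j\<in>{a..b}. {\<omega>\<in>space (past b). e < norm (S a j \<omega>)}) \<in> sets (past b)"
    by (intro sets.finite_UN) auto
  also have "(\<Union>j\<in>{a..b}. {\<omega>\<in>space (past b). e < norm (S a j \<omega>)}) = loud_set e a b"
    by (auto simp: loud_set_def)
  finally show ?thesis .
qed

lemma loud_set_measurable [measurable]: "loud_set e a b \<in> sets M"
  using measurable_sets[OF id_measurable_past loud_set_past[of e a b]]
  by (simp add: loud_set_def Int_def conj_commute cong: conj_cong)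

lemma S_measurable [measurable]: "S a b \<in> borel_measurable M"
  using S_past by (rule measurable_past)

text \<open>Borel-Cantelli along the thresholds \<open>1 / real (Suc q)\<close>; lowering a
  threshold enlarges the loud sets, so countably many suffice.\<close>

lemma summable_imp_eventually_quiet:
  assumes "\<And>e. e > 0 \<Longrightarrow> summable (\<lambda>n. prob (loud_set e (win n) (win (Suc n))))"
  shows "AE \<omega> in M. \<forall>e>0. \<forall>\<^sub>F n in sequentially. \<omega> \<notin> loud_set e (win n) (win (Suc n))"
proof -
  have "AE \<omega> in M. \<forall>q. \<forall>\<^sub>F n in sequentially. \<omega> \<in> space M - loud_set (1 / real (Suc q)) (win n) (win (Suc n))"
    unfolding AE_all_countable
    by (intro allI borel_cantelli_AE1 assms) (auto simp: emeasure_eq_measure)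
  then show ?thesis
  proof eventually_elim
    case (elim \<omega>)
    show ?case
    proof (intro allI impI)
      fix e :: real assume "e > 0"
      then obtain q where q: "1 / real (Suc q) < e" using nat_approx_posE by blast
      from elim[rule_format, of q] show "\<forall>\<^sub>F n in sequentially. \<omega> \<notin> loud_set e (win n) (win (Suc n))"
      proof eventually_elim
        case (elim n)
        then show ?case using q by (auto simp: loud_set_def intro: less_trans)
      qed
    qed
  qed
qed

text \<open>Each square is at most \<open>\<delta>\<close> times the step, and the steps of one
  window add up to at most \<open>1 + b\<close>.\<close>

lemma sum_squares_le:
  assumes "\<And>i. i \<ge> win n \<Longrightarrow> \<alpha> i \<le> \<delta>" "\<And>k. \<alpha> k \<le> b"
  shows "(\<Sum>i\<in>{win n..<win (Suc n)}. (\<alpha> i)\<^sup>2) \<le> \<delta> * (1 + b)"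
proof -
  have \<delta>: "\<delta> > 0" using assms(1)[of "win n"] \<alpha>_pos[of "win n"] by simp
  have "(\<Sum>i\<in>{win n..<win (Suc n)}. (\<alpha> i)\<^sup>2) \<le> (\<Sum>i\<in>{win n..<win (Suc n)}. \<delta> * \<alpha> i)"
    unfolding power2_eq_square
    by (intro sum_mono mult_right_mono) (use assms(1) \<alpha>_pos in \<open>auto simp: less_imp_le\<close>)
  also have "\<dots> = \<delta> * (T (win (Suc n)) - T (win n))"
    by (simp add: T_diff[OF win_le_Suc] sum_distrib_left)
  also have "\<dots> \<le> \<delta> * (1 + b)"
    using T_nxt_le[of "win n"] assms(2)[of "nxt (win n) - 1"] \<delta> by (intro mult_left_mono) (auto simp: win_Suc)
  finally show ?thesis .
qed

end

section \<open>Square integrable noise: rarity of loud windows\<close>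

locale square_integrable_noise = adapted_noise M P \<xi> \<alpha> w N
  for M :: "'o measure" and P :: "'s measure" and \<xi> \<alpha> and w :: "nat \<Rightarrow> 'o \<Rightarrow> 'a::euclidean_space" and N +
  fixes C :: real
  assumes N_square_integrable: "\<And>z. integrable P (\<lambda>s. (norm (N z s))\<^sup>2)"
    and N_square_le: "\<And>z. (\<integral>s. (norm (N z s))\<^sup>2 \<partial>P) \<le> C"
begin

lemma C_nonneg: "0 \<le> C"
  by (rule order_trans[OF integral_nonneg_AE N_square_le[of 0]]) simp

text \<open>The cross term disappears because the noise has mean 0.\<close>

lemma nn_integral_square:
  "(\<integral>\<^sup>+s. ennreal ((norm (y + a *\<^sub>R N z s))\<^sup>2) \<partial>P) = ennreal ((norm y)\<^sup>2 + a\<^sup>2 * (\<integral>s. (norm (N z s))\<^sup>2 \<partial>P))"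
proof -
  have eq: "(norm (y + a *\<^sub>R N z s))\<^sup>2 = (norm y)\<^sup>2 + 2 * a * (y \<bullet> N z s) + a\<^sup>2 * (norm (N z s))\<^sup>2" for s
    unfolding power2_norm_eq_inner
    by (simp add: inner_add_left inner_add_right inner_commute power2_eq_square algebra_simps)
  have int: "integrable P (\<lambda>s. y \<bullet> N z s)" "integrable P (\<lambda>s. (norm (N z s))\<^sup>2)"
    using N_integrable N_square_integrable by auto
  have int': "integrable P (\<lambda>s. (norm (y + a *\<^sub>R N z s))\<^sup>2)"
    unfolding eq by (intro Bochner_Integration.integrable_add integrable_mult_right int P.integrable_const)
  have "(\<integral>\<^sup>+s. ennreal ((norm (y + a *\<^sub>R N z s))\<^sup>2) \<partial>P) = ennreal (\<integral>s. (norm (y + a *\<^sub>R N z s))\<^sup>2 \<partial>P)"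
    by (rule nn_integral_eq_integral[OF int']) simp
  also have "(\<integral>s. (norm (y + a *\<^sub>R N z s))\<^sup>2 \<partial>P) = (norm y)\<^sup>2 + a\<^sup>2 * (\<integral>s. (norm (N z s))\<^sup>2 \<partial>P)"
    using int N_integrable by (simp add: eq N_mean P.prob_space)
  finally show ?thesis .
qed

lemma second_moment:
  assumes X: "X \<in> borel_measurable (past a)" and "a \<le> b"
  shows "(\<integral>\<^sup>+\<omega>. X \<omega> * ennreal ((norm (S a b \<omega>))\<^sup>2) \<partial>M) \<le> ennreal (C * (\<Sum>i\<in>{a..<b}. (\<alpha> i)\<^sup>2)) * (\<integral>\<^sup>+\<omega>. X \<omega> \<partial>M)"
  using assms(2)
proof (induction b rule: dec_induct)
  case (step b)
  have Xb: "X \<in> borel_measurable (past b)" using past_mono[OF step.hyps(1) X] .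
  have [measurable]: "X \<in> borel_measurable M" using X by (rule measurable_past)
  have "(\<integral>\<^sup>+\<omega>. X \<omega> * ennreal ((norm (S a (Suc b) \<omega>))\<^sup>2) \<partial>M)
    = (\<integral>\<^sup>+\<omega>. X \<omega> * ennreal ((norm (S a b \<omega>))\<^sup>2 + (\<alpha> b)\<^sup>2 * (\<integral>s. (norm (N (w b \<omega>) s))\<^sup>2 \<partial>P)) \<partial>M)"
    by (subst nn_integral_S_Suc[OF Xb _ step.hyps(1), of "\<lambda>y. ennreal ((norm y)\<^sup>2)"]) (auto simp: nn_integral_square)
  also have "\<dots> \<le> (\<integral>\<^sup>+\<omega>. X \<omega> * ennreal ((norm (S a b \<omega>))\<^sup>2) + ennreal ((\<alpha> b)\<^sup>2 * C) * X \<omega> \<partial>M)"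
  proof (rule nn_integral_mono)
    fix \<omega>
    have "ennreal ((norm (S a b \<omega>))\<^sup>2 + (\<alpha> b)\<^sup>2 * (\<integral>s. (norm (N (w b \<omega>) s))\<^sup>2 \<partial>P))
        \<le> ennreal ((norm (S a b \<omega>))\<^sup>2 + (\<alpha> b)\<^sup>2 * C)"
      by (intro ennreal_leI add_left_mono mult_left_mono N_square_le) auto
    also have "\<dots> = ennreal ((norm (S a b \<omega>))\<^sup>2) + ennreal ((\<alpha> b)\<^sup>2 * C)"
      using C_nonneg by (intro ennreal_plus) auto
    finally show "X \<omega> * ennreal ((norm (S a b \<omega>))\<^sup>2 + (\<alpha> b)\<^sup>2 * (\<integral>s. (norm (N (w b \<omega>) s))\<^sup>2 \<partial>P))
        \<le> X \<omega> * ennreal ((norm (S a b \<omega>))\<^sup>2) + ennreal ((\<alpha> b)\<^sup>2 * C) * X \<omega>"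
      unfolding mult.commute[of "ennreal ((\<alpha> b)\<^sup>2 * C)"] distrib_left[symmetric] by (rule mult_left_mono) simp
  qed
  also have "\<dots> = (\<integral>\<^sup>+\<omega>. X \<omega> * ennreal ((norm (S a b \<omega>))\<^sup>2) \<partial>M) + ennreal ((\<alpha> b)\<^sup>2 * C) * (\<integral>\<^sup>+\<omega>. X \<omega> \<partial>M)"
    by (subst nn_integral_add) (auto simp: nn_integral_cmult)
  also have "\<dots> \<le> ennreal (C * (\<Sum>i\<in>{a..<b}. (\<alpha> i)\<^sup>2)) * (\<integral>\<^sup>+\<omega>. X \<omega> \<partial>M) + ennreal ((\<alpha> b)\<^sup>2 * C) * (\<integral>\<^sup>+\<omega>. X \<omega> \<partial>M)"
    by (rule add_right_mono) (rule step.IH)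
  also have "\<dots> = ennreal (C * (\<Sum>i\<in>{a..<Suc b}. (\<alpha> i)\<^sup>2)) * (\<integral>\<^sup>+\<omega>. X \<omega> \<partial>M)"
  proof -
    have "ennreal (C * (\<Sum>i\<in>{a..<b}. (\<alpha> i)\<^sup>2)) + ennreal ((\<alpha> b)\<^sup>2 * C) = ennreal (C * (\<Sum>i\<in>{a..<b}. (\<alpha> i)\<^sup>2) + (\<alpha> b)\<^sup>2 * C)"
      using C_nonneg by (intro ennreal_plus[symmetric]) (auto intro!: mult_nonneg_nonneg sum_nonneg)
    also have "C * (\<Sum>i\<in>{a..<b}. (\<alpha> i)\<^sup>2) + (\<alpha> b)\<^sup>2 * C = C * (\<Sum>i\<in>{a..<Suc b}. (\<alpha> i)\<^sup>2)"
      using step.hyps(1) by (simp add: algebra_simps)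
    finally show ?thesis unfolding distrib_right[symmetric] by simp
  qed
  finally show ?case .
qed simp

text \<open>With \<open>X\<close> ranging over weights known at time \<open>a\<close>, this bounds
  the conditional probability of a loud window by a deterministic number.\<close>

lemma kolmogorov_inequality:
  assumes X: "X \<in> borel_measurable (past a)" and ab: "a \<le> b" and "\<epsilon> > 0"
  shows "(\<integral>\<^sup>+\<omega>. X \<omega> * indicator (loud_set \<epsilon> a b) \<omega> \<partial>M)
    \<le> ennreal (C * (\<Sum>i\<in>{a..<b}. (\<alpha> i)\<^sup>2) / \<epsilon>\<^sup>2) * (\<integral>\<^sup>+\<omega>. X \<omega> \<partial>M)"
proof -
  let ?\<Phi> = "\<lambda>y. ennreal ((norm y)\<^sup>2)"
  define E where "E = {\<omega>\<in>space M. \<exists>j\<in>{a..b}. ennreal (\<epsilon>\<^sup>2) \<le> ?\<Phi> (S a j \<omega>)}"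
  have "(\<integral>\<^sup>+\<omega>. X \<omega> * indicator (loud_set \<epsilon> a b) \<omega> \<partial>M) \<le> (\<integral>\<^sup>+\<omega>. X \<omega> * indicator E \<omega> \<partial>M)"
    using \<open>\<epsilon> > 0\<close>
    by (intro nn_integral_mono mult_left_mono indicator_leI)
      (auto simp: loud_set_def E_def indicator_def intro!: bexI ennreal_leI power_mono)
  also have "\<dots> = ennreal (1 / \<epsilon>\<^sup>2) * (ennreal (\<epsilon>\<^sup>2) * (\<integral>\<^sup>+\<omega>. X \<omega> * indicator E \<omega> \<partial>M))"
    using \<open>\<epsilon> > 0\<close> by (simp add: mult.assoc[symmetric] ennreal_mult[symmetric])
  also have "\<dots> \<le> ennreal (1 / \<epsilon>\<^sup>2) * (\<integral>\<^sup>+\<omega>. X \<omega> * indicator E \<omega> * ?\<Phi> (S a b \<omega>) \<partial>M)"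
    unfolding E_def
  proof (intro mult_left_mono maximal_inequality[OF X _ ab])
    show "ennreal ((norm y)\<^sup>2) \<le> (\<integral>\<^sup>+s. ennreal ((norm (y + \<alpha> j *\<^sub>R N z s))\<^sup>2) \<partial>P)" for j y z
      unfolding nn_integral_square by (intro ennreal_leI) simp
  qed simp_all
  also have "\<dots> \<le> ennreal (1 / \<epsilon>\<^sup>2) * (\<integral>\<^sup>+\<omega>. X \<omega> * ?\<Phi> (S a b \<omega>) \<partial>M)"
    by (intro mult_left_mono nn_integral_mono mult_right_mono) (auto simp: indicator_def)
  also have "\<dots> \<le> ennreal (1 / \<epsilon>\<^sup>2) * (ennreal (C * (\<Sum>i\<in>{a..<b}. (\<alpha> i)\<^sup>2)) * (\<integral>\<^sup>+\<omega>. X \<omega> \<partial>M))"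
    by (intro mult_left_mono second_moment X ab) simp
  also have "\<dots> = ennreal (C * (\<Sum>i\<in>{a..<b}. (\<alpha> i)\<^sup>2) / \<epsilon>\<^sup>2) * (\<integral>\<^sup>+\<omega>. X \<omega> \<partial>M)"
    using C_nonneg by (simp add: mult.assoc[symmetric] ennreal_mult[symmetric] sum_nonneg)
  finally show ?thesis .
qed

text \<open>The windows are disjoint, so their sums of squared steps are summable along with the
  squares themselves.\<close>

lemma eventually_quiet_summable:
  assumes "summable (\<lambda>k. (\<alpha> k)\<^sup>2)"
  shows "AE \<omega> in M. \<forall>e>0. \<forall>\<^sub>F n in sequentially. \<omega> \<notin> loud_set e (win n) (win (Suc n))"
proof (rule summable_imp_eventually_quiet)
  fix e :: real assume "e > 0"
  define q where "q n = (\<Sum>i\<in>{win n..<win (Suc n)}. (\<alpha> i)\<^sup>2)" for n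
  have le: "prob (loud_set e (win n) (win (Suc n))) \<le> C / e\<^sup>2 * q n" for n
  proof -
    have "emeasure M (loud_set e (win n) (win (Suc n))) \<le> ennreal (C * q n / e\<^sup>2) * (\<integral>\<^sup>+\<omega>. 1 \<partial>M)"
      using kolmogorov_inequality[of "\<lambda>_. 1" "win n" "win (Suc n)" e] \<open>e > 0\<close> win_le_Suc[of n]
      by (simp add: q_def)
    then show ?thesis
      using C_nonneg by (simp add: emeasure_eq_measure prob_space q_def sum_nonneg)
  qed
  have "(\<Sum>n<K. q n) = (\<Sum>i<win K. (\<alpha> i)\<^sup>2)" for K
  proof (induction K)
    case (Suc K)
    have "(\<Sum>i<win (Suc K). (\<alpha> i)\<^sup>2) = (\<Sum>i<win K. (\<alpha> i)\<^sup>2) + q K"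
      unfolding q_def lessThan_atLeast0 by (rule sum.atLeastLessThan_concat[symmetric]) (use win_le_Suc in auto)
    then show ?case using Suc by simp
  qed simp
  then have "(\<Sum>n<K. q n) \<le> (\<Sum>i. (\<alpha> i)\<^sup>2)" for K
    using sum_le_suminf[OF assms] by simp
  then have "summable q"
    by (intro summableI_nonneg_bounded) (auto simp: q_def sum_nonneg)
  then have "summable (\<lambda>n. C / e\<^sup>2 * q n)"
    by (rule summable_mult)
  then show "summable (\<lambda>n. prob (loud_set e (win n) (win (Suc n))))"
    by (rule summable_comparison_test') (use le in auto)
qed


lemma kolmogorov_vanish:
  assumes "\<epsilon> > 0" "\<delta> > 0"
  shows "\<forall>\<^sub>F n in sequentially. C * (\<Sum>i\<in>{win n..<win (Suc n)}. (\<alpha> i)\<^sup>2) / \<epsilon>\<^sup>2 \<le> \<delta>"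
proof -
  obtain b where b: "b > 0" "\<And>k. \<alpha> k \<le> b" using \<alpha>_bounded by blast
  \<comment> \<open>Solves \<open>(C + 1) * e * (1 + b) = \<delta> * \<epsilon>^2\<close>; the
    summand 1 is there because \<open>C\<close> may be 0.\<close>
  define e where "e = \<delta> * \<epsilon>\<^sup>2 / ((C + 1) * (1 + b))"
  have "e > 0" unfolding e_def using assms C_nonneg b by (intro divide_pos_pos mult_pos_pos) auto
  have "\<forall>\<^sub>F k in sequentially. \<alpha> k < e"
    using \<alpha>_null \<open>e > 0\<close> by (rule order_tendstoD)
  then obtain K where K: "\<And>k. k \<ge> K \<Longrightarrow> \<alpha> k < e" by (auto simp: eventually_sequentially)
  show ?thesis
    using eventually_ge_at_top[of K]
  proof eventually_elim
    case (elim n)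
    have "(\<Sum>i\<in>{win n..<win (Suc n)}. (\<alpha> i)\<^sup>2) \<le> e * (1 + b)"
      by (rule sum_squares_le) (use K b(2) win_ge[of n] elim in \<open>auto intro!: less_imp_le\<close>)
    then have "C * (\<Sum>i\<in>{win n..<win (Suc n)}. (\<alpha> i)\<^sup>2) \<le> (C + 1) * (e * (1 + b))"
      using C_nonneg by (intro mult_mono) (auto intro: sum_nonneg)
    also have "\<dots> = e * ((C + 1) * (1 + b))" by (simp only: mult_ac)
    also have "\<dots> = \<delta> * \<epsilon>\<^sup>2"
    proof -
      have "(C + 1) * (1 + b) \<noteq> 0" using C_nonneg b(1) by auto
      then show ?thesis unfolding e_def by (rule nonzero_eq_divide_eq[THEN iffD1, OF _ refl])
    qed
    finally show ?case using assms(1) by (simp add: divide_le_eq)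
  qed
qed

definition loud_count :: "real \<Rightarrow> nat \<Rightarrow> 'o \<Rightarrow> nat" where
  "loud_count e K \<omega> = card {n. n < K \<and> \<omega> \<in> loud_set e (win n) (win (Suc n))}"

lemma loud_count_Suc:
  "loud_count e (Suc K) \<omega> = loud_count e K \<omega> + of_bool (\<omega> \<in> loud_set e (win K) (win (Suc K)))"
proof -
  have "{n. n < Suc K \<and> \<omega> \<in> loud_set e (win n) (win (Suc n))} =
      {n. n < K \<and> \<omega> \<in> loud_set e (win n) (win (Suc n))} \<union>
      (if \<omega> \<in> loud_set e (win K) (win (Suc K)) then {K} else {})"
    by (auto simp: less_Suc_eq)
  then show ?thesis by (auto simp: loud_count_def)
qed

lemma power_loud_count_past: "(\<lambda>\<omega>. 2 ^ loud_count e K \<omega> :: ennreal) \<in> borel_measurable (past (win K))"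
proof (induction K)
  case 0
  then show ?case by (simp add: loud_count_def)
next
  case (Suc K)
  have *: "(2 ^ loud_count e (Suc K) \<omega> :: ennreal) =
      2 ^ loud_count e K \<omega> * (1 + indicator (loud_set e (win K) (win (Suc K))) \<omega>)" for \<omega>
    by (simp add: loud_count_Suc indicator_def mult.commute)
  note [measurable] = past_mono[OF win_le_Suc Suc] loud_set_past[of e "win K" "win (Suc K)"]
  show ?case unfolding * by measurable
qed

text \<open>The number of loud windows is dominated by a sum of independent Bernoulli variables whose
  parameters tend to \<open>0\<close>, so its exponential moments grow subexponentially.\<close>

lemma loud_count_moment:
  assumes "\<epsilon> > 0"
  shows "(\<integral>\<^sup>+\<omega>. 2 ^ loud_count \<epsilon> K \<omega> \<partial>M) \<le>
    ennreal (exp (\<Sum>n<K. C * (\<Sum>i\<in>{win n..<win (Suc n)}. (\<alpha> i)\<^sup>2) / \<epsilon>\<^sup>2))"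
proof (induction K)
  case 0
  then show ?case by (simp add: loud_count_def emeasure_space_1)
next
  case (Suc K)
  define c where "c = C * (\<Sum>i\<in>{win K..<win (Suc K)}. (\<alpha> i)\<^sup>2) / \<epsilon>\<^sup>2"
  have "c \<ge> 0" using C_nonneg by (auto simp: c_def intro!: mult_nonneg_nonneg divide_nonneg_nonneg sum_nonneg)
  let ?L = "loud_set \<epsilon> (win K) (win (Suc K))"
  let ?X = "\<lambda>\<omega>. 2 ^ loud_count \<epsilon> K \<omega> :: ennreal"
  have [measurable]: "?X \<in> borel_measurable M"
    using power_loud_count_past by (rule measurable_past)
  \<comment> \<open>Base 2 turns a window into the factor 1 plus its indicator, so the maximal
    inequality applies with the weight \<open>?X\<close>.\<close>
  have *: "(2 ^ loud_count \<epsilon> (Suc K) \<omega> :: ennreal) = ?X \<omega> + ?X \<omega> * indicator ?L \<omega>" for \<omega>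
    by (simp add: loud_count_Suc indicator_def mult_2)
  have "(\<integral>\<^sup>+\<omega>. 2 ^ loud_count \<epsilon> (Suc K) \<omega> \<partial>M) = (\<integral>\<^sup>+\<omega>. ?X \<omega> \<partial>M) + (\<integral>\<^sup>+\<omega>. ?X \<omega> * indicator ?L \<omega> \<partial>M)"
    unfolding * by (rule nn_integral_add) auto
  also have "\<dots> \<le> (\<integral>\<^sup>+\<omega>. ?X \<omega> \<partial>M) + ennreal c * (\<integral>\<^sup>+\<omega>. ?X \<omega> \<partial>M)"
    unfolding c_def by (intro add_left_mono kolmogorov_inequality power_loud_count_past win_le_Suc assms)
  also have "\<dots> = ennreal (1 + c) * (\<integral>\<^sup>+\<omega>. ?X \<omega> \<partial>M)"
    using \<open>c \<ge> 0\<close> by (simp add: distrib_right)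
  also have "\<dots> \<le> ennreal (exp c) * ennreal (exp (\<Sum>n<K. C * (\<Sum>i\<in>{win n..<win (Suc n)}. (\<alpha> i)\<^sup>2) / \<epsilon>\<^sup>2))"
    by (intro mult_mono Suc.IH ennreal_leI exp_ge_add_one_self) auto
  also have "\<dots> = ennreal (exp (\<Sum>n<Suc K. C * (\<Sum>i\<in>{win n..<win (Suc n)}. (\<alpha> i)\<^sup>2) / \<epsilon>\<^sup>2))"
    by (simp add: ennreal_mult[symmetric] exp_add c_def mult.commute)
  finally show ?case .
qed

text \<open>Markov's inequality for \<open>2 ^ loud_count\<close>. All but finitely many windows
  contribute at most \<open>\<delta> / 4\<close> to the exponent of its moment, so the probability
  of more than \<open>\<delta> * K\<close> loud windows decays geometrically in \<open>K\<close> and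
  Borel-Cantelli applies.\<close>

lemma loud_density:
  "AE \<omega> in M. \<forall>e>0. (\<lambda>K. real (loud_count e K \<omega>) / real K) \<longlonglongrightarrow> 0"
proof -
  have ev: "AE \<omega> in M. \<forall>\<^sub>F K in sequentially. \<omega> \<in> space M - {\<omega>\<in>space M. \<delta> * real K \<le> real (loud_count \<epsilon> K \<omega>)}"
    if e0: "\<epsilon> > 0" and d0: "\<delta> > 0" for \<epsilon> \<delta>
  proof -
    define c where "c n = C * (\<Sum>i\<in>{win n..<win (Suc n)}. (\<alpha> i)\<^sup>2) / \<epsilon>\<^sup>2" for n
    have "\<delta> / 4 > 0" using d0 by simp
    obtain n0 where n0: "\<And>n. n \<ge> n0 \<Longrightarrow> c n \<le> \<delta> / 4"
      using kolmogorov_vanish[OF e0 \<open>\<delta> / 4 > 0\<close>] unfolding c_def eventually_sequentially by blast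
    define B where "B = (\<Sum>n<n0. c n)"
    have c_nonneg: "c n \<ge> 0" for n
      using C_nonneg by (auto simp: c_def intro!: mult_nonneg_nonneg divide_nonneg_nonneg sum_nonneg)
    have c_sum: "(\<Sum>n<K. c n) \<le> B + \<delta> / 4 * real K" for K
    proof -
      have "(\<Sum>n<K. c n) \<le> (\<Sum>n<K. (if n < n0 then c n else 0) + \<delta> / 4)"
        using n0 d0 by (intro sum_mono) auto
      also have "\<dots> = (\<Sum>n<K. if n < n0 then c n else 0) + \<delta> / 4 * real K"
        by (simp add: sum.distrib)
      also have "(\<Sum>n<K. if n < n0 then c n else 0) = (\<Sum>n\<in>{n\<in>{..<K}. n < n0}. c n)"
        by (rule sum.inter_filter[symmetric]) simp
      also have "\<dots> \<le> B"
        unfolding B_def by (rule sum_mono2) (use c_nonneg in auto)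
      finally show ?thesis by simp
    qed
    have meas [measurable]: "{\<omega>\<in>space M. \<delta> * real K \<le> real (loud_count \<epsilon> K \<omega>)} \<in> sets M" for K
    proof -
      have "(\<lambda>\<omega>. real (loud_count \<epsilon> K \<omega>)) \<in> borel_measurable M"
      proof (induction K)
        case (Suc K)
        have "(\<lambda>\<omega>. real (loud_count \<epsilon> (Suc K) \<omega>)) =
            (\<lambda>\<omega>. real (loud_count \<epsilon> K \<omega>) + indicator (loud_set \<epsilon> (win K) (win (Suc K))) \<omega>)"
          by (auto simp: loud_count_Suc indicator_def)
        then show ?case using Suc by simp
      qed (simp add: loud_count_def)
      then show ?thesis by measurable
    qed
    have prob_le: "prob {\<omega>\<in>space M. \<delta> * real K \<le> real (loud_count \<epsilon> K \<omega>)} \<le> exp B * exp (- \<delta> / 4) ^ K" for K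
    proof -
      let ?A = "{\<omega>\<in>space M. \<delta> * real K \<le> real (loud_count \<epsilon> K \<omega>)}"
      have "ennreal (exp (\<delta> / 2 * real K)) * emeasure M ?A = (\<integral>\<^sup>+\<omega>. ennreal (exp (\<delta> / 2 * real K)) * indicator ?A \<omega> \<partial>M)"
        by (subst nn_integral_cmult_indicator) (auto intro: meas)
      also have "\<dots> \<le> (\<integral>\<^sup>+\<omega>. 2 ^ loud_count \<epsilon> K \<omega> \<partial>M)"
      proof (rule nn_integral_mono)
        fix \<omega>
        show "ennreal (exp (\<delta> / 2 * real K)) * indicator ?A \<omega> \<le> 2 ^ loud_count \<epsilon> K \<omega>"
        proof (cases "\<omega> \<in> ?A")
          case True
          \<comment> \<open>As \<open>ln 2 \<ge> 1 / 2\<close>, the event forces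
            \<open>2 ^ loud_count\<close> above \<open>exp (\<delta> / 2 * K)\<close>, whereas its
            mean grows only like \<open>exp (\<delta> / 4 * K)\<close>.\<close>
          then have "exp (\<delta> / 2 * real K) \<le> exp (ln 2 * real (loud_count \<epsilon> K \<omega>))"
            using ln2_ge_two_thirds mult_right_mono[of "1 / 2" "ln 2" "real (loud_count \<epsilon> K \<omega>)"] by simp
          also have "\<dots> = 2 ^ loud_count \<epsilon> K \<omega>"
            by (simp add: exp_of_nat2_mult)
          finally have "ennreal (exp (\<delta> / 2 * real K)) \<le> ennreal (2 ^ loud_count \<epsilon> K \<omega>)"
            by (rule ennreal_leI)
          then show ?thesis using True by (simp add: ennreal_power[symmetric])
        qed simp
      qed
      also have "\<dots> \<le> ennreal (exp (B + \<delta> / 4 * real K))"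
        using loud_count_moment[OF e0, of K] c_sum[of K] unfolding c_def[symmetric]
        by (elim order_trans) (intro ennreal_leI, simp)
      finally have "exp (\<delta> / 2 * real K) * prob ?A \<le> exp (B + \<delta> / 4 * real K)"
        by (simp add: emeasure_eq_measure ennreal_mult[symmetric])
      then have "prob ?A \<le> exp (B + \<delta> / 4 * real K) / exp (\<delta> / 2 * real K)"
        by (simp add: pos_le_divide_eq mult.commute)
      also have "\<dots> = exp (B + real K * (- \<delta> / 4))"
        unfolding exp_diff[symmetric] by (simp add: field_simps)
      also have "\<dots> = exp B * exp (- \<delta> / 4) ^ K"
        unfolding exp_add exp_of_nat_mult ..
      finally show ?thesis .
    qed
    have "summable (\<lambda>K. exp B * exp (- \<delta> / 4) ^ K)"
      using d0 by (intro summable_mult summable_geometric) simp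
    then have "summable (\<lambda>K. prob {\<omega>\<in>space M. \<delta> * real K \<le> real (loud_count \<epsilon> K \<omega>)})"
      by (rule summable_comparison_test') (use prob_le in auto)
    then show ?thesis
      by (intro borel_cantelli_AE1 meas) (auto simp: emeasure_eq_measure)
  qed
  have "AE \<omega> in M. \<forall>q r. \<forall>\<^sub>F K in sequentially.
      \<omega> \<in> space M - {\<omega>\<in>space M. 1 / real (Suc r) * real K \<le> real (loud_count (1 / real (Suc q)) K \<omega>)}"
    unfolding AE_all_countable by (intro allI ev) auto
  then show ?thesis
  proof eventually_elim
    case (elim \<omega>)
    show ?case
    proof (intro allI impI tendstoI)
      fix e d :: real assume "e > 0" "d > 0"
      obtain q where q: "1 / real (Suc q) < e" using \<open>e > 0\<close> nat_approx_posE by blast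
      obtain r where r: "1 / real (Suc r) < d" using \<open>d > 0\<close> nat_approx_posE by blast
      show "\<forall>\<^sub>F K in sequentially. dist (real (loud_count e K \<omega>) / real K) 0 < d"
        using elim[rule_format, of r q] eventually_gt_at_top[of 0]
      proof eventually_elim
        case (elim K)
        have "{n. n < K \<and> \<omega> \<in> loud_set e (win n) (win (Suc n))}
            \<subseteq> {n. n < K \<and> \<omega> \<in> loud_set (1 / real (Suc q)) (win n) (win (Suc n))}"
          using q by (auto simp: loud_set_def intro: less_trans)
        then have "loud_count e K \<omega> \<le> loud_count (1 / real (Suc q)) K \<omega>"
          unfolding loud_count_def by (intro card_mono) auto
        then have "real (loud_count e K \<omega>) < 1 / real (Suc r) * real K"
          using elim by auto
        also have "\<dots> \<le> d * real K" using r by (intro mult_right_mono) auto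
        finally show ?case using elim(2) by (simp add: divide_less_eq)
      qed
    qed
  qed
qed

end

section \<open>Bounded noise: bounds of Hoeffding and Azuma type\<close>

locale bounded_noise = adapted_noise M P \<xi> \<alpha> w N
  for M :: "'o measure" and P :: "'s measure" and \<xi> \<alpha> and w :: "nat \<Rightarrow> 'o \<Rightarrow> 'a::euclidean_space" and N +
  fixes B :: real
  assumes B_pos: "B > 0" and N_bounded: "\<And>z. AE s in P. norm (N z s) \<le> B"
begin

text \<open>The lower bound follows from \<open>1 + x \<le> exp x\<close> and the vanishing mean; it
  will give the submartingale property. The upper bound is Hoeffding's lemma.\<close>

lemma exp_moment:
  assumes "l > 0" and e: "norm e \<le> 1"
  shows "1 \<le> (\<integral>\<^sup>+s. ennreal (exp (l * (N z s \<bullet> e))) \<partial>P)"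
    and "(\<integral>\<^sup>+s. ennreal (exp (l * (N z s \<bullet> e))) \<partial>P) \<le> ennreal (exp (l\<^sup>2 * B\<^sup>2 / 2))"
proof -
  have [measurable]: "N z \<in> borel_measurable P" using N_integrable by auto
  have bound: "AE s in P. \<bar>N z s \<bullet> e\<bar> \<le> B"
    using N_bounded[of z]
  proof eventually_elim
    case (elim s)
    have "\<bar>N z s \<bullet> e\<bar> \<le> norm (N z s) * norm e" by (rule Cauchy_Schwarz_ineq2)
    also have "\<dots> \<le> norm (N z s) * 1" using e by (intro mult_left_mono) auto
    finally show ?case using elim by simp
  qed
  have int: "integrable P (\<lambda>s. N z s \<bullet> e)" using N_integrable by auto
  have mean: "(\<integral>s. N z s \<bullet> e \<partial>P) = 0" using N_integrable by (simp add: N_mean)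
  interpret interval_bounded_random_variable P "\<lambda>s. N z s \<bullet> e" "- B" B
  proof
    show "AE s in P. N z s \<bullet> e \<in> {- B..B}"
      using bound by eventually_elim (auto simp: abs_le_iff)
  qed measurable
  \<comment> \<open>Hoeffding's constant for an interval of width \<open>2 * B\<close>.\<close>
  have "(B - - B)\<^sup>2 / 8 = B\<^sup>2 / 2" by (simp add: power2_eq_square)
  then have "l\<^sup>2 * (B - - B)\<^sup>2 / 8 = l\<^sup>2 * B\<^sup>2 / 2" by (metis times_divide_eq_right)
  then show "(\<integral>\<^sup>+s. ennreal (exp (l * (N z s \<bullet> e))) \<partial>P) \<le> ennreal (exp (l\<^sup>2 * B\<^sup>2 / 2))"
    using Hoeffdings_lemma_nn_integral_0[OF \<open>l > 0\<close> mean] by (simp add: mult.commute)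
  have exp_int: "integrable P (\<lambda>s. exp (l * (N z s \<bullet> e)))"
  proof (rule P.integrable_const_bound[where B = "exp (l * B)"])
    show "AE s in P. norm (exp (l * (N z s \<bullet> e))) \<le> exp (l * B)"
      using bound by eventually_elim (use \<open>l > 0\<close> in auto)
  qed measurable
  have "1 = (\<integral>s. 1 + l * (N z s \<bullet> e) \<partial>P)"
    using int by (simp add: mean P.prob_space)
  also have "\<dots> \<le> (\<integral>s. exp (l * (N z s \<bullet> e)) \<partial>P)"
    using int exp_int by (intro integral_mono exp_ge_add_one_self) auto
  finally have "ennreal 1 \<le> ennreal (\<integral>s. exp (l * (N z s \<bullet> e)) \<partial>P)" by (rule ennreal_leI)
  also have "\<dots> = (\<integral>\<^sup>+s. ennreal (exp (l * (N z s \<bullet> e))) \<partial>P)"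
    by (rule nn_integral_eq_integral[symmetric]) (use exp_int in auto)
  finally show "1 \<le> (\<integral>\<^sup>+s. ennreal (exp (l * (N z s \<bullet> e))) \<partial>P)" by simp
qed

lemma exp_step:
  "(\<integral>\<^sup>+s. ennreal (exp (l * ((y + a *\<^sub>R N z s) \<bullet> e))) \<partial>P) =
    ennreal (exp (l * (y \<bullet> e))) * (\<integral>\<^sup>+s. ennreal (exp (l * a * (N z s \<bullet> e))) \<partial>P)"
proof -
  have [measurable]: "N z \<in> borel_measurable P" using N_integrable by auto
  have "ennreal (exp (l * ((y + a *\<^sub>R N z s) \<bullet> e))) = ennreal (exp (l * (y \<bullet> e))) * ennreal (exp (l * a * (N z s \<bullet> e)))" for s
    by (simp add: inner_add_left distrib_left exp_add ennreal_mult mult.assoc)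
  then show ?thesis by (simp add: nn_integral_cmult)
qed

lemma exp_growth:
  assumes "l > 0" "norm e \<le> 1" "a \<le> b"
  shows "(\<integral>\<^sup>+\<omega>. ennreal (exp (l * (S a b \<omega> \<bullet> e))) \<partial>M) \<le> ennreal (exp (l\<^sup>2 * B\<^sup>2 / 2 * (\<Sum>i\<in>{a..<b}. (\<alpha> i)\<^sup>2)))"
  using assms(3)
proof (induction b rule: dec_induct)
  case base
  then show ?case by (simp add: emeasure_space_1)
next
  case (step b)
  let ?\<Phi> = "\<lambda>y. ennreal (exp (l * (y \<bullet> e)))"
  have l: "l * \<alpha> b > 0" using assms(1) \<alpha>_pos by simp
  have "(\<integral>\<^sup>+\<omega>. ?\<Phi> (S a (Suc b) \<omega>) \<partial>M) = (\<integral>\<^sup>+\<omega>. (\<integral>\<^sup>+s. ?\<Phi> (S a b \<omega> + \<alpha> b *\<^sub>R N (w b \<omega>) s) \<partial>P) \<partial>M)"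
    using nn_integral_S_Suc[of "\<lambda>_. 1" b ?\<Phi> a] step.hyps(1) by simp
  also have "\<dots> \<le> (\<integral>\<^sup>+\<omega>. ?\<Phi> (S a b \<omega>) * ennreal (exp ((l * \<alpha> b)\<^sup>2 * B\<^sup>2 / 2)) \<partial>M)"
    unfolding exp_step by (intro nn_integral_mono mult_left_mono exp_moment(2)[OF l assms(2)]) simp
  also have "\<dots> = (\<integral>\<^sup>+\<omega>. ?\<Phi> (S a b \<omega>) \<partial>M) * ennreal (exp ((l * \<alpha> b)\<^sup>2 * B\<^sup>2 / 2))"
    by (rule nn_integral_multc) simp
  also have "\<dots> \<le> ennreal (exp (l\<^sup>2 * B\<^sup>2 / 2 * (\<Sum>i\<in>{a..<b}. (\<alpha> i)\<^sup>2))) * ennreal (exp ((l * \<alpha> b)\<^sup>2 * B\<^sup>2 / 2))"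
    by (rule mult_right_mono[OF step.IH]) simp
  also have "\<dots> = ennreal (exp (l\<^sup>2 * B\<^sup>2 / 2 * (\<Sum>i\<in>{a..<Suc b}. (\<alpha> i)\<^sup>2)))"
    using step.hyps(1)
    by (simp add: ennreal_mult[symmetric] exp_add[symmetric] power_mult_distrib distrib_left mult_ac)
  finally show ?case .
qed

lemma exceed_measurable: "{\<omega>\<in>space M. \<exists>j\<in>{a..b}. r \<le> S a j \<omega> \<bullet> e} \<in> sets M"
proof -
  have "(\<Union>j\<in>{a..b}. {\<omega>\<in>space M. r \<le> S a j \<omega> \<bullet> e}) \<in> sets M"
    by (intro sets.finite_UN) auto
  also have "(\<Union>j\<in>{a..b}. {\<omega>\<in>space M. r \<le> S a j \<omega> \<bullet> e}) = {\<omega>\<in>space M. \<exists>j\<in>{a..b}. r \<le> S a j \<omega> \<bullet> e}" by auto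
  finally show ?thesis .
qed

text \<open>Doob's inequality for exponentials of the component along \<open>e\<close>, optimized in
  the parameter \<open>l\<close>. The majorant \<open>Q\<close> stands for the sum of squares, which
  is 0 if \<open>a = b\<close>.\<close>

lemma azuma_inequality:
  assumes e: "norm e \<le> 1" and "a \<le> b" "r > 0" and Q: "(\<Sum>i\<in>{a..<b}. (\<alpha> i)\<^sup>2) \<le> Q" "Q > 0"
  shows "prob {\<omega>\<in>space M. \<exists>j\<in>{a..b}. r \<le> S a j \<omega> \<bullet> e} \<le> exp (- r\<^sup>2 / (2 * B\<^sup>2 * Q))"
proof -
  \<comment> \<open>Minimizes \<open>l^2 * B^2 / 2 * Q - l * r\<close>.\<close>
  define l where "l = r / (B\<^sup>2 * Q)"
  have l: "l > 0" using assms B_pos by (simp add: l_def)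
  let ?\<Phi> = "\<lambda>y. ennreal (exp (l * (y \<bullet> e)))"
  let ?E = "{\<omega>\<in>space M. \<exists>j\<in>{a..b}. r \<le> S a j \<omega> \<bullet> e}"
  have E: "?E = {\<omega>\<in>space M. \<exists>j\<in>{a..b}. ennreal (exp (l * r)) \<le> ?\<Phi> (S a j \<omega>)}"
    using l by (auto simp: ennreal_le_iff)
  have "ennreal (exp (l * r)) * emeasure M ?E = ennreal (exp (l * r)) * (\<integral>\<^sup>+\<omega>. 1 * indicator ?E \<omega> \<partial>M)"
    using exceed_measurable[of a b r e] by simp
  also have "\<dots> \<le> (\<integral>\<^sup>+\<omega>. 1 * indicator ?E \<omega> * ?\<Phi> (S a b \<omega>) \<partial>M)"
    unfolding E
  proof (rule maximal_inequality[OF _ _ \<open>a \<le> b\<close>])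
    show "?\<Phi> y \<le> (\<integral>\<^sup>+s. ?\<Phi> (y + \<alpha> j *\<^sub>R N z s) \<partial>P)" for j y z
    proof -
      have "l * \<alpha> j > 0" using l \<alpha>_pos by simp
      from mult_left_mono[OF exp_moment(1)[OF this e], of "?\<Phi> y"] show ?thesis
        unfolding exp_step by simp
    qed
  qed simp_all
  also have "\<dots> \<le> (\<integral>\<^sup>+\<omega>. ?\<Phi> (S a b \<omega>) \<partial>M)"
    by (intro nn_integral_mono) (auto simp: indicator_def)
  also have "\<dots> \<le> ennreal (exp (l\<^sup>2 * B\<^sup>2 / 2 * (\<Sum>i\<in>{a..<b}. (\<alpha> i)\<^sup>2)))"
    by (rule exp_growth[OF l e \<open>a \<le> b\<close>])
  also have "\<dots> \<le> ennreal (exp (l\<^sup>2 * B\<^sup>2 / 2 * Q))"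
    using Q(1) by (intro ennreal_leI) (auto intro!: mult_left_mono)
  finally have "exp (l * r) * prob ?E \<le> exp (l\<^sup>2 * B\<^sup>2 / 2 * Q)"
    by (simp add: emeasure_eq_measure ennreal_mult[symmetric])
  then have "prob ?E \<le> exp (l\<^sup>2 * B\<^sup>2 / 2 * Q) / exp (l * r)"
    by (simp add: pos_le_divide_eq mult.commute)
  also have "\<dots> = exp (l\<^sup>2 * B\<^sup>2 / 2 * Q - l * r)"
    by (rule exp_diff[symmetric])
  also have "l\<^sup>2 * B\<^sup>2 / 2 * Q - l * r = - r\<^sup>2 / (2 * B\<^sup>2 * Q)"
    using B_pos Q(2) unfolding l_def by (simp add: field_simps power2_eq_square)
  finally show ?thesis .
qed

text \<open>A vector of norm above \<open>\<epsilon>\<close> has a coordinate of modulus at least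
  \<open>\<epsilon> / DIM('a)\<close>, since the norm is at most the sum of the moduli. The union
  bound runs over the signed basis vectors.\<close>

lemma loud_prob:
  assumes "a \<le> b" "\<epsilon> > 0" and Q: "(\<Sum>i\<in>{a..<b}. (\<alpha> i)\<^sup>2) \<le> Q" "Q > 0"
  shows "prob (loud_set \<epsilon> a b) \<le> 2 * DIM('a) * exp (- (\<epsilon> / DIM('a))\<^sup>2 / (2 * B\<^sup>2 * Q))"
proof -
  define r where "r = \<epsilon> / DIM('a)"
  have r: "r > 0" using assms by (simp add: r_def)
  let ?E = "\<lambda>e. {\<omega>\<in>space M. \<exists>j\<in>{a..b}. r \<le> S a j \<omega> \<bullet> e}"
  let ?D = "Basis \<union> uminus ` Basis :: 'a set"
  have "loud_set \<epsilon> a b \<subseteq> (\<Union>e\<in>?D. ?E e)"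
  proof
    fix \<omega> assume "\<omega> \<in> loud_set \<epsilon> a b"
    then obtain j where j: "\<omega> \<in> space M" "j \<in> {a..b}" "\<epsilon> < norm (S a j \<omega>)" by (auto simp: loud_set_def)
    have "\<exists>u\<in>Basis. r \<le> \<bar>S a j \<omega> \<bullet> u\<bar>"
    proof (rule ccontr)
      assume "\<not> ?thesis"
      then have "(\<Sum>u\<in>Basis. \<bar>S a j \<omega> \<bullet> u\<bar>) \<le> (\<Sum>u\<in>(Basis::'a set). r)"
        by (intro sum_mono) (auto simp: not_le less_imp_le)
      then show False using norm_le_l1[of "S a j \<omega>"] j(3) by (simp add: r_def)
    qed
    then obtain u where "u \<in> Basis" "r \<le> S a j \<omega> \<bullet> u \<or> r \<le> S a j \<omega> \<bullet> (- u)"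
      by (auto simp: abs_if split: if_splits)
    then show "\<omega> \<in> (\<Union>e\<in>?D. ?E e)" using j by blast
  qed
  then have "prob (loud_set \<epsilon> a b) \<le> prob (\<Union>e\<in>?D. ?E e)"
    by (intro finite_measure_mono sets.finite_UN exceed_measurable) auto
  also have "\<dots> \<le> (\<Sum>e\<in>?D. prob (?E e))"
    by (rule finite_measure_subadditive_finite) (use exceed_measurable in auto)
  also have "\<dots> \<le> (\<Sum>e\<in>?D. exp (- r\<^sup>2 / (2 * B\<^sup>2 * Q)))"
    by (intro sum_mono azuma_inequality assms r) auto
  also have "\<dots> = card ?D * exp (- r\<^sup>2 / (2 * B\<^sup>2 * Q))" by simp
  also have "\<dots> \<le> (2 * DIM('a)) * exp (- r\<^sup>2 / (2 * B\<^sup>2 * Q))"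
  proof -
    have "card ?D \<le> card (Basis :: 'a set) + card (uminus ` Basis :: 'a set)" by (rule card_Un_le)
    also have "card (uminus ` Basis :: 'a set) \<le> DIM('a)" by (rule card_image_le) simp
    finally have "real (card ?D) \<le> real (2 * DIM('a))" by simp
    then show ?thesis by (intro mult_right_mono) auto
  qed
  finally show ?thesis by (simp add: r_def)
qed

text \<open>From index \<open>win n \<ge> n\<close> on, the steps are at most
  \<open>c / ln (real n)\<close>. This makes the sum of squares of window \<open>n\<close> so small
  that its probability of being loud is of order \<open>1 / n^2\<close>.\<close>

lemma eventually_quiet_bounded:
  assumes \<alpha>_small: "\<alpha> \<in> o(\<lambda>k. 1 / ln (real k))"
  shows "AE \<omega> in M. \<forall>e>0. \<forall>\<^sub>F n in sequentially. \<omega> \<notin> loud_set e (win n) (win (Suc n))"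
proof (rule summable_imp_eventually_quiet)
  fix e :: real assume "e > 0"
  define d where "d = real DIM('a)"
  have "d > 0" by (simp add: d_def)
  obtain b where b: "b > 0" "\<And>k. \<alpha> k \<le> b" using \<alpha>_bounded by blast
  \<comment> \<open>Chosen so that the exponent in \<open>loud_prob\<close> becomes
    \<open>- 2 * ln (real n)\<close>.\<close>
  define c where "c = (e / d)\<^sup>2 / (4 * B\<^sup>2 * (1 + b))"
  have "c > 0" using \<open>e > 0\<close> \<open>d > 0\<close> B_pos b by (simp add: c_def)
  have "\<forall>\<^sub>F k in sequentially. norm (\<alpha> k) \<le> c * norm (1 / ln (real k))"
    using landau_o.smallD[OF \<alpha>_small \<open>c > 0\<close>] .
  then obtain K where K: "\<And>k. k \<ge> K \<Longrightarrow> norm (\<alpha> k) \<le> c * norm (1 / ln (real k))"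
    by (auto simp: eventually_sequentially)
  have le: "norm (prob (loud_set e (win n) (win (Suc n)))) \<le> 2 * d * (1 / real n ^ 2)" if n: "n \<ge> K + 2" for n
  proof -
    have ln_n: "ln (real n) > 0" using n by simp
    have "\<alpha> i \<le> c / ln (real n)" if "i \<ge> win n" for i
    proof -
      have "n \<le> i" using that win_ge[of n] by simp
      then have "ln (real n) \<le> ln (real i)" using n by simp
      have "\<alpha> i \<le> c * norm (1 / ln (real i))" using K[of i] \<open>n \<le> i\<close> n \<alpha>_pos[of i] by simp
      also have "\<dots> = c / ln (real i)" using \<open>ln (real n) \<le> ln (real i)\<close> ln_n by simp
      also have "\<dots> \<le> c / ln (real n)"
        using \<open>ln (real n) \<le> ln (real i)\<close> ln_n \<open>c > 0\<close> by (intro divide_left_mono) auto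
      finally show ?thesis .
    qed
    then have Q: "(\<Sum>i\<in>{win n..<win (Suc n)}. (\<alpha> i)\<^sup>2) \<le> c / ln (real n) * (1 + b)"
      by (intro sum_squares_le b)
    have Q_pos: "c / ln (real n) * (1 + b) > 0" using \<open>c > 0\<close> ln_n b by simp
    have "prob (loud_set e (win n) (win (Suc n))) \<le> 2 * d * exp (- (e / d)\<^sup>2 / (2 * B\<^sup>2 * (c / ln (real n) * (1 + b))))"
      using loud_prob[OF win_le_Suc \<open>e > 0\<close> Q Q_pos] by (simp add: d_def)
    also have "- (e / d)\<^sup>2 / (2 * B\<^sup>2 * (c / ln (real n) * (1 + b))) = - 2 * ln (real n)"
    proof -
      define z where "z = 2 * B\<^sup>2 * (1 + b) * c"
      have "z > 0" using B_pos b \<open>c > 0\<close> by (simp add: z_def)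
      have "c * (4 * B\<^sup>2 * (1 + b)) = (e / d)\<^sup>2"
        unfolding c_def by (rule nonzero_eq_divide_eq[THEN iffD1, OF _ refl]) (use B_pos b(1) in auto)
      then have "(e / d)\<^sup>2 = 2 * z" by (simp add: z_def algebra_simps)
      moreover have "2 * B\<^sup>2 * (c / ln (real n) * (1 + b)) = z / ln (real n)" by (simp add: z_def)
      ultimately show ?thesis using \<open>z > 0\<close> ln_n by simp
    qed
    also have "exp (- 2 * ln (real n)) = 1 / real n ^ 2"
    proof -
      have "exp (- 2 * ln (real n)) = inverse (exp (2 * ln (real n)))" by (simp add: exp_minus)
      also have "\<dots> = 1 / real n ^ 2" using n by (simp add: exp_double inverse_eq_divide)
      finally show ?thesis .
    qed
    finally show ?thesis by simp
  qed
  have "summable (\<lambda>n. 2 * d * (1 / real n ^ 2))"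
    by (intro summable_mult) (use inverse_power_summable[of 2, where 'a = real] in \<open>simp add: inverse_eq_divide\<close>)
  then show "summable (\<lambda>n. prob (loud_set e (win n) (win (Suc n))))"
    by (rule summable_comparison_test') (rule le)
qed

end

section \<open>Support functions and measurable selections\<close>

text \<open>A Lipschitz functional is continuous for the Hausdorff distance. The measurability of
  \<open>D\<close> is exploited through two such functionals, the distance to a point and the
  support function.\<close>

lemma borel_measurable_hausdorff:
  fixes \<phi> :: "'a::metric_space set \<Rightarrow> real"
  assumes lip: "\<And>A B. A \<in> nonempty_compacts \<Longrightarrow> B \<in> nonempty_compacts \<Longrightarrow> \<bar>\<phi> A - \<phi> B\<bar> \<le> C * hausdist A B"
  shows "\<phi> \<in> borel_measurable hausdorff_borel"
proof (rule borel_measurableI)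
  interpret H: Metric_space "nonempty_compacts :: 'a set set" hausdist
    by (rule Metric_space_hausdist)
  fix U :: "real set" assume "open U"
  have "openin H.mtopology (\<phi> -` U \<inter> nonempty_compacts)"
    unfolding H.openin_mtopology
  proof (intro conjI allI impI)
    fix A assume A: "A \<in> \<phi> -` U \<inter> nonempty_compacts"
    with \<open>open U\<close> obtain e where e: "e > 0" "\<And>y. dist y (\<phi> A) < e \<Longrightarrow> y \<in> U"
      by (auto simp: open_dist)
    define r where "r = e / (\<bar>C\<bar> + 1)"
    have "r > 0" using e by (simp add: r_def)
    moreover have "H.mball A r \<subseteq> \<phi> -` U \<inter> nonempty_compacts"
    proof
      fix B assume "B \<in> H.mball A r"
      then have B: "B \<in> nonempty_compacts" "hausdist A B < r" by auto
      have "dist (\<phi> B) (\<phi> A) \<le> C * hausdist A B"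
        using lip[of A B] A B by (simp add: dist_real_def abs_minus_commute)
      also have "\<dots> \<le> (\<bar>C\<bar> + 1) * hausdist A B"
        using H.nonneg[of A B] by (intro mult_right_mono) auto
      also have "\<dots> < (\<bar>C\<bar> + 1) * r"
        using B by (intro mult_strict_left_mono) auto
      finally show "B \<in> \<phi> -` U \<inter> nonempty_compacts"
        using B e by (auto simp: r_def)
    qed
    ultimately show "\<exists>r>0. H.mball A r \<subseteq> \<phi> -` U \<inter> nonempty_compacts" by blast
  qed auto
  then show "\<phi> -` U \<inter> space hausdorff_borel \<in> sets hausdorff_borel"
    unfolding space_hausdorff_borel sets_hausdorff_borel by (intro sigma_sets.Basic) simp
qed

lemma infdist_hausdist:
  fixes A B :: "'a::heine_borel set"
  assumes "A \<in> nonempty_compacts" "B \<in> nonempty_compacts"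
  shows "\<bar>infdist q A - infdist q B\<bar> \<le> 1 * hausdist A B"
proof -
  have *: "infdist q B \<le> infdist q A + hausdist A B"
    if AB: "A \<in> nonempty_compacts" "B \<in> nonempty_compacts" for A B :: "'a set"
  proof -
    obtain a where a: "a \<in> A" "infdist q A = dist q a"
      using infdist_attains_inf[of A q] AB by (auto simp: nonempty_compacts_def compact_imp_closed)
    have "infdist a B \<le> hausdist A B"
      using hausdist_le_iff[OF AB, of "hausdist A B"] a by auto
    then show ?thesis
      using infdist_triangle[of q B a] a by simp
  qed
  have "hausdist A B = hausdist B A" by (auto simp: hausdist_def max.commute)
  then show ?thesis using *[of A B] *[of B A] assms by (simp add: abs_le_iff)
qed

lemma measurable_infdist_hausdorff:
  fixes q :: "'a::heine_borel"
  shows "infdist q \<in> borel_measurable hausdorff_borel"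
  by (rule borel_measurable_hausdorff[OF infdist_hausdist])

section \<open>Support functions of compact sets\<close>

definition support :: "'a::euclidean_space set \<Rightarrow> 'a \<Rightarrow> real" where
  "support A p = (SUP u\<in>A. u \<bullet> p)"

lemma support_attained:
  assumes "A \<in> nonempty_compacts"
  shows "\<exists>u\<in>A. support A p = u \<bullet> p"
proof -
  have "compact A" "A \<noteq> {}" using assms by (auto simp: nonempty_compacts_def)
  moreover have "continuous_on A (\<lambda>u. u \<bullet> p)" by (intro continuous_intros)
  ultimately obtain u where u: "u \<in> A" "\<And>v. v \<in> A \<Longrightarrow> v \<bullet> p \<le> u \<bullet> p"
    using continuous_attains_sup[of A "\<lambda>u. u \<bullet> p"] by blast
  have "support A p = u \<bullet> p"
    unfolding support_def by (rule cSup_eq_maximum) (use u in auto)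
  with u show ?thesis by blast
qed

lemma support_upper:
  assumes "A \<in> nonempty_compacts" "u \<in> A"
  shows "u \<bullet> p \<le> support A p"
proof -
  have "compact ((\<lambda>u. u \<bullet> p) ` A)"
    using assms by (intro compact_continuous_image continuous_intros) (auto simp: nonempty_compacts_def)
  then have "bdd_above ((\<lambda>u. u \<bullet> p) ` A)"
    by (intro bounded_imp_bdd_above compact_imp_bounded)
  then show ?thesis
    unfolding support_def using assms(2) by (intro cSUP_upper)
qed

lemma support_0: "A \<in> nonempty_compacts \<Longrightarrow> support A 0 = 0"
  using support_attained[of A 0] by auto

lemma support_abs_le:
  assumes "A \<in> nonempty_compacts" "\<And>u. u \<in> A \<Longrightarrow> norm u \<le> R"
  shows "\<bar>support A p\<bar> \<le> R * norm p"
proof -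
  obtain u where u: "u \<in> A" "support A p = u \<bullet> p" using support_attained assms(1) by blast
  have "\<bar>u \<bullet> p\<bar> \<le> norm u * norm p" by (rule Cauchy_Schwarz_ineq2)
  also have "\<dots> \<le> R * norm p" using assms(2)[OF u(1)] by (intro mult_right_mono) auto
  finally show ?thesis using u by simp
qed

lemma support_hausdist:
  assumes "A \<in> nonempty_compacts" "B \<in> nonempty_compacts"
  shows "\<bar>support A p - support B p\<bar> \<le> norm p * hausdist A B"
proof -
  have *: "support A p \<le> support B p + norm p * hausdist A B"
    if AB: "A \<in> nonempty_compacts" "B \<in> nonempty_compacts" for A B :: "'a set"
  proof -
    obtain u where u: "u \<in> A" "support A p = u \<bullet> p" using support_attained AB(1) by blast
    obtain v where v: "v \<in> B" "infdist u B = dist u v"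
      using infdist_attains_inf[of B u] AB by (auto simp: nonempty_compacts_def compact_imp_closed)
    have "dist u v \<le> hausdist A B"
      using hausdist_le_iff[OF AB, of "hausdist A B"] u v by auto
    then have "(u - v) \<bullet> p \<le> norm p * hausdist A B"
      using norm_cauchy_schwarz[of "u - v" p] mult_left_mono[of "dist u v" "hausdist A B" "norm p"]
      by (simp add: dist_norm mult.commute)
    moreover have "v \<bullet> p \<le> support B p" using AB v by (intro support_upper)
    ultimately show ?thesis using u by (simp add: inner_diff_left)
  qed
  have "hausdist A B = hausdist B A" by (auto simp: hausdist_def max.commute)
  then show ?thesis using *[of A B] *[of B A] assms by (simp add: abs_le_iff)
qed

lemma measurable_support_hausdorff: "(\<lambda>A. support A p) \<in> borel_measurable hausdorff_borel"
  by (rule borel_measurable_hausdorff[OF support_hausdist])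

text \<open>The support function of a bounded set is Lipschitz in the direction. This will admit
  directions that vary measurably, by approximation with simple functions.\<close>

lemma tendsto_support:
  assumes A: "A \<in> nonempty_compacts" and "p \<longlonglongrightarrow> p0"
  shows "(\<lambda>n. support A (p n)) \<longlonglongrightarrow> support A p0"
proof -
  obtain R where R: "R > 0" "\<And>u. u \<in> A \<Longrightarrow> norm u \<le> R"
  proof -
    have "bounded A" using A by (simp add: nonempty_compacts_def compact_imp_bounded)
    then show thesis using that unfolding bounded_pos by metis
  qed
  have le: "support A x \<le> support A y + R * norm (x - y)" for x y
  proof -
    obtain u where u: "u \<in> A" "support A x = u \<bullet> x" using support_attained A by blast
    have "u \<bullet> (x - y) \<le> norm u * norm (x - y)" by (rule norm_cauchy_schwarz)
    also have "\<dots> \<le> R * norm (x - y)" using R(2)[OF u(1)] by (intro mult_right_mono) auto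
    finally show ?thesis using u support_upper[OF A u(1), of y] by (simp add: inner_diff_right)
  qed
  have "(\<lambda>n. support A (p n) - support A p0) \<longlonglongrightarrow> 0"
  proof (rule Lim_null_comparison)
    show "\<forall>\<^sub>F n in sequentially. norm (support A (p n) - support A p0) \<le> R * norm (p n - p0)"
    proof (intro always_eventually allI)
      fix n
      show "norm (support A (p n) - support A p0) \<le> R * norm (p n - p0)"
        using le[of "p n" p0] le[of p0 "p n"] by (simp add: abs_le_iff norm_minus_commute)
    qed
    have "(\<lambda>n. R * norm (p n - p0)) \<longlonglongrightarrow> R * norm (p0 - p0)"
      by (intro tendsto_intros assms)
    then show "(\<lambda>n. R * norm (p n - p0)) \<longlonglongrightarrow> 0" by simp
  qed
  then show ?thesis by (simp add: LIM_zero_iff)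
qed

text \<open>Taking the least admissible index keeps a choice among countably many values
  measurable.\<close>

lemma measurable_countable_choice:
  fixes q :: "nat \<Rightarrow> 'a::euclidean_space"
  assumes [measurable]: "\<And>i. Measurable.pred P (Q i)" and ex: "\<And>s. s \<in> space P \<Longrightarrow> \<exists>i. Q i s"
  shows "\<exists>u\<in>borel_measurable P. \<forall>s\<in>space P. \<exists>i. u s = q i \<and> Q i s"
proof
  show "(\<lambda>s. q (LEAST i. Q i s)) \<in> borel_measurable P" by measurable
  show "\<forall>s\<in>space P. \<exists>i. q (LEAST i. Q i s) = q i \<and> Q i s"
  proof
    fix s assume "s \<in> space P"
    from LeastI_ex[OF ex[OF this]] show "\<exists>i. q (LEAST i. Q i s) = q i \<and> Q i s" by blast
  qed
qed

lemma dense_sequence: "\<exists>q :: nat \<Rightarrow> 'a::euclidean_space. \<forall>U. open U \<longrightarrow> U \<noteq> {} \<longrightarrow> (\<exists>i. q i \<in> U)"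
proof -
  obtain D :: "'a set" where D: "countable D" "\<And>U. open U \<Longrightarrow> U \<noteq> {} \<Longrightarrow> \<exists>d\<in>D. d \<in> U"
    using countable_dense_exists by blast
  have "D \<noteq> {}" using D(2)[of UNIV] by auto
  then have "range (from_nat_into D) = D" using D(1) by (rule range_from_nat_into)
  then show ?thesis
    using D(2) by (intro exI[of _ "from_nat_into D"]) (metis rangeE)
qed

text \<open>The Kuratowski--Ryll-Nardzewski scheme, started at an arbitrary approximate selection.\<close>

lemma measurable_selection_near:
  fixes F :: "'s \<Rightarrow> 'a::euclidean_space set"
  assumes F: "\<And>s. s \<in> space P \<Longrightarrow> F s \<in> nonempty_compacts"
    and meas [measurable]: "\<And>q. (\<lambda>s. infdist q (F s)) \<in> borel_measurable P"
    and u0: "u0 \<in> borel_measurable P" "\<And>s. s \<in> space P \<Longrightarrow> infdist (u0 s) (F s) < \<epsilon>" and "\<epsilon> > 0"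
  shows "\<exists>u\<in>borel_measurable P. \<forall>s\<in>space P. u s \<in> F s \<and> norm (u s - u0 s) \<le> 2 * \<epsilon>"
proof -
  obtain q :: "nat \<Rightarrow> 'a" where q: "\<And>U. open U \<Longrightarrow> U \<noteq> {} \<Longrightarrow> \<exists>i. q i \<in> U"
    using dense_sequence by blast
  define good where "good n u \<longleftrightarrow> u \<in> borel_measurable P \<and> (\<forall>s\<in>space P. infdist (u s) (F s) < \<epsilon> / 2 ^ n)"
    for n :: nat and u :: "'s \<Rightarrow> 'a"
  have "\<exists>U. \<forall>n. (good n (U n) \<and> (n = 0 \<longrightarrow> U n = u0)) \<and> (\<forall>s\<in>space P. dist (U (Suc n) s) (U n s) < \<epsilon> / 2 ^ n)"
  proof (rule dependent_nat_choice)
    show "\<exists>u. good 0 u \<and> ((0::nat) = 0 \<longrightarrow> u = u0)"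
      using u0 by (auto simp: good_def)
  next
    fix u and n :: nat
    assume "good n u \<and> (n = 0 \<longrightarrow> u = u0)"
    then have u [measurable]: "u \<in> borel_measurable P" and near: "\<And>s. s \<in> space P \<Longrightarrow> infdist (u s) (F s) < \<epsilon> / 2 ^ n"
      by (auto simp: good_def)
    define Q where "Q i s \<longleftrightarrow> infdist (q i) (F s) < \<epsilon> / 2 ^ Suc n \<and> dist (q i) (u s) < \<epsilon> / 2 ^ n" for i s
    have "\<exists>u'\<in>borel_measurable P. \<forall>s\<in>space P. \<exists>i. u' s = q i \<and> Q i s"
    proof (rule measurable_countable_choice)
      show "Measurable.pred P (Q i)" for i unfolding Q_def by measurable
      fix s assume s: "s \<in> space P"
      have Fs: "closed (F s)" "F s \<noteq> {}" using F[OF s] by (auto simp: nonempty_compacts_def compact_imp_closed)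
      obtain y where y: "y \<in> F s" "infdist (u s) (F s) = dist (u s) y"
        using infdist_attains_inf[OF Fs, of "u s"] by metis
      \<comment> \<open>A point this close to \<open>y\<close> meets both requirements of
        \<open>Q\<close>. The radius is positive because the invariant bounds
        \<open>infdist (u s) (F s)\<close> strictly.\<close>
      define \<delta> where "\<delta> = min (\<epsilon> / 2 ^ Suc n) (\<epsilon> / 2 ^ n - dist (u s) y)"
      have "\<delta> > 0" using near[OF s] y \<open>\<epsilon> > 0\<close> by (simp add: \<delta>_def)
      then obtain i where i: "q i \<in> ball y \<delta>" using q[of "ball y \<delta>"] by auto
      have "infdist (q i) (F s) \<le> dist (q i) y" using y by (intro infdist_le) 
      moreover have "dist (q i) (u s) \<le> dist (q i) y + dist (u s) y" by (rule dist_triangle2)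
      ultimately have "Q i s" using i by (simp add: Q_def \<delta>_def dist_commute)
      then show "\<exists>i. Q i s" ..
    qed
    then obtain u' where u': "u' \<in> borel_measurable P" "\<And>s. s \<in> space P \<Longrightarrow> \<exists>i. u' s = q i \<and> Q i s" by blast
    have "good (Suc n) u'" unfolding good_def using u' by (force simp: Q_def)
    moreover have "\<forall>s\<in>space P. dist (u' s) (u s) < \<epsilon> / 2 ^ n" using u'(2) by (force simp: Q_def)
    ultimately show "\<exists>u'. (good (Suc n) u' \<and> (Suc n = 0 \<longrightarrow> u' = u0)) \<and> (\<forall>s\<in>space P. dist (u' s) (u s) < \<epsilon> / 2 ^ n)"
      by blast
  qed
  then obtain U where U: "\<And>n. good n (U n)" "U 0 = u0" "\<And>n s. s \<in> space P \<Longrightarrow> dist (U (Suc n) s) (U n s) < \<epsilon> / 2 ^ n"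
    by metis
  have geo: "(\<lambda>n. \<epsilon> / 2 ^ n) sums (2 * \<epsilon>)"
    using sums_mult[OF geometric_sums[of "1 / 2 :: real"], of \<epsilon>] by (simp add: power_divide mult.commute)
  define u where "u s = u0 s + (\<Sum>n. U (Suc n) s - U n s)" for s
  have sm: "summable (\<lambda>n. norm (U (Suc n) s - U n s))" if "s \<in> space P" for s
    by (rule summable_comparison_test'[OF sums_summable[OF geo]])
      (use U(3)[OF that] in \<open>simp add: dist_norm less_imp_le\<close>)
  have lim: "(\<lambda>n. U n s) \<longlonglongrightarrow> u s" if "s \<in> space P" for s
  proof -
    have "(\<lambda>n. \<Sum>k<n. U (Suc k) s - U k s) \<longlonglongrightarrow> (\<Sum>n. U (Suc n) s - U n s)"
      using summable_LIMSEQ[OF summable_norm_cancel[OF sm[OF that]]] .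
    then have "(\<lambda>n. U n s - U 0 s) \<longlonglongrightarrow> (\<Sum>n. U (Suc n) s - U n s)"
      by (simp only: sum_lessThan_telescope[of "\<lambda>k. U k s"])
    from tendsto_add[OF tendsto_const this, of "u0 s"] show ?thesis by (simp add: U(2) u_def)
  qed
  show ?thesis
  proof (intro bexI ballI conjI)
    show "u \<in> borel_measurable P"
      by (rule borel_measurable_LIMSEQ_metric[OF _ lim]) (use U(1) in \<open>auto simp: good_def\<close>)
    fix s assume s: "s \<in> space P"
    have Fs: "closed (F s)" "F s \<noteq> {}" using F[OF s] by (auto simp: nonempty_compacts_def compact_imp_closed)
    have "(\<lambda>n. infdist (U n s) (F s)) \<longlonglongrightarrow> infdist (u s) (F s)"
      by (intro tendsto_intros lim s)
    moreover have "(\<lambda>n. infdist (U n s) (F s)) \<longlonglongrightarrow> 0"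
    proof (rule Lim_null_comparison[OF _ summable_LIMSEQ_zero[OF sums_summable[OF geo]]])
      show "\<forall>\<^sub>F n in sequentially. norm (infdist (U n s) (F s)) \<le> \<epsilon> / 2 ^ n"
        using U(1) s by (auto simp: good_def infdist_nonneg intro!: always_eventually less_imp_le)
    qed
    ultimately have "infdist (u s) (F s) = 0" by (rule LIMSEQ_unique)
    then show "u s \<in> F s" using in_closed_iff_infdist_zero[OF Fs] by simp
    have "norm (u s - u0 s) = norm (\<Sum>n. U (Suc n) s - U n s)" by (simp add: u_def)
    also have "\<dots> \<le> (\<Sum>n. norm (U (Suc n) s - U n s))" by (rule summable_norm[OF sm[OF s]])
    also have "\<dots> \<le> (\<Sum>n. \<epsilon> / 2 ^ n)"
      by (rule suminf_le[OF _ sm[OF s] sums_summable[OF geo]]) (use U(3)[OF s] in \<open>simp add: dist_norm less_imp_le\<close>)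
    also have "\<dots> = 2 * \<epsilon>" using geo by (rule sums_unique[symmetric])
    finally show "norm (u s - u0 s) \<le> 2 * \<epsilon>" .
  qed
qed

section \<open>The Aumann integral\<close>

text \<open>Convexity and the bound hold only almost everywhere, whereas a selection in the Aumann
  integral must lie in \<open>F s\<close> for every \<open>s\<close>; constructions are therefore
  repaired on null sets.\<close>

locale bounded_multifunction = prob_space P for P :: "'s measure" +
  fixes F :: "'s \<Rightarrow> 'a::euclidean_space set" and k :: "'s \<Rightarrow> real"
  assumes F: "\<And>s. s \<in> space P \<Longrightarrow> F s \<in> nonempty_compacts"
    and infdist_measurable [measurable]: "\<And>q. (\<lambda>s. infdist q (F s)) \<in> borel_measurable P"
    and support_measurable [measurable]: "\<And>p. (\<lambda>s. support (F s) p) \<in> borel_measurable P"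
    and F_convex: "AE s in P. convex (F s)"
    and F_bounded: "AE s in P. \<forall>u\<in>F s. norm u \<le> k s"
    and k_measurable [measurable]: "k \<in> borel_measurable P"
    and k_square_integrable: "integrable P (\<lambda>s. (k s)\<^sup>2)"
begin

definition selections :: "('s \<Rightarrow> 'a) set" where
  "selections = {u \<in> borel_measurable P. \<forall>s\<in>space P. u s \<in> F s}"

lemma k_integrable: "integrable P k"
proof (rule Bochner_Integration.integrable_bound)
  show "integrable P (\<lambda>s. 1 + (k s)\<^sup>2)" using k_square_integrable by auto
  show "AE s in P. norm (k s) \<le> norm (1 + (k s)\<^sup>2)"
  proof (intro AE_I2)
    fix s
    have "0 \<le> (\<bar>k s\<bar> - 1)\<^sup>2" by simp
    then have "2 * \<bar>k s\<bar> \<le> 1 + (k s)\<^sup>2" by (simp add: power2_diff)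
    then show "norm (k s) \<le> norm (1 + (k s)\<^sup>2)" by simp
  qed
qed simp

lemma selection_measurable: "u \<in> selections \<Longrightarrow> u \<in> borel_measurable P"
  by (simp add: selections_def)

lemma selection_bounded: "u \<in> selections \<Longrightarrow> AE s in P. norm (u s) \<le> k s"
  using F_bounded AE_space by eventually_elim (auto simp: selections_def)

lemma selection_integrable:
  assumes "u \<in> selections"
  shows "integrable P u" "integrable P (\<lambda>s. (norm (u s))\<^sup>2)"
proof -
  have [measurable]: "u \<in> borel_measurable P" using assms by (rule selection_measurable)
  show "integrable P u"
    by (rule Bochner_Integration.integrable_bound[OF k_integrable])
      (use selection_bounded[OF assms] in \<open>auto elim: eventually_mono\<close>)
  show "integrable P (\<lambda>s. (norm (u s))\<^sup>2)"
  proof (rule Bochner_Integration.integrable_bound[OF k_square_integrable])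
    show "AE s in P. norm ((norm (u s))\<^sup>2) \<le> norm ((k s)\<^sup>2)"
      using selection_bounded[OF assms] by eventually_elim (auto intro: power_mono)
  qed measurable
qed

text \<open>On a null set containing all points where convexity fails the mixture is replaced by
  \<open>u\<close>, so that the result is a selection everywhere.\<close>

lemma selection_mix:
  assumes u: "u \<in> selections" and v: "v \<in> selections" and "0 \<le> t" "t \<le> 1"
  shows "\<exists>m\<in>selections. AE s in P. m s = (1 - t) *\<^sub>R u s + t *\<^sub>R v s"
proof -
  obtain N where N: "{s \<in> space P. \<not> convex (F s)} \<subseteq> N" "emeasure P N = 0" "N \<in> sets P"
    using AE_E[OF F_convex] by blast
  have [measurable]: "u \<in> borel_measurable P" "v \<in> borel_measurable P" "N \<in> sets P"
    using u v N by (auto simp: selections_def)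
  define m where "m s = (if s \<in> N then u s else (1 - t) *\<^sub>R u s + t *\<^sub>R v s)" for s
  have "m s \<in> F s" if s: "s \<in> space P" for s
  proof (cases "s \<in> N")
    case True
    then show ?thesis using u s by (simp add: m_def selections_def)
  next
    case False
    then have "convex (F s)" using N s by blast
    then have "(1 - t) *\<^sub>R u s + t *\<^sub>R v s \<in> F s"
      using u v s assms(3,4) unfolding convex_alt by (auto simp: selections_def)
    then show ?thesis using False by (simp add: m_def)
  qed
  moreover have "m \<in> borel_measurable P" unfolding m_def by measurable
  moreover have "AE s in P. s \<notin> N" using N by (intro AE_not_in) (auto simp: null_sets_def)
  then have "AE s in P. m s = (1 - t) *\<^sub>R u s + t *\<^sub>R v s"
    by eventually_elim (simp add: m_def)
  ultimately show ?thesis by (intro bexI[of _ m]) (auto simp: selections_def)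
qed

lemma selection_mix_integral:
  assumes u: "u \<in> selections" and v: "v \<in> selections" and "AE s in P. m s = (1 - t) *\<^sub>R u s + t *\<^sub>R v s"
    and m: "m \<in> selections"
  shows "(\<integral>s. m s \<partial>P) = (1 - t) *\<^sub>R (\<integral>s. u s \<partial>P) + t *\<^sub>R (\<integral>s. v s \<partial>P)"
proof -
  have [measurable]: "u \<in> borel_measurable P" "v \<in> borel_measurable P" "m \<in> borel_measurable P"
    using u v m by (auto simp: selections_def)
  have "(\<integral>s. m s \<partial>P) = (\<integral>s. (1 - t) *\<^sub>R u s + t *\<^sub>R v s \<partial>P)"
    by (rule integral_cong_AE) (use assms in auto)
  then show ?thesis
    using selection_integrable(1)[OF u] selection_integrable(1)[OF v] by simp
qed

text \<open>A measurable function with values in a dense sequence comes within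
  \<open>\<epsilon>\<close> of the maximum and of \<open>F s\<close>; moving it into
  \<open>F s\<close> costs at most \<open>2 * \<epsilon> * norm p\<close> more.\<close>

lemma selection_near_support:
  assumes "\<epsilon> > 0"
  shows "\<exists>u\<in>selections. \<forall>s\<in>space P. support (F s) p - \<epsilon> * (1 + 2 * norm p) \<le> u s \<bullet> p"
proof -
  obtain q :: "nat \<Rightarrow> 'a" where q: "\<And>U. open U \<Longrightarrow> U \<noteq> {} \<Longrightarrow> \<exists>i. q i \<in> U"
    using dense_sequence by blast
  define Q where "Q i s \<longleftrightarrow> infdist (q i) (F s) < \<epsilon> \<and> support (F s) p - \<epsilon> < q i \<bullet> p" for i s
  have "\<exists>u\<in>borel_measurable P. \<forall>s\<in>space P. \<exists>i. u s = q i \<and> Q i s"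
  proof (rule measurable_countable_choice)
    show "Measurable.pred P (Q i)" for i unfolding Q_def by measurable
    fix s assume s: "s \<in> space P"
    obtain y where y: "y \<in> F s" "support (F s) p = y \<bullet> p" using support_attained[OF F[OF s]] by blast
    have "open ({x. support (F s) p - \<epsilon> < x \<bullet> p} \<inter> ball y \<epsilon>)"
      by (intro open_Int open_Collect_less continuous_intros) auto
    moreover have "y \<in> {x. support (F s) p - \<epsilon> < x \<bullet> p} \<inter> ball y \<epsilon>" using y assms by simp
    ultimately obtain i where i: "q i \<in> {x. support (F s) p - \<epsilon> < x \<bullet> p} \<inter> ball y \<epsilon>" using q by blast
    have "infdist (q i) (F s) \<le> dist (q i) y" using y(1) by (rule infdist_le)
    then have "Q i s" using i by (simp add: Q_def dist_commute)
    then show "\<exists>i. Q i s" ..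
  qed
  then obtain u0 where u0: "u0 \<in> borel_measurable P" "\<And>s. s \<in> space P \<Longrightarrow> \<exists>i. u0 s = q i \<and> Q i s" by blast
  have near: "infdist (u0 s) (F s) < \<epsilon>" "support (F s) p - \<epsilon> < u0 s \<bullet> p" if "s \<in> space P" for s
    using u0(2)[OF that] by (auto simp: Q_def)
  obtain u where u: "u \<in> borel_measurable P" "\<And>s. s \<in> space P \<Longrightarrow> u s \<in> F s \<and> norm (u s - u0 s) \<le> 2 * \<epsilon>"
    using measurable_selection_near[OF F infdist_measurable u0(1) near(1) assms] by blast
  have "support (F s) p - \<epsilon> * (1 + 2 * norm p) \<le> u s \<bullet> p" if s: "s \<in> space P" for s
  proof -
    have "(u0 s - u s) \<bullet> p \<le> norm (u0 s - u s) * norm p" by (rule norm_cauchy_schwarz)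
    also have "\<dots> \<le> 2 * \<epsilon> * norm p"
      using u(2)[OF s] by (intro mult_right_mono) (auto simp: norm_minus_commute)
    finally show ?thesis using near(2)[OF s] by (simp add: inner_diff_left algebra_simps)
  qed
  then show ?thesis using u by (intro bexI[of _ u]) (auto simp: selections_def)
qed

text \<open>Otherwise a hyperplane with normal \<open>a\<close> and margin \<open>b\<close>
  separates 0 from the convex set of integrals. A selection nearly maximal in direction
  \<open>- a\<close> then forces the integrated support function to be negative in that
  direction.\<close>

lemma zero_in_closure:
  assumes "\<And>p. 0 \<le> (\<integral>s. support (F s) p \<partial>P)"
  shows "0 \<in> closure ((\<lambda>u. \<integral>s. u s \<partial>P) ` selections)" (is "0 \<in> closure ?I")
proof (rule ccontr)
  assume notin: "0 \<notin> closure ?I"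
  have "convex ?I"
    unfolding convex_alt
  proof (intro ballI allI impI)
    fix x y and t :: real assume x: "x \<in> ?I" and y: "y \<in> ?I" and t: "0 \<le> t \<and> t \<le> 1"
    from x obtain u where u: "u \<in> selections" "x = (\<integral>s. u s \<partial>P)" by blast
    from y obtain v where v: "v \<in> selections" "y = (\<integral>s. v s \<partial>P)" by blast
    from t have t: "0 \<le> t" "t \<le> 1" by auto
    obtain m where m: "m \<in> selections" "AE s in P. m s = (1 - t) *\<^sub>R u s + t *\<^sub>R v s"
      using selection_mix[OF u(1) v(1) t] by blast
    have "(\<integral>s. m s \<partial>P) = (1 - t) *\<^sub>R x + t *\<^sub>R y"
      unfolding u v by (rule selection_mix_integral[OF u(1) v(1) m(2,1)])
    then show "(1 - t) *\<^sub>R x + t *\<^sub>R y \<in> ?I" using m(1) by (metis imageI)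
  qed
  then obtain a b where ab: "a \<noteq> 0" "0 < b" "\<And>x. x \<in> closure ?I \<Longrightarrow> b < a \<bullet> x"
    using separating_hyperplane_closed_0[OF convex_closure closed_closure notin] by blast
  \<comment> \<open>Makes the loss in \<open>selection_near_support\<close>, for the direction
    \<open>- a\<close>, equal to the margin \<open>b\<close>.\<close>
  define \<epsilon> where "\<epsilon> = b / (1 + 2 * norm (- a))"
  have "\<epsilon> > 0" using ab(2) by (simp add: \<epsilon>_def add_pos_nonneg)
  obtain u where u: "u \<in> selections" "\<And>s. s \<in> space P \<Longrightarrow> support (F s) (- a) - \<epsilon> * (1 + 2 * norm (- a)) \<le> u s \<bullet> (- a)"
    using selection_near_support[OF \<open>\<epsilon> > 0\<close>, of "- a"] by blast
  have eb: "\<epsilon> * (1 + 2 * norm (- a)) = b"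
    unfolding \<epsilon>_def by (rule nonzero_eq_divide_eq[THEN iffD1, OF _ refl]) (metis add_pos_nonneg less_irrefl mult_nonneg_nonneg norm_ge_zero zero_le_numeral zero_less_one)
  have [measurable]: "u \<in> borel_measurable P" using u(1) by (rule selection_measurable)
  have int: "integrable P u" using u(1) by (rule selection_integrable)
  have sint: "integrable P (\<lambda>s. support (F s) (- a))"
  proof (rule Bochner_Integration.integrable_bound)
    show "integrable P (\<lambda>s. k s * norm (- a))" using k_integrable by simp
    show "AE s in P. norm (support (F s) (- a)) \<le> norm (k s * norm (- a))"
      using F_bounded AE_space
    proof eventually_elim
      case (elim s)
      have "\<bar>support (F s) (- a)\<bar> \<le> k s * norm (- a)"
        using elim(1) by (intro support_abs_le[OF F[OF elim(2)]]) auto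
      then show ?case by (simp add: abs_mult) (meson abs_ge_self mult_right_mono norm_ge_zero order_trans)
    qed
  qed measurable
  have "0 - b \<le> (\<integral>s. support (F s) (- a) \<partial>P) - b" using assms[of "- a"] by simp
  also have "\<dots> = (\<integral>s. support (F s) (- a) - b \<partial>P)" using sint by (simp add: prob_space)
  also have "\<dots> \<le> (\<integral>s. u s \<bullet> (- a) \<partial>P)"
    by (rule integral_mono) (use sint int u(2) eb in auto)
  also have "\<dots> = - (a \<bullet> (\<integral>s. u s \<partial>P))"
    using int by (simp add: inner_commute)
  also have "\<dots> < - b"
  proof -
    have "(\<integral>s. u s \<partial>P) \<in> closure ?I" using u(1) by (intro subsetD[OF closure_subset] imageI)
    then show ?thesis using ab(3) by simp
  qed
  finally show False by simp
qed

text \<open>The image of the selections under integration is closed at \<open>0\<close>: almost minimizers of the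
  \<open>L\<^sup>2\<close> norm among the selections with small integral form a Cauchy sequence, by the
  parallelogram law.\<close>

lemma minimizing_cauchy:
  fixes u :: "nat \<Rightarrow> 's \<Rightarrow> 'a"
  assumes u: "\<And>n. u n \<in> selections" "\<And>n. norm (\<integral>s. u n s \<partial>P) \<le> 1 / real (Suc n)"
    and \<mu>: "\<And>n x. x \<in> selections \<Longrightarrow> norm (\<integral>s. x s \<partial>P) \<le> 1 / real (Suc n) \<Longrightarrow> \<mu> n \<le> (\<integral>s. (norm (x s))\<^sup>2 \<partial>P)"
    and u_min: "\<And>n. (\<integral>s. (norm (u n s))\<^sup>2 \<partial>P) \<le> \<mu> n + 1 / real (Suc n)"
    and lim: "\<mu> \<longlonglongrightarrow> l" and mono: "\<And>n. \<mu> n \<le> l" and "e > 0"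
  shows "\<exists>N. \<forall>i\<ge>N. \<forall>j\<ge>N. (\<integral>s. norm (u i s - u j s) \<partial>P) < e"
proof -
  \<comment> \<open>This quantity will bound the squared \<open>L2\<close> distance of
    \<open>u i\<close> and \<open>u j\<close> for indices beyond \<open>n\<close>: their squared
    norms are at most \<open>l + 1 / real (Suc n)\<close>, that of the midpoint is at least
    \<open>\<mu> n\<close>.\<close>
  have "(\<lambda>n. 4 * (l - \<mu> n + 1 / real (Suc n))) \<longlonglongrightarrow> 4 * (l - l + 0)"
    by (intro tendsto_intros lim lim_const_over_n[THEN LIMSEQ_Suc])
  then have "\<forall>\<^sub>F n in sequentially. 4 * (l - \<mu> n + 1 / real (Suc n)) < (e / 2)\<^sup>2"
    using \<open>e > 0\<close> by (intro order_tendstoD) auto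
  then obtain N where N: "4 * (l - \<mu> N + 1 / real (Suc N)) < (e / 2)\<^sup>2"
    by (auto simp: eventually_sequentially)
  have "(\<integral>s. norm (u i s - u j s) \<partial>P) < e" if ij: "i \<ge> N" "j \<ge> N" for i j
  proof -
    have [measurable]: "u n \<in> borel_measurable P" for n using u(1) by (rule selection_measurable)
    have le_N: "1 / real (Suc n) \<le> 1 / real (Suc N)" if "n \<ge> N" for n
      using that by (intro divide_left_mono) auto
    \<comment> \<open>The midpoint is again a selection, and its integral has norm at most
      \<open>1 / real (Suc N)\<close>, so \<open>\<mu> N\<close> bounds its squared norm from below.
      This is where convex values are essential.\<close>
    obtain m where m: "m \<in> selections" "AE s in P. m s = (1 - 1/2) *\<^sub>R u i s + (1/2) *\<^sub>R u j s"
      using selection_mix[OF u(1)[of i] u(1)[of j], of "1/2"] by auto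
    have [measurable]: "m \<in> borel_measurable P" using m(1) by (rule selection_measurable)
    have "norm (\<integral>s. m s \<partial>P) \<le> 1 / 2 * norm (\<integral>s. u i s \<partial>P) + 1 / 2 * norm (\<integral>s. u j s \<partial>P)"
      unfolding selection_mix_integral[OF u(1) u(1) m(2,1)] by (rule order_trans[OF norm_triangle_ineq]) simp
    also have "\<dots> \<le> 1 / real (Suc N)"
      using u(2)[of i] u(2)[of j] le_N[OF ij(1)] le_N[OF ij(2)] by linarith
    finally have "\<mu> N \<le> (\<integral>s. (norm (m s))\<^sup>2 \<partial>P)" by (rule \<mu>[OF m(1)])
    also have "\<dots> = (\<integral>s. (norm ((1/2) *\<^sub>R (u i s + u j s)))\<^sup>2 \<partial>P)"
    proof (rule integral_cong_AE)
      show "AE s in P. (norm (m s))\<^sup>2 = (norm ((1/2) *\<^sub>R (u i s + u j s)))\<^sup>2"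
        using m(2) by eventually_elim (simp add: scaleR_add_right)
    qed measurable
    finally have mid: "\<mu> N \<le> (\<integral>s. (norm ((1/2) *\<^sub>R (u i s + u j s)))\<^sup>2 \<partial>P)" .
    have par: "(norm (x - y))\<^sup>2 = 2 * (norm x)\<^sup>2 + 2 * (norm y)\<^sup>2 - 4 * (norm ((1/2) *\<^sub>R (x + y)))\<^sup>2" for x y :: 'a
    proof -
      have "4 * (norm ((1/2) *\<^sub>R (x + y)))\<^sup>2 = (norm (x + y))\<^sup>2" by (simp add: power_divide)
      moreover have "(norm (x - y))\<^sup>2 + (norm (x + y))\<^sup>2 = 2 * (norm x)\<^sup>2 + 2 * (norm y)\<^sup>2"
        unfolding power2_norm_eq_inner by (simp add: inner_add_left inner_add_right inner_diff_left inner_diff_right)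
      ultimately show ?thesis by linarith
    qed
    have int_mid: "integrable P (\<lambda>s. (norm ((1/2) *\<^sub>R (u i s + u j s)))\<^sup>2)"
    proof (rule Bochner_Integration.integrable_bound)
      show "integrable P (\<lambda>s. 2 * (norm (u i s))\<^sup>2 + 2 * (norm (u j s))\<^sup>2)"
        using selection_integrable(2)[OF u(1)] by auto
      show "AE s in P. norm ((norm ((1/2) *\<^sub>R (u i s + u j s)))\<^sup>2) \<le> norm (2 * (norm (u i s))\<^sup>2 + 2 * (norm (u j s))\<^sup>2)"
      proof (intro AE_I2)
        fix s
        have "(norm ((1/2) *\<^sub>R (u i s + u j s)))\<^sup>2 \<le> 2 * (norm (u i s))\<^sup>2 + 2 * (norm (u j s))\<^sup>2"
          using par[of "u i s" "u j s"] zero_le_power2[of "norm (u i s - u j s)"]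
            zero_le_power2[of "norm ((1/2) *\<^sub>R (u i s + u j s))"] by linarith
        then show "norm ((norm ((1/2) *\<^sub>R (u i s + u j s)))\<^sup>2) \<le> norm (2 * (norm (u i s))\<^sup>2 + 2 * (norm (u j s))\<^sup>2)"
          by simp
      qed
    qed measurable
    have "integrable P (\<lambda>s. (norm (u i s - u j s))\<^sup>2)"
      unfolding par using int_mid selection_integrable(2)[OF u(1)] by auto
    note int = this
    have "(\<integral>s. (norm (u i s - u j s))\<^sup>2 \<partial>P) = 2 * (\<integral>s. (norm (u i s))\<^sup>2 \<partial>P) + 2 * (\<integral>s. (norm (u j s))\<^sup>2 \<partial>P)
        - 4 * (\<integral>s. (norm ((1/2) *\<^sub>R (u i s + u j s)))\<^sup>2 \<partial>P)"
      unfolding par using int_mid selection_integrable(2)[OF u(1)]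
      by (subst Bochner_Integration.integral_diff) auto
    also have "\<dots> \<le> 4 * (l - \<mu> N + 1 / real (Suc N))"
    proof -
      have "2 * x + 2 * y - 4 * z \<le> 4 * (l - c + d)"
        if "c \<le> z" "x \<le> a + a'" "y \<le> b + b'" "a \<le> l" "b \<le> l" "a' \<le> d" "b' \<le> d" for x y z a b c d a' b' :: real
        using that by argo
      from this[OF mid u_min u_min mono mono le_N[OF ij(1)] le_N[OF ij(2)]] show ?thesis .
    qed
    also note N
    finally have sq: "(\<integral>s. (norm (u i s - u j s))\<^sup>2 \<partial>P) < (e / 2)\<^sup>2" .
    \<comment> \<open>A weighted arithmetic-geometric mean inequality, which turns the
      \<open>L2\<close> bound into an \<open>L1\<close> bound.\<close>
    have "norm (u i s - u j s) \<le> e / 2 + (norm (u i s - u j s))\<^sup>2 / e" for s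
    proof -
      have "0 \<le> (norm (u i s - u j s) - e / 2)\<^sup>2" by simp
      also have "\<dots> = (norm (u i s - u j s))\<^sup>2 - e * norm (u i s - u j s) + (e / 2)\<^sup>2"
        by (simp add: power2_eq_square algebra_simps)
      finally have "e * norm (u i s - u j s) \<le> e * (e / 4) + (norm (u i s - u j s))\<^sup>2"
        by (simp add: power2_eq_square)
      then have "norm (u i s - u j s) \<le> (e * (e / 4) + (norm (u i s - u j s))\<^sup>2) / e"
        using \<open>e > 0\<close> by (simp add: pos_le_divide_eq mult.commute)
      also have "\<dots> = e / 4 + (norm (u i s - u j s))\<^sup>2 / e"
        using \<open>e > 0\<close> by (simp add: add_divide_distrib)
      finally show ?thesis using \<open>e > 0\<close> by simp
    qed
    then have "(\<integral>s. norm (u i s - u j s) \<partial>P) \<le> (\<integral>s. e / 2 + (norm (u i s - u j s))\<^sup>2 / e \<partial>P)"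
      using int selection_integrable(1)[OF u(1)] by (intro integral_mono) auto
    also have "\<dots> = e / 2 + (\<integral>s. (norm (u i s - u j s))\<^sup>2 \<partial>P) / e"
      using int by (simp add: prob_space)
    also have "\<dots> < e / 2 + (e / 2)\<^sup>2 / e"
      using sq \<open>e > 0\<close> by (simp add: divide_strict_right_mono)
    also have "\<dots> \<le> e" using \<open>e > 0\<close> by (simp add: power2_eq_square)
    finally show ?thesis .
  qed
  then show ?thesis by blast
qed

text \<open>The infima \<open>\<mu> n\<close> increase and stay below the integral of
  \<open>k^2\<close>, hence converge. A subsequence of almost minimizers then converges almost
  everywhere; closed values keep the limit a selection, and the dominating function \<open>k\<close>
  carries the limit through the integral.\<close>

lemma zero_in_aumann_integral:
  assumes pos: "\<And>p. 0 \<le> (\<integral>s. support (F s) p \<partial>P)"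
  shows "0 \<in> aumann_integral P F"
proof -
  define small where "small n = {x \<in> selections. norm (\<integral>s. x s \<partial>P) \<le> 1 / real (Suc n)}" for n
  define \<mu> where "\<mu> n = Inf ((\<lambda>x. \<integral>s. (norm (x s))\<^sup>2 \<partial>P) ` small n)" for n
  have small_ne: "small n \<noteq> {}" for n
  proof -
    have "1 / real (Suc n) > 0" by simp
    then obtain x where "x \<in> selections" "dist (\<integral>s. x s \<partial>P) 0 < 1 / real (Suc n)"
      using zero_in_closure[OF pos] unfolding closure_approachable by blast
    then have "x \<in> small n" by (simp add: small_def)
    then show ?thesis by blast
  qed
  have small_mono: "small (Suc n) \<subseteq> small n" for n
    by (auto simp: small_def intro: order_trans[OF _ divide_left_mono])
  have bdd: "bdd_below ((\<lambda>x. \<integral>s. (norm (x s))\<^sup>2 \<partial>P) ` A)" for A :: "('s \<Rightarrow> 'a) set"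
    by (rule bdd_belowI[of _ 0]) auto
  have \<mu>_le: "\<mu> n \<le> (\<integral>s. (norm (x s))\<^sup>2 \<partial>P)" if "x \<in> selections" "norm (\<integral>s. x s \<partial>P) \<le> 1 / real (Suc n)" for n x
    unfolding \<mu>_def using that by (intro cInf_lower bdd) (auto simp: small_def)
  have "incseq \<mu>"
    unfolding incseq_Suc_iff \<mu>_def
    by (intro allI cInf_superset_mono bdd image_mono small_mono) (use small_ne in auto)
  have "\<mu> n \<le> (\<integral>s. (k s)\<^sup>2 \<partial>P)" for n
  proof -
    obtain x where x: "x \<in> small n" using small_ne by blast
    then have sel: "x \<in> selections" by (simp add: small_def)
    have "\<mu> n \<le> (\<integral>s. (norm (x s))\<^sup>2 \<partial>P)" using x by (intro \<mu>_le) (auto simp: small_def)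
    also have "\<dots> \<le> (\<integral>s. (k s)\<^sup>2 \<partial>P)"
    proof (rule integral_mono_AE[OF selection_integrable(2)[OF sel] k_square_integrable])
      show "AE s in P. (norm (x s))\<^sup>2 \<le> (k s)\<^sup>2"
        using selection_bounded[OF sel] by eventually_elim (auto intro: power_mono)
    qed
    finally show ?thesis .
  qed
  then obtain l where l: "\<mu> \<longlonglongrightarrow> l" "\<And>n. \<mu> n \<le> l"
    using incseq_convergent[OF \<open>incseq \<mu>\<close>] by blast
  have "\<exists>x\<in>small n. (\<integral>s. (norm (x s))\<^sup>2 \<partial>P) \<le> \<mu> n + 1 / real (Suc n)" for n
  proof -
    have "\<mu> n < \<mu> n + 1 / real (Suc n)" by simp
    then show ?thesis
      using small_ne[of n] unfolding \<mu>_def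
      by (subst (asm) cInf_less_iff) (auto intro: bdd less_imp_le)
  qed
  then obtain u where "\<And>n. u n \<in> small n" and u_min: "\<And>n. (\<integral>s. (norm (u n s))\<^sup>2 \<partial>P) \<le> \<mu> n + 1 / real (Suc n)"
    by metis
  then have u: "u n \<in> selections" "norm (\<integral>s. u n s \<partial>P) \<le> 1 / real (Suc n)" for n
    by (auto simp: small_def)
  have [measurable]: "u n \<in> borel_measurable P" for n using u(1) by (rule selection_measurable)
  obtain r where r: "strict_mono r" "AE s in P. Cauchy (\<lambda>i. u (r i) s)"
    by (rule cauchy_L1_AE_cauchy_subseq[of P u])
      (use selection_integrable(1)[OF u(1)] minimizing_cauchy[OF u \<mu>_le u_min l] in auto)
  obtain N where N: "{s \<in> space P. \<not> Cauchy (\<lambda>i. u (r i) s)} \<subseteq> N" "emeasure P N = 0" "N \<in> sets P"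
    using AE_E[OF r(2)] by blast
  \<comment> \<open>On a null set covering the points without convergence the constant sequence
    \<open>u 0 s\<close> is used, so the limit lies in \<open>F s\<close> everywhere.\<close>
  define x where "x i s = (if s \<in> N then u 0 s else u (r i) s)" for i s
  have x_meas [measurable]: "x i \<in> borel_measurable P" for i
    unfolding x_def using N(3) by measurable
  have "\<exists>y. (\<lambda>i. x i s) \<longlonglongrightarrow> y" if "s \<in> space P" for s
  proof (cases "s \<in> N")
    case False
    then have "convergent (\<lambda>i. u (r i) s)" using N(1) that by (intro Cauchy_convergent) blast
    then show ?thesis using False by (simp add: x_def convergent_def)
  qed (auto simp: x_def)
  then obtain y where y: "\<And>s. s \<in> space P \<Longrightarrow> (\<lambda>i. x i s) \<longlonglongrightarrow> y s" by metis
  have [measurable]: "y \<in> borel_measurable P"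
    by (rule borel_measurable_LIMSEQ_metric[OF x_meas y])
  have sel: "y \<in> selections"
  proof -
    have "y s \<in> F s" if s: "s \<in> space P" for s
    proof (rule closed_sequentially[of "F s" "\<lambda>i. x i s"])
      show "closed (F s)" using F[OF s] by (simp add: nonempty_compacts_def compact_imp_closed)
      show "x i s \<in> F s" for i using u(1) s by (auto simp: x_def selections_def)
    qed (rule y[OF s])
    then show ?thesis by (simp add: selections_def)
  qed
  have "AE s in P. s \<notin> N" using N by (intro AE_not_in) (auto simp: null_sets_def)
  have "(\<lambda>i. \<integral>s. u (r i) s \<partial>P) \<longlonglongrightarrow> (\<integral>s. y s \<partial>P)"
  proof (rule integral_dominated_convergence[where w = k])
    show "AE s in P. (\<lambda>i. u (r i) s) \<longlonglongrightarrow> y s"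
      using \<open>AE s in P. s \<notin> N\<close> AE_space
    proof eventually_elim
      case (elim s)
      then show ?case using y[of s] by (simp add: x_def)
    qed
    show "AE s in P. norm (u (r i) s) \<le> k s" for i by (rule selection_bounded[OF u(1)])
  qed (auto intro: k_integrable)
  moreover have "(\<lambda>i. \<integral>s. u (r i) s \<partial>P) \<longlonglongrightarrow> 0"
  proof (rule Lim_null_comparison)
    show "\<forall>\<^sub>F i in sequentially. norm (\<integral>s. u (r i) s \<partial>P) \<le> 1 / real (Suc (r i))"
      using u(2) by (intro always_eventually) auto
    show "(\<lambda>i. 1 / real (Suc (r i))) \<longlonglongrightarrow> 0"
      by (rule filterlim_compose[OF lim_const_over_n[THEN LIMSEQ_Suc] filterlim_subseq[OF r(1)]])
  qed
  ultimately have "(\<integral>s. y s \<partial>P) = 0" by (rule LIMSEQ_unique)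
  then show ?thesis
    unfolding aumann_integral_def
    using sel selection_integrable(1)[OF sel] by (auto simp: selections_def intro!: exI[of _ y])
qed

end

section \<open>The chain rule for the expectation\<close>

text \<open>Local constants along the curve are combined into one by compactness of the
  interval.\<close>

lemma locally_lipschitz_compose_interval:
  fixes \<phi> :: "'a::metric_space \<Rightarrow> real" and \<gamma> :: "real \<Rightarrow> 'a"
  assumes \<phi>: "locally_lipschitz \<phi>" and \<gamma>: "L-lipschitz_on {0..1} \<gamma>"
  shows "\<exists>C. C-lipschitz_on {0..1} (\<lambda>t. \<phi> (\<gamma> t))"
proof -
  have L: "L \<ge> 0" using \<gamma> by (rule lipschitz_on_nonneg)
  \<comment> \<open>\<open>local_lipschitz\<close> carries a time parameter; the singleton makes it
    a dummy.\<close>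
  have "local_lipschitz {0::real} {0..1} (\<lambda>_ t. \<phi> (\<gamma> t))"
  proof (rule local_lipschitzI)
    fix x t :: real assume "x \<in> {0}" "t \<in> {0..1}"
    obtain \<epsilon> K where \<epsilon>: "\<epsilon> > 0" "K-lipschitz_on (ball (\<gamma> t) \<epsilon>) \<phi>"
      using \<phi> unfolding locally_lipschitz_def by blast
    define u where "u = (\<epsilon> / 2) / (L + 1)"
    have "u > 0" using \<epsilon> L by (simp add: u_def)
    have "(K * L)-lipschitz_on (cball t u \<inter> {0..1}) (\<lambda>t. \<phi> (\<gamma> t))"
    proof (rule lipschitz_on_compose2[of L _ \<gamma> K \<phi>])
      show "L-lipschitz_on (cball t u \<inter> {0..1}) \<gamma>"
        using \<gamma> by (rule lipschitz_on_subset) auto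
      have "\<gamma> ` (cball t u \<inter> {0..1}) \<subseteq> ball (\<gamma> t) \<epsilon>"
      proof
        fix z assume "z \<in> \<gamma> ` (cball t u \<inter> {0..1})"
        then obtain r where r: "z = \<gamma> r" "dist t r \<le> u" "r \<in> {0..1}" by auto
        have "dist (\<gamma> t) (\<gamma> r) \<le> L * dist t r"
          using \<gamma> \<open>t \<in> {0..1}\<close> r(3) by (rule lipschitz_onD)
        also have "\<dots> \<le> (L + 1) * u" using r(2) L by (intro mult_mono) auto
        also have "\<dots> = \<epsilon> / 2"
          unfolding u_def mult.commute[of "L + 1"]
          by (rule nonzero_eq_divide_eq[THEN iffD1, OF _ refl]) (use L in simp)
        finally show "z \<in> ball (\<gamma> t) \<epsilon>" using r(1) \<epsilon>(1) by simp
      qed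
      then show "K-lipschitz_on (\<gamma> ` (cball t u \<inter> {0..1})) \<phi>"
        by (rule lipschitz_on_subset[OF \<epsilon>(2)])
    qed
    then show "\<exists>u>0. \<exists>L. \<forall>x\<in>cball x u \<inter> {0}. L-lipschitz_on (cball t u \<inter> {0..1}) (\<lambda>t. \<phi> (\<gamma> t))"
      using \<open>u > 0\<close> by blast
  qed
  then obtain C where "\<And>x. x \<in> {0::real} \<Longrightarrow> C-lipschitz_on {0..1} (\<lambda>t. \<phi> (\<gamma> t))"
    by (rule local_lipschitz_compact_implies_lipschitz) auto
  then show ?thesis by blast
qed

text \<open>Local boundedness yields a convergent subsequence of the maximizers \<open>u n\<close>,
  and the closed graph places its limit in \<open>E x\<close>.\<close>

lemma conservative_gradient_support_usc:
  assumes E: "conservative_gradient \<phi> E" and x: "\<And>y. E y \<in> nonempty_compacts" and "e > 0"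
  shows "\<exists>d>0. \<forall>y. dist y x < d \<longrightarrow> support (E y) p \<le> support (E x) p + e"
proof (rule ccontr)
  assume neg: "\<not> ?thesis"
  have "\<exists>y u. dist y x < 1 / real (Suc n) \<and> u \<in> E y \<and> support (E x) p + e < u \<bullet> p" for n
  proof -
    have "1 / real (Suc n) > 0" by simp
    with neg obtain y where y: "dist y x < 1 / real (Suc n)" "\<not> support (E y) p \<le> support (E x) p + e"
      by blast
    obtain u where "u \<in> E y" "support (E y) p = u \<bullet> p" using support_attained[OF x] by blast
    with y show ?thesis by (intro exI[of _ y] exI[of _ u]) (simp add: not_le)
  qed
  then obtain y u where y: "\<And>n. dist (y n) x < 1 / real (Suc n)" and u: "\<And>n. u n \<in> E (y n)"
    and up: "\<And>n. support (E x) p + e < u n \<bullet> p" by metis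
  have null: "(\<lambda>n. 1 / real (Suc n)) \<longlonglongrightarrow> 0" by (rule lim_const_over_n[THEN LIMSEQ_Suc])
  have y_lim: "y \<longlonglongrightarrow> x"
    by (rule metric_tendsto_imp_tendsto[OF null]) (use y in \<open>auto intro!: always_eventually less_imp_le\<close>)
  obtain \<epsilon> where \<epsilon>: "\<epsilon> > 0" "bounded (\<Union>z\<in>ball x \<epsilon>. E z)"
    using E unfolding conservative_gradient_def by blast
  obtain n0 where n0: "\<And>n. n \<ge> n0 \<Longrightarrow> dist (y n) x < \<epsilon>"
    using tendstoD[OF y_lim \<epsilon>(1)] by (auto simp: eventually_sequentially)
  have "bounded (range (\<lambda>n. u (n + n0)))"
  proof (rule bounded_subset[OF \<epsilon>(2)])
    show "range (\<lambda>n. u (n + n0)) \<subseteq> (\<Union>z\<in>ball x \<epsilon>. E z)"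
    proof
      fix z assume "z \<in> range (\<lambda>n. u (n + n0))"
      then obtain n where "z = u (n + n0)" by blast
      then show "z \<in> (\<Union>z\<in>ball x \<epsilon>. E z)"
        using u[of "n + n0"] n0[of "n + n0"] by (auto simp: dist_commute)
    qed
  qed
  then obtain l r where r: "strict_mono r" "((\<lambda>n. u (n + n0)) \<circ> r) \<longlonglongrightarrow> l"
    using bounded_imp_convergent_subsequence by blast
  have "(\<lambda>n. y (n + n0)) \<longlonglongrightarrow> x" using y_lim by (rule LIMSEQ_ignore_initial_segment)
  from LIMSEQ_subseq_LIMSEQ[OF this r(1)] have lim: "(\<lambda>n. (y (r n + n0), u (r n + n0))) \<longlonglongrightarrow> (x, l)"
    using r(2) by (intro tendsto_Pair) (auto simp: o_def)
  have cl: "closed {(x, v). v \<in> E x}" using E unfolding conservative_gradient_def by blast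
  have "(x, l) \<in> {(x, v). v \<in> E x}"
    by (rule closed_sequentially[OF cl _ lim]) (simp add: u)
  then have "l \<bullet> p \<le> support (E x) p" by (intro support_upper x) simp
  moreover have "(\<lambda>n. u (r n + n0) \<bullet> p) \<longlonglongrightarrow> l \<bullet> p"
    using r(2) by (intro tendsto_intros) (simp add: o_def)
  then have "support (E x) p + e \<le> l \<bullet> p"
    by (rule LIMSEQ_le_const) (use up in \<open>auto intro: less_imp_le\<close>)
  ultimately show False using \<open>e > 0\<close> by simp
qed

text \<open>All \<open>v\<close> in \<open>E (\<gamma> t)\<close> give the same derivative, so it
  may be written with the one attaining the support function in direction \<open>- d\<close>. This
  form depends measurably on time and sample, without choosing \<open>v\<close>.\<close>

lemma conservative_gradient_chain:
  assumes E: "conservative_gradient \<phi> E" and Ec: "\<And>y. E y \<in> nonempty_compacts" and \<gamma>: "L-lipschitz_on {0..1} \<gamma>"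
  shows "AE t in unit_interval. \<exists>d. (\<gamma> has_vector_derivative d) (at t)
    \<and> ((\<lambda>t. \<phi> (\<gamma> t)) has_real_derivative - support (E (\<gamma> t)) (- d)) (at t)"
proof -
  have "AE t in lebesgue_on {0..1}. \<exists>\<gamma>'. (\<gamma> has_vector_derivative \<gamma>') (at t within {0..1}) \<and>
          (\<forall>v\<in>E (\<gamma> t). ((\<phi> \<circ> \<gamma>) has_real_derivative v \<bullet> \<gamma>') (at t within {0..1}))"
    using E lipschitz_imp_absolutely_continuous_curve[OF \<gamma>] unfolding conservative_gradient_def by blast
  then have "AE t in unit_interval. \<exists>\<gamma>'. (\<gamma> has_vector_derivative \<gamma>') (at t within {0..1}) \<and>
          (\<forall>v\<in>E (\<gamma> t). ((\<phi> \<circ> \<gamma>) has_real_derivative v \<bullet> \<gamma>') (at t within {0..1}))"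
    by (rule AE_unit_intervalI)
  then show ?thesis
    using AE_space
  proof eventually_elim
    case (elim t)
    have t: "at t within {0..1} = at t"
      using elim(2) by (intro at_within_Icc_at) (auto simp: space_restrict_space)
    obtain d where d: "(\<gamma> has_vector_derivative d) (at t)"
      "\<And>v. v \<in> E (\<gamma> t) \<Longrightarrow> ((\<lambda>t. \<phi> (\<gamma> t)) has_real_derivative v \<bullet> d) (at t)"
      using elim(1) unfolding t o_def by blast
    obtain v where "v \<in> E (\<gamma> t)" "support (E (\<gamma> t)) (- d) = v \<bullet> (- d)"
      using support_attained[OF Ec] by blast
    then show ?case using d by (intro exI[of _ d]) auto
  qed
qed


text \<open>Coordinatewise, increments are integrals of the derivative; the increment up to
  \<open>t\<close> is that over the whole interval of the curve stopped at \<open>t\<close>.\<close>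

lemma lipschitz_curve_const:
  fixes \<gamma> :: "real \<Rightarrow> 'a::euclidean_space"
  assumes \<gamma>: "L-lipschitz_on {0..1} \<gamma>" and zero: "AE t in unit_interval. (\<gamma> has_vector_derivative 0) (at t)"
    and t: "t \<in> {0..1}"
  shows "\<gamma> t = \<gamma> 0"
proof (rule euclidean_eqI)
  fix b :: 'a assume "b \<in> Basis"
  define c where "c r = \<gamma> (min r t) \<bullet> b" for r
  have "L-lipschitz_on {0..1} c"
  proof (rule lipschitz_onI)
    show "0 \<le> L" using \<gamma> by (rule lipschitz_on_nonneg)
    fix x y :: real assume xy: "x \<in> {0..1}" "y \<in> {0..1}"
    have "dist (c x) (c y) = \<bar>(\<gamma> (min x t) - \<gamma> (min y t)) \<bullet> b\<bar>"
      by (simp add: c_def dist_real_def inner_diff_left)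
    also have "\<dots> \<le> norm (\<gamma> (min x t) - \<gamma> (min y t))"
      using \<open>b \<in> Basis\<close> by (rule Basis_le_norm)
    also have "\<dots> \<le> L * dist (min x t) (min y t)"
      unfolding dist_norm[symmetric] by (rule lipschitz_onD[OF \<gamma>]) (use xy t in auto)
    also have "\<dots> \<le> L * dist x y"
      using \<open>0 \<le> L\<close> by (intro mult_left_mono) (auto simp: dist_real_def min_def)
    finally show "dist (c x) (c y) \<le> L * dist x y" .
  qed
  moreover have "AE r in unit_interval. (c has_real_derivative 0) (at r)"
  proof -
    have "AE r in unit_interval. r \<noteq> t"
      using AE_lborel_singleton[of t] by (subst AE_restrict_space_iff) (auto elim: eventually_mono)
    with zero show ?thesis
    proof eventually_elim
      case (elim r)
      show ?case
      proof (cases "r < t")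
        case True
        have "((\<lambda>r. \<gamma> r \<bullet> b) has_real_derivative 0 \<bullet> b) (at r)"
          using bounded_linear.has_vector_derivative[OF bounded_linear_inner_left elim(1)]
          by (simp add: has_real_derivative_iff_has_vector_derivative)
        then have "(c has_real_derivative 0 \<bullet> b) (at r)"
          by (rule has_field_derivative_transform_within_open[of _ _ _ "{..<t}"]) (use True in \<open>auto simp: c_def\<close>)
        then show ?thesis by simp
      next
        case False
        show ?thesis
          by (rule has_field_derivative_transform_within_open[of "\<lambda>_. \<gamma> t \<bullet> b" _ _ "{t<..}"])
            (use False elim(2) in \<open>auto simp: c_def\<close>)
      qed
    qed
  qed
  ultimately have "(\<integral>r. 0 \<partial>unit_interval) = c 1 - c 0"
    by (intro lipschitz_integral_derivative) auto
  then show "\<gamma> t \<bullet> b = \<gamma> 0 \<bullet> b" using t by (simp add: c_def)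
qed

lemma has_vector_derivative_quotient:
  fixes C :: "real \<Rightarrow> 'a::euclidean_space"
  assumes "(C has_vector_derivative e) (at t)"
  shows "((\<lambda>y. (C (t + y) - C t) /\<^sub>R y) \<longlongrightarrow> e) (at 0)"
proof (rule tendsto_componentwise_iff[THEN iffD2], rule ballI)
  fix b :: 'a assume "b \<in> Basis"
  have "((\<lambda>r. C r \<bullet> b) has_real_derivative e \<bullet> b) (at t)"
    using bounded_linear.has_vector_derivative[OF bounded_linear_inner_left assms]
    by (simp add: has_real_derivative_iff_has_vector_derivative)
  then show "((\<lambda>y. ((C (t + y) - C t) /\<^sub>R y) \<bullet> b) \<longlongrightarrow> e \<bullet> b) (at 0)"
    by (simp add: DERIV_def inner_diff_left divide_inverse_commute)
qed

text \<open>The derivative is given only almost everywhere; limits of difference quotients of the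
  extended curve supply a Borel function on the whole line.\<close>

lemma measurable_derivative:
  fixes \<gamma> :: "real \<Rightarrow> 'a::euclidean_space"
  assumes \<gamma>: "L-lipschitz_on {0..1} \<gamma>" and diff: "AE t in unit_interval. \<exists>d. (\<gamma> has_vector_derivative d) (at t)"
  shows "\<exists>d\<in>borel_measurable borel. (AE t in unit_interval. (\<gamma> has_vector_derivative d t) (at t)) \<and> (\<forall>t. norm (d t) \<le> L)"
proof -
  have L: "L \<ge> 0" using \<gamma> by (rule lipschitz_on_nonneg)
  define C where "C t = \<gamma> (max 0 (min 1 t))" for t
  have lip: "L-lipschitz_on UNIV C"
    unfolding C_def using \<gamma> by (rule lipschitz_on_clamp)
  have [measurable]: "C \<in> borel_measurable borel"
    by (rule borel_measurable_continuous_onI) (rule lipschitz_on_continuous_on[OF lip])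
  define h where "h n = 1 / real (Suc n)" for n
  define q where "q n t = (C (t + h n) - C t) /\<^sub>R h n" for n t
  \<comment> \<open>Where the quotients diverge, \<open>lim\<close> is an unspecified value; the
    cutoff keeps the norm bound valid everywhere.\<close>
  define d where "d t = (if norm (lim (\<lambda>n. q n t)) \<le> L then lim (\<lambda>n. q n t) else 0)" for t
  have h: "h n > 0" for n by (simp add: h_def)
  have q_le: "norm (q n t) \<le> L" for n t
    using lipschitz_onD[OF lip, of "t + h n" t] h[of n]
    by (simp add: q_def dist_norm dist_real_def divide_inverse_commute[symmetric] pos_divide_le_eq)
  have "d \<in> borel_measurable borel"
    unfolding d_def q_def by measurable
  moreover have "AE t in unit_interval. (\<gamma> has_vector_derivative d t) (at t)"
    using diff AE_space
  proof eventually_elim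
    case (elim t)
    then obtain e where e: "(\<gamma> has_vector_derivative e) (at t)" by blast
    have t: "t \<in> {0<..<1}" using elim(2) by (simp add: space_restrict_space)
    have "(C has_vector_derivative e) (at t)"
      by (rule has_vector_derivative_transform_within_open[OF e, of "{0<..<1}"]) (use t in \<open>auto simp: C_def\<close>)
    then have "((\<lambda>y. (C (t + y) - C t) /\<^sub>R y) \<longlongrightarrow> e) (at 0)"
      by (rule has_vector_derivative_quotient)
    moreover have "filterlim h (at 0) sequentially"
      unfolding filterlim_at using h lim_const_over_n[of 1, THEN LIMSEQ_Suc] by (auto simp: h_def[abs_def] simp del: of_nat_Suc)
    ultimately have q: "(\<lambda>n. q n t) \<longlonglongrightarrow> e"
      unfolding q_def by (rule filterlim_compose)
    have "norm e \<le> L"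
      by (rule LIMSEQ_le_const2[OF tendsto_norm[OF q]]) (use q_le in auto)
    then have "d t = e" using limI[OF q] by (simp add: d_def)
    then show ?case using e by simp
  qed
  moreover have "norm (d t) \<le> L" for t using L by (simp add: d_def)
  ultimately show ?thesis by blast
qed

section \<open>Expected objective and expected support function\<close>

locale stochastic_objective = prob_space P for P :: "'s measure" +
  fixes f :: "'a::euclidean_space \<Rightarrow> 's \<Rightarrow> real" and D :: "'a \<Rightarrow> 's \<Rightarrow> 'a set" and \<kappa> :: "'s \<Rightarrow> real" and q0 :: nat
  assumes D_values: "\<And>x s. s \<in> space P \<Longrightarrow> D x s \<noteq> {} \<and> compact (D x s)"
    and conservative: "AE s in P. locally_lipschitz (\<lambda>x. f x s)
          \<and> conservative_gradient (\<lambda>x. f x s) (\<lambda>x. D x s) \<and> (\<forall>x. convex (D x s))"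
    and f_integrable: "\<And>x. integrable P (f x)"
    and D_measurable: "(\<lambda>(x, s). D x s) \<in> borel \<Otimes>\<^sub>M P \<rightarrow>\<^sub>M hausdorff_borel"
    and \<kappa>_nonneg: "\<And>s. s \<in> space P \<Longrightarrow> \<kappa> s \<ge> 0"
    and \<kappa>_measurable [measurable]: "\<kappa> \<in> borel_measurable P"
    and \<kappa>_square_integrable: "integrable P (\<lambda>s. (\<kappa> s)\<^sup>2)"
    and D_growth: "AE s in P. \<forall>x. set_norm (D x s) \<le> \<kappa> s * (1 + norm x ^ q0)"
begin

definition g :: "'a \<Rightarrow> 'a \<Rightarrow> real" where
  "g x p = (\<integral>s. support (D x s) p \<partial>P)"

definition K :: real where
  "K = (\<integral>s. \<kappa> s \<partial>P)"

lemma D_compact: "s \<in> space P \<Longrightarrow> D x s \<in> nonempty_compacts"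
  using D_values by (simp add: nonempty_compacts_def)

lemma D_section: "D x \<in> P \<rightarrow>\<^sub>M hausdorff_borel"
  using measurable_compose[OF measurable_Pair1' D_measurable, of x] by simp

lemma D_bound: "AE s in P. \<forall>x. \<forall>u\<in>D x s. norm u \<le> \<kappa> s * (1 + norm x ^ q0)"
  using D_growth AE_space
proof eventually_elim
  case (elim s)
  show ?case
  proof (intro allI ballI)
    fix x u assume u: "u \<in> D x s"
    have "compact (norm ` D x s)"
      using D_values[OF elim(2)] by (intro compact_continuous_image continuous_intros) auto
    then have "bdd_above (norm ` D x s)" by (intro bounded_imp_bdd_above compact_imp_bounded)
    then have "norm u \<le> set_norm (D x s)" unfolding set_norm_def using u by (intro cSUP_upper)
    then show "norm u \<le> \<kappa> s * (1 + norm x ^ q0)" using elim(1) order_trans by blast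
  qed
qed

lemma multifunction: "bounded_multifunction P (D x) (\<lambda>s. \<kappa> s * (1 + norm x ^ q0))"
proof
  show "(\<lambda>s. infdist q (D x s)) \<in> borel_measurable P" for q
    by (rule measurable_compose[OF D_section measurable_infdist_hausdorff])
  show "(\<lambda>s. support (D x s) p) \<in> borel_measurable P" for p
    by (rule measurable_compose[OF D_section measurable_support_hausdorff])
  show "AE s in P. convex (D x s)" using conservative by (auto elim: eventually_mono)
  show "AE s in P. \<forall>u\<in>D x s. norm u \<le> \<kappa> s * (1 + norm x ^ q0)"
    using D_bound by (auto elim: eventually_mono)
  show "integrable P (\<lambda>s. (\<kappa> s * (1 + norm x ^ q0))\<^sup>2)"
    using \<kappa>_square_integrable by (simp add: power_mult_distrib)
qed (auto intro: D_compact)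

lemma \<kappa>_integrable: "integrable P \<kappa>"
  using bounded_multifunction.k_integrable[OF multifunction, of 0] by (cases "q0 = 0") (auto simp: zero_power)

lemma K_nonneg: "0 \<le> K"
  unfolding K_def using \<kappa>_nonneg by (intro integral_nonneg_AE) auto

text \<open>For a constant direction this is composition with a Borel functional on compact sets;
  simple functions and continuity in the direction give the rest. The varying direction will be the
  derivative of a curve.\<close>

lemma support_measurable:
  assumes x: "x \<in> N \<rightarrow>\<^sub>M borel" and s: "s \<in> N \<rightarrow>\<^sub>M P" and p: "p \<in> N \<rightarrow>\<^sub>M borel"
  shows "(\<lambda>t. support (D (x t) (s t)) (p t)) \<in> borel_measurable N"
proof -
  obtain F where F: "\<And>i. simple_function N (F i)" "\<And>t. t \<in> space N \<Longrightarrow> (\<lambda>i. F i t) \<longlonglongrightarrow> p t"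
    using borel_measurable_implies_sequence_metric[OF p] by metis
  have "(\<lambda>t. case (x t, s t) of (x, s) \<Rightarrow> D x s) \<in> N \<rightarrow>\<^sub>M hausdorff_borel"
    by (rule measurable_compose[OF _ D_measurable]) (use x s in measurable)
  then have D: "(\<lambda>t. D (x t) (s t)) \<in> N \<rightarrow>\<^sub>M hausdorff_borel" by simp
  have meas: "(\<lambda>t. support (D (x t) (s t)) (F i t)) \<in> borel_measurable N" for i
  proof (rule measurable_compose_countable'[where I = "F i ` space N" and f = "\<lambda>q t. support (D (x t) (s t)) q"])
    show "(\<lambda>t. support (D (x t) (s t)) q) \<in> borel_measurable N" for q
      by (rule measurable_compose[OF D measurable_support_hausdorff])
    have fin: "finite (F i ` space N)" using F(1) by (rule simple_functionD)
    then show "countable (F i ` space N)" by (rule countable_finite)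
    show "F i \<in> N \<rightarrow>\<^sub>M count_space (F i ` space N)"
      unfolding measurable_count_space_eq2[OF fin] using simple_functionD(2)[OF F(1)] by auto
  qed
  show ?thesis
  proof (rule borel_measurable_LIMSEQ_metric[OF meas])
    fix t assume t: "t \<in> space N"
    have "D (x t) (s t) \<in> nonempty_compacts" using measurable_space[OF s t] by (rule D_compact)
    from tendsto_support[OF this F(2)[OF t]]
    show "(\<lambda>i. support (D (x t) (s t)) (F i t)) \<longlonglongrightarrow> support (D (x t) (s t)) (p t)" .
  qed
qed

lemma support_bound: "AE s in P. \<forall>x p. \<bar>support (D x s) p\<bar> \<le> \<kappa> s * (1 + norm x ^ q0) * norm p"
  using D_bound AE_space
  by eventually_elim (auto intro!: support_abs_le D_compact)

lemma support_integrable: "integrable P (\<lambda>s. support (D x s) p)"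
proof (rule Bochner_Integration.integrable_bound)
  show "integrable P (\<lambda>s. \<kappa> s * (1 + norm x ^ q0) * norm p)" using \<kappa>_integrable by auto
  show "(\<lambda>s. support (D x s) p) \<in> borel_measurable P" by (rule support_measurable) auto
  show "AE s in P. norm (support (D x s) p) \<le> norm (\<kappa> s * (1 + norm x ^ q0) * norm p)"
    using support_bound AE_space
    by eventually_elim (metis abs_ge_self order_trans real_norm_def)
qed

lemma g_bound: "\<bar>g x p\<bar> \<le> K * (1 + norm x ^ q0) * norm p"
proof -
  have "\<bar>g x p\<bar> \<le> (\<integral>s. \<bar>support (D x s) p\<bar> \<partial>P)" unfolding g_def by (rule integral_abs_bound)
  also have "\<dots> \<le> (\<integral>s. \<kappa> s * (1 + norm x ^ q0) * norm p \<partial>P)"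
    by (rule integral_mono_AE) (use support_integrable \<kappa>_integrable support_bound in \<open>auto elim: eventually_mono\<close>)
  also have "\<dots> = K * (1 + norm x ^ q0) * norm p" using \<kappa>_integrable by (simp add: K_def)
  finally show ?thesis .
qed

lemma g_0: "g x 0 = 0"
proof -
  have "g x 0 = (\<integral>s. 0 \<partial>P)"
    unfolding g_def by (rule Bochner_Integration.integral_cong) (auto intro: support_0 D_compact)
  then show ?thesis by simp
qed

lemma zero_in_expected_map:
  assumes "\<And>p. 0 \<le> g x p"
  shows "0 \<in> expected_map P D x"
  unfolding expected_map_def
  by (rule bounded_multifunction.zero_in_aumann_integral[OF multifunction]) (use assms in \<open>simp add: g_def\<close>)

text \<open>A reverse Fatou argument: pointwise only an upper bound for the limit is known, but the
  maximum \<open>\<tau>\<close> with the value at \<open>x\<close> converges, so dominated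
  convergence applies.\<close>

lemma g_usc:
  assumes "e > 0"
  shows "\<exists>d>0. \<forall>y. dist y x < d \<longrightarrow> g y p \<le> g x p + e"
proof (rule ccontr)
  assume neg: "\<not> ?thesis"
  have "\<exists>y. dist y x < 1 / real (Suc n) \<and> g x p + e < g y p" for n
  proof -
    have "1 / real (Suc n) > 0" by simp
    with neg show ?thesis by (meson not_le)
  qed
  then obtain y where y: "\<And>n. dist (y n) x < 1 / real (Suc n)" "\<And>n. g x p + e < g (y n) p" by metis
  have null: "(\<lambda>n. 1 / real (Suc n)) \<longlonglongrightarrow> 0" by (rule lim_const_over_n[THEN LIMSEQ_Suc])
  have y_lim: "y \<longlonglongrightarrow> x"
    by (rule metric_tendsto_imp_tendsto[OF null])
      (use y in \<open>auto intro!: always_eventually less_imp_le\<close>)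
  define R where "R = norm x + 1"
  have R: "norm (y n) \<le> R" for n
  proof -
    have "dist (y n) x < 1" using y(1)[of n] by (rule less_le_trans) simp
    then show ?thesis using norm_triangle_sub[of "y n" x] by (simp add: R_def dist_norm)
  qed
  define \<tau> where "\<tau> n s = max (support (D (y n) s) p) (support (D x s) p)" for n s
  have \<tau>_meas: "\<tau> n \<in> borel_measurable P" for n
    unfolding \<tau>_def by (intro borel_measurable_max support_measurable) auto
  have \<tau>_lim: "(\<lambda>n. \<integral>s. \<tau> n s \<partial>P) \<longlonglongrightarrow> g x p"
    unfolding g_def
  proof (rule integral_dominated_convergence[where w = "\<lambda>s. \<kappa> s * (1 + R ^ q0) * norm p"])
    show "(\<lambda>s. support (D x s) p) \<in> borel_measurable P" by (rule support_measurable) auto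
    show "integrable P (\<lambda>s. \<kappa> s * (1 + R ^ q0) * norm p)" using \<kappa>_integrable by auto
    show "AE s in P. (\<lambda>n. \<tau> n s) \<longlonglongrightarrow> support (D x s) p"
      using conservative AE_space
    proof eventually_elim
      case (elim s)
      show ?case
      proof (rule tendstoI)
        fix \<epsilon> :: real assume "\<epsilon> > 0"
        then have "\<epsilon> / 2 > 0" by simp
        obtain d where d: "d > 0" "\<And>z. dist z x < d \<Longrightarrow> support (D z s) p \<le> support (D x s) p + \<epsilon> / 2"
          using conservative_gradient_support_usc[OF elim(1)[THEN conjunct2, THEN conjunct1] D_compact[OF elim(2)] \<open>\<epsilon> / 2 > 0\<close>]
          by blast
        show "\<forall>\<^sub>F n in sequentially. dist (\<tau> n s) (support (D x s) p) < \<epsilon>"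
          using tendstoD[OF y_lim d(1)]
        proof eventually_elim
          case (elim n)
          from d(2)[OF this] show ?case using \<open>\<epsilon> > 0\<close> by (simp add: \<tau>_def dist_real_def)
        qed
      qed
    qed
    show "AE s in P. norm (\<tau> n s) \<le> \<kappa> s * (1 + R ^ q0) * norm p" for n
      using support_bound AE_space
    proof eventually_elim
      case (elim s)
      have "\<bar>support (D z s) p\<bar> \<le> \<kappa> s * (1 + R ^ q0) * norm p" if "norm z \<le> R" for z
      proof -
        have "\<kappa> s * (1 + norm z ^ q0) * norm p \<le> \<kappa> s * (1 + R ^ q0) * norm p"
          using that \<kappa>_nonneg[OF elim(2)] by (intro mult_right_mono mult_left_mono add_left_mono power_mono) auto
        then show ?thesis using elim(1) order_trans by blast
      qed
      from this[OF R] this[of x] show ?case by (auto simp: \<tau>_def R_def max_def)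
    qed
  qed (rule \<tau>_meas)
  have \<tau>_int: "integrable P (\<tau> n)" for n
    unfolding \<tau>_def by (intro integrable_max support_integrable)
  have "g x p + e \<le> (\<integral>s. \<tau> n s \<partial>P)" for n
  proof -
    have "g (y n) p \<le> (\<integral>s. \<tau> n s \<partial>P)"
      unfolding g_def by (intro integral_mono support_integrable \<tau>_int) (simp add: \<tau>_def)
    then show ?thesis using y(2)[of n] by simp
  qed
  then have "g x p + e \<le> g x p" by (intro LIMSEQ_le_const[OF \<tau>_lim]) auto
  with assms show False by simp
qed

lemma curve_differentiable:
  fixes \<gamma> :: "real \<Rightarrow> 'a"
  assumes "L-lipschitz_on {0..1} \<gamma>"
  shows "AE t in unit_interval. \<exists>d. (\<gamma> has_vector_derivative d) (at t)"
proof -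
  have "AE s in P. AE t in unit_interval. \<exists>d. (\<gamma> has_vector_derivative d) (at t)"
    using conservative AE_space
  proof eventually_elim
    case (elim s)
    from conservative_gradient_chain[OF elim(1)[THEN conjunct2, THEN conjunct1] D_compact[OF elim(2)] assms]
    show ?case by eventually_elim blast
  qed
  then show ?thesis by simp
qed

text \<open>The derivative of \<open>f (\<gamma> t) s\<close> is both the largest and the smallest value of
  \<open>v \<bullet> d t\<close> over \<open>v \<in> D (\<gamma> t) s\<close>; the smallest is \<open>- support (D (\<gamma> t) s) (- d t)\<close>.\<close>

lemma expected_chain:
  fixes \<gamma> d :: "real \<Rightarrow> 'a"
  assumes \<gamma>: "L-lipschitz_on {0..1} \<gamma>"
    and d: "d \<in> borel_measurable borel" "\<And>t. norm (d t) \<le> L"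
    and der: "AE t in unit_interval. (\<gamma> has_vector_derivative d t) (at t)"
  shows "integrable unit_interval (\<lambda>t. g (\<gamma> t) (- d t))"
    and "expected_fun P f (\<gamma> 1) - expected_fun P f (\<gamma> 0) = - (\<integral>t. g (\<gamma> t) (- d t) \<partial>unit_interval)"
proof -
  interpret U: prob_space unit_interval by (rule prob_space_unit_interval)
  interpret PU: pair_sigma_finite P unit_interval by unfold_locales
  \<comment> \<open>A Borel function on the whole line that agrees with the curve on the unit
    interval, so that joint measurability follows by composition.\<close>
  define \<Gamma> where "\<Gamma> t = \<gamma> (max 0 (min 1 t))" for t
  have \<Gamma>: "\<Gamma> t = \<gamma> t" if "t \<in> {0..1}" for t using that by (simp add: \<Gamma>_def)
  have lip: "L-lipschitz_on UNIV \<Gamma>" unfolding \<Gamma>_def using \<gamma> by (rule lipschitz_on_clamp)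
  have \<Gamma>_meas: "\<Gamma> \<in> borel_measurable borel"
    by (rule borel_measurable_continuous_onI) (rule lipschitz_on_continuous_on[OF lip])
  have "compact (\<gamma> ` {0..1})"
    using lipschitz_on_continuous_on[OF \<gamma>] by (intro compact_continuous_image) auto
  then have "bounded (\<gamma> ` {0..1})" by (rule compact_imp_bounded)
  then obtain R where R: "R > 0" "\<And>t. t \<in> {0..1} \<Longrightarrow> norm (\<gamma> t) \<le> R"
    unfolding bounded_pos by auto
  have R': "norm (\<Gamma> t) \<le> R" for t unfolding \<Gamma>_def by (rule R(2)) auto
  have L: "0 \<le> L" using \<gamma> by (rule lipschitz_on_nonneg)
  define \<Phi> where "\<Phi> s t = support (D (\<Gamma> t) s) (- d t)" for s t
  have \<Phi>_pair: "(\<lambda>x. \<Phi> (fst x) (snd x)) \<in> borel_measurable (P \<Otimes>\<^sub>M unit_interval)"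
  proof -
    have snd: "snd \<in> P \<Otimes>\<^sub>M unit_interval \<rightarrow>\<^sub>M borel"
    proof (rule measurable_compose[OF measurable_snd, where g = "\<lambda>t. t"])
      show "(\<lambda>t. t) \<in> unit_interval \<rightarrow>\<^sub>M borel" by (rule measurable_restrict_space1) simp
    qed
    show ?thesis
      unfolding \<Phi>_def
      by (intro support_measurable measurable_compose[OF snd \<Gamma>_meas] measurable_fst borel_measurable_uminus
          measurable_compose[OF snd d(1)])
  qed
  have \<Phi>_meas: "\<Phi> s \<in> borel_measurable unit_interval" if "s \<in> space P" for s
    using measurable_compose[OF measurable_Pair1'[OF that] \<Phi>_pair] by simp
  define c where "c s = \<kappa> s * (1 + R ^ q0) * L" for s
  have c_int: "integrable P c" unfolding c_def using \<kappa>_integrable by auto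
  have \<Phi>_bound: "AE s in P. \<forall>t. \<bar>\<Phi> s t\<bar> \<le> c s"
    using support_bound AE_space
  proof eventually_elim
    case (elim s)
    show ?case
    proof
      fix t
      have "\<kappa> s * (1 + norm (\<Gamma> t) ^ q0) * norm (- d t) \<le> c s"
        unfolding c_def using R'[of t] d(2)[of t] \<kappa>_nonneg[OF elim(2)] R(1)
        by (intro mult_mono mult_left_mono add_left_mono power_mono) auto
      then show "\<bar>\<Phi> s t\<bar> \<le> c s"
        unfolding \<Phi>_def using elim(1) order_trans by blast
    qed
  qed
  have \<Phi>_int: "AE s in P. integrable unit_interval (\<Phi> s)"
    using \<Phi>_bound AE_space
    by eventually_elim (rule U.integrable_const_bound[OF _ \<Phi>_meas], auto)
  have pair_int: "integrable (P \<Otimes>\<^sub>M unit_interval) (\<lambda>(s, t). \<Phi> s t)"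
  proof (rule PU.Fubini_integrable)
    show "(\<lambda>(s, t). \<Phi> s t) \<in> borel_measurable (P \<Otimes>\<^sub>M unit_interval)"
      using \<Phi>_pair by (simp add: case_prod_beta)
    show "AE s in P. integrable unit_interval (\<lambda>t. case (s, t) of (s, t) \<Rightarrow> \<Phi> s t)"
      using \<Phi>_int by simp
    show "integrable P (\<lambda>s. \<integral>t. norm (case (s, t) of (s, t) \<Rightarrow> \<Phi> s t) \<partial>unit_interval)"
    proof (rule Bochner_Integration.integrable_bound[OF c_int])
      show "(\<lambda>s. \<integral>t. norm (case (s, t) of (s, t) \<Rightarrow> \<Phi> s t) \<partial>unit_interval) \<in> borel_measurable P"
        using \<Phi>_pair by (intro U.borel_measurable_lebesgue_integral) (simp add: case_prod_beta)
      show "AE s in P. norm (\<integral>t. norm (case (s, t) of (s, t) \<Rightarrow> \<Phi> s t) \<partial>unit_interval) \<le> norm (c s)"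
        using \<Phi>_bound \<Phi>_int
      proof eventually_elim
        case (elim s)
        have "(\<integral>t. norm (\<Phi> s t) \<partial>unit_interval) \<le> (\<integral>t. c s \<partial>unit_interval)"
          using elim by (intro integral_mono) auto
        also have "\<dots> = c s" by (simp add: measure_restrict_space)
        finally show ?case by simp
      qed
    qed
  qed
  have g_eq: "g (\<Gamma> t) (- d t) = (\<integral>s. \<Phi> s t \<partial>P)" for t
    by (simp add: g_def \<Phi>_def)
  have in01: "t \<in> {0..1}" if "t \<in> space unit_interval" for t
    using that by (auto simp: space_restrict_space)
  have "integrable unit_interval (\<lambda>t. \<integral>s. \<Phi> s t \<partial>P)"
    using PU.integrable_snd[OF pair_int] by simp
  moreover have "integrable unit_interval (\<lambda>t. g (\<gamma> t) (- d t)) \<longleftrightarrow> integrable unit_interval (\<lambda>t. \<integral>s. \<Phi> s t \<partial>P)"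
    by (rule Bochner_Integration.integrable_cong) (use \<Gamma> in01 in \<open>auto simp: g_eq[symmetric]\<close>)
  ultimately show "integrable unit_interval (\<lambda>t. g (\<gamma> t) (- d t))" by simp
  \<comment> \<open>The exceptional times depend on \<open>s\<close>. Hence time is integrated
    first, for each \<open>s\<close>, and the order of integration is exchanged afterwards.\<close>
  have "AE s in P. f (\<gamma> 1) s - f (\<gamma> 0) s = - (\<integral>t. \<Phi> s t \<partial>unit_interval)"
    using conservative AE_space
  proof eventually_elim
    case (elim s)
    obtain C where C: "C-lipschitz_on {0..1} (\<lambda>t. f (\<gamma> t) s)"
      using locally_lipschitz_compose_interval[OF elim(1)[THEN conjunct1] \<gamma>] by blast
    have "(\<integral>t. - \<Phi> s t \<partial>unit_interval) = f (\<gamma> 1) s - f (\<gamma> 0) s"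
    proof (rule lipschitz_integral_derivative[OF C])
      show "(\<lambda>t. - \<Phi> s t) \<in> borel_measurable unit_interval" using \<Phi>_meas[OF elim(2)] by simp
      show "AE t in unit_interval. ((\<lambda>t. f (\<gamma> t) s) has_real_derivative - \<Phi> s t) (at t)"
        using conservative_gradient_chain[OF elim(1)[THEN conjunct2, THEN conjunct1] D_compact[OF elim(2)] \<gamma>] der AE_space
      proof eventually_elim
        case (elim t)
        then obtain e where e: "(\<gamma> has_vector_derivative e) (at t)"
          "((\<lambda>t. f (\<gamma> t) s) has_real_derivative - support (D (\<gamma> t) s) (- e)) (at t)" by blast
        have "e = d t" using e(1) elim(2) by (rule vector_derivative_unique_at)
        then show ?case using e(2) \<Gamma>[OF in01[OF elim(3)]] by (simp add: \<Phi>_def)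
      qed
    qed
    then show ?case by simp
  qed
  then have "(\<integral>s. f (\<gamma> 1) s - f (\<gamma> 0) s \<partial>P) = (\<integral>s. - (\<integral>t. \<Phi> s t \<partial>unit_interval) \<partial>P)"
  proof (intro integral_cong_AE)
    show "(\<lambda>s. - (\<integral>t. \<Phi> s t \<partial>unit_interval)) \<in> borel_measurable P"
      using \<Phi>_pair by (intro borel_measurable_uminus U.borel_measurable_lebesgue_integral) (simp add: case_prod_beta)
  qed (use f_integrable in auto)
  also have "\<dots> = - (\<integral>t. (\<integral>s. \<Phi> s t \<partial>P) \<partial>unit_interval)"
    using PU.Fubini_integral[OF pair_int] by simp
  also have "(\<integral>t. (\<integral>s. \<Phi> s t \<partial>P) \<partial>unit_interval) = (\<integral>t. g (\<gamma> t) (- d t) \<partial>unit_interval)"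
    by (rule Bochner_Integration.integral_cong) (use \<Gamma> in01 in \<open>auto simp: g_eq[symmetric]\<close>)
  finally show "expected_fun P f (\<gamma> 1) - expected_fun P f (\<gamma> 0) = - (\<integral>t. g (\<gamma> t) (- d t) \<partial>unit_interval)"
    using f_integrable by (simp add: expected_fun_def)
qed

text \<open>The chain rule along the segment from \<open>x\<close> to \<open>y\<close>, whose points
  stay in the ball of radius \<open>R\<close>, combined with \<open>g_bound\<close>.\<close>

lemma J_lipschitz:
  assumes "norm x \<le> R" "norm y \<le> R"
  shows "\<bar>expected_fun P f y - expected_fun P f x\<bar> \<le> K * (1 + R ^ q0) * norm (y - x)"
proof -
  interpret U: prob_space unit_interval by (rule prob_space_unit_interval)
  define \<gamma> where "\<gamma> t = x + t *\<^sub>R (y - x)" for t :: real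
  have lip: "(norm (y - x))-lipschitz_on {0..1} \<gamma>"
  proof (rule lipschitz_onI)
    fix s t :: real
    have "\<gamma> s - \<gamma> t = (s - t) *\<^sub>R (y - x)" by (simp add: \<gamma>_def scaleR_diff_left)
    then show "dist (\<gamma> s) (\<gamma> t) \<le> norm (y - x) * dist s t"
      by (simp add: dist_norm mult.commute)
  qed simp
  have der: "(\<gamma> has_vector_derivative y - x) (at t)" for t
    unfolding \<gamma>_def by (auto intro!: derivative_eq_intros)
  have bound: "\<bar>g (\<gamma> t) (- (y - x))\<bar> \<le> K * (1 + R ^ q0) * norm (y - x)" if "t \<in> space unit_interval" for t
  proof -
    have t: "0 \<le> t" "t \<le> 1" using that by (auto simp: space_restrict_space)
    have "\<gamma> t = (1 - t) *\<^sub>R x + t *\<^sub>R y" by (simp add: \<gamma>_def algebra_simps)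
    then have "norm (\<gamma> t) \<le> (1 - t) * norm x + t * norm y"
      using norm_triangle_ineq[of "(1 - t) *\<^sub>R x" "t *\<^sub>R y"] t by simp
    also have "\<dots> \<le> R" using assms t by (intro convex_bound_le) auto
    finally have "norm (\<gamma> t) \<le> R" .
    then have "K * (1 + norm (\<gamma> t) ^ q0) * norm (- (y - x)) \<le> K * (1 + R ^ q0) * norm (- (y - x))"
      using K_nonneg by (intro mult_right_mono mult_left_mono add_left_mono power_mono) auto
    then show ?thesis using g_bound[of "\<gamma> t" "- (y - x)"] unfolding norm_minus_cancel by linarith
  qed
  have int: "integrable unit_interval (\<lambda>t. g (\<gamma> t) (- (y - x)))"
    and eq: "expected_fun P f (\<gamma> 1) - expected_fun P f (\<gamma> 0) = - (\<integral>t. g (\<gamma> t) (- (y - x)) \<partial>unit_interval)"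
    using expected_chain[OF lip, of "\<lambda>_. y - x"] der by auto
  have "\<bar>\<integral>t. g (\<gamma> t) (- (y - x)) \<partial>unit_interval\<bar> \<le> (\<integral>t. \<bar>g (\<gamma> t) (- (y - x))\<bar> \<partial>unit_interval)"
    by (rule integral_abs_bound)
  also have "\<dots> \<le> (\<integral>t. K * (1 + R ^ q0) * norm (y - x) \<partial>unit_interval)"
    by (rule integral_mono) (use int bound in auto)
  also have "\<dots> = K * (1 + R ^ q0) * norm (y - x)" by (simp add: measure_restrict_space)
  finally show ?thesis using eq by (simp add: \<gamma>_def)
qed

lemma J_continuous: "continuous_on UNIV (expected_fun P f)"
proof (rule continuous_at_imp_continuous_on, rule ballI)
  fix x :: 'a
  define R where "R = norm x + 1"
  show "isCont (expected_fun P f) x"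
    unfolding isCont_def
  proof (rule LIM_zero_cancel, rule Lim_null_comparison)
    have "\<forall>\<^sub>F y in at x. dist y x < 1" by (auto simp: eventually_at intro!: exI[of _ 1])
    then show "\<forall>\<^sub>F y in at x. norm (expected_fun P f y - expected_fun P f x) \<le> K * (1 + R ^ q0) * norm (y - x)"
    proof eventually_elim
      case (elim y)
      then have "norm y \<le> R" using norm_triangle_sub[of y x] by (simp add: R_def dist_norm)
      then show ?case using J_lipschitz[of x R y] by (simp add: R_def)
    qed
    have "((\<lambda>y. K * (1 + R ^ q0) * norm (y - x)) \<longlongrightarrow> K * (1 + R ^ q0) * norm (x - x)) (at x)"
      by (intro tendsto_intros)
    then show "((\<lambda>y. K * (1 + R ^ q0) * norm (y - x)) \<longlongrightarrow> 0) (at x)" by simp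
  qed
qed

sublocale descent_pair "expected_fun P f" g
proof
  show "continuous_on UNIV (expected_fun P f)" by (rule J_continuous)
  show "\<exists>d>0. \<forall>y. dist y x < d \<longrightarrow> g y p \<le> g x p + e" if "e > 0" for x p and e :: real
    using that by (rule g_usc)
next
  fix \<gamma> :: "real \<Rightarrow> 'a" and L \<tau> :: real
  assume \<gamma>: "L-lipschitz_on {0..1} \<gamma>" and \<tau>: "0 \<le> \<tau>"
    and incl: "\<And>t d p. t \<in> {0<..<1} \<Longrightarrow> (\<gamma> has_vector_derivative d) (at t) \<Longrightarrow> - d \<bullet> p \<le> \<tau> * g (\<gamma> t) p"
  let ?J = "expected_fun P f"
  obtain d where d: "d \<in> borel_measurable borel" "\<And>t. norm (d t) \<le> L"
    and der: "AE t in unit_interval. (\<gamma> has_vector_derivative d t) (at t)"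
    using measurable_derivative[OF \<gamma> curve_differentiable[OF \<gamma>]] by blast
  have int: "integrable unit_interval (\<lambda>t. g (\<gamma> t) (- d t))"
    and eq: "?J (\<gamma> 1) - ?J (\<gamma> 0) = - (\<integral>t. g (\<gamma> t) (- d t) \<partial>unit_interval)"
    using expected_chain[OF \<gamma> d der] by auto
  \<comment> \<open>The inclusion is tested in the direction \<open>p = - d t\<close>.\<close>
  have sq: "AE t in unit_interval. (norm (d t))\<^sup>2 \<le> \<tau> * g (\<gamma> t) (- d t)"
    using der AE_space
  proof eventually_elim
    case (elim t)
    then have "- d t \<bullet> - d t \<le> \<tau> * g (\<gamma> t) (- d t)"
      by (intro incl) (auto simp: space_restrict_space)
    then show ?case by (simp add: power2_norm_eq_inner)
  qed
  have nonneg: "AE t in unit_interval. 0 \<le> g (\<gamma> t) (- d t)"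
    using sq
  proof eventually_elim
    case (elim t)
    show ?case
    \<comment> \<open>For \<open>\<tau> = 0\<close> the sign of \<open>g\<close> cannot be read off
      \<open>sq\<close>, but then the derivative vanishes.\<close>
    proof (cases "\<tau> = 0")
      case True
      then have "d t = 0" using elim by simp
      then show ?thesis by (simp add: g_0)
    next
      case False
      have "0 \<le> \<tau> * g (\<gamma> t) (- d t)" using elim zero_le_power2[of "norm (d t)"] by linarith
      then show ?thesis using False \<tau> by (simp add: zero_le_mult_iff)
    qed
  qed
  have int_nonneg: "0 \<le> (\<integral>t. g (\<gamma> t) (- d t) \<partial>unit_interval)"
    using nonneg by (rule integral_nonneg_AE)
  have "(\<forall>t\<in>{0..1}. \<gamma> t = \<gamma> 0) \<and> (\<forall>p. 0 \<le> g (\<gamma> 0) p)" if "?J (\<gamma> 1) = ?J (\<gamma> 0)" "0 < \<tau>"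
  proof -
    have "AE t in unit_interval. g (\<gamma> t) (- d t) = 0"
      using integral_nonneg_eq_0_iff_AE[OF int nonneg] eq that by simp
    with sq der have "AE t in unit_interval. (\<gamma> has_vector_derivative 0) (at t)"
    proof eventually_elim
      case (elim t)
      then have "d t = 0" by simp
      with elim(2) show ?case by simp
    qed
    from lipschitz_curve_const[OF \<gamma> this] have const: "\<gamma> t = \<gamma> 0" if "t \<in> {0..1}" for t
      using that by blast
    \<comment> \<open>At an interior time the constant curve has derivative 0, and the inclusion
      reads \<open>0 \<le> \<tau> * g (\<gamma> 0) p\<close>.\<close>
    have "(\<gamma> has_vector_derivative 0) (at (1/2))"
      by (rule has_vector_derivative_transform_within_open[of "\<lambda>_. \<gamma> 0" _ _ "{0<..<1}"]) (auto intro: const[symmetric])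
    then have "- 0 \<bullet> p \<le> \<tau> * g (\<gamma> (1/2)) p" for p by (intro incl) auto
    then have "0 \<le> \<tau> * g (\<gamma> 0) p" for p using const[of "1/2"] by simp
    then have "\<forall>p. 0 \<le> g (\<gamma> 0) p" using that(2) by (simp add: zero_le_mult_iff)
    with const show ?thesis by blast
  qed
  moreover have "?J (\<gamma> 1) \<le> ?J (\<gamma> 0)" using eq int_nonneg by simp
  ultimately show "?J (\<gamma> 1) \<le> ?J (\<gamma> 0) \<and>
      (?J (\<gamma> 1) = ?J (\<gamma> 0) \<longrightarrow> 0 < \<tau> \<longrightarrow> (\<forall>t\<in>{0..1}. \<gamma> t = \<gamma> 0) \<and> (\<forall>p. 0 \<le> g (\<gamma> 0) p))"
    by blast
qed

end

section \<open>The stochastic subgradient method\<close>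

locale stochastic_subgradient = obj: stochastic_objective P f D \<kappa> q0 + iid_sequence M P \<xi> + step_sizes \<alpha>
  for P :: "'s measure" and M :: "'o measure" and f :: "'a::euclidean_space \<Rightarrow> 's \<Rightarrow> real" and D \<kappa> q0 \<xi> \<alpha> +
  fixes v :: "'a \<Rightarrow> 's \<Rightarrow> 'a" and w0 :: 'a and w :: "nat \<Rightarrow> 'o \<Rightarrow> 'a"
  assumes v_measurable: "(\<lambda>(x, s). v x s) \<in> borel_measurable (borel \<Otimes>\<^sub>M P)"
    and v_selection: "\<And>x. AE s in P. v x s \<in> D x s"
    and w_0: "\<And>\<omega>. \<omega> \<in> space M \<Longrightarrow> w 0 \<omega> = w0"
    and w_Suc: "\<And>k \<omega>. \<omega> \<in> space M \<Longrightarrow> w (Suc k) \<omega> = w k \<omega> - \<alpha> k *\<^sub>R v (w k \<omega>) (\<xi> k \<omega>)"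
begin

definition H :: "'a \<Rightarrow> 'a" where
  "H x = (\<integral>s. v x s \<partial>P)"

text \<open>The noise is switched off outside a ball, which makes it square integrable uniformly in the
  position.\<close>

definition N :: "real \<Rightarrow> 'a \<Rightarrow> 's \<Rightarrow> 'a" where
  "N R x s = indicator (cball 0 R) x *\<^sub>R (v x s - H x)"

lemma v_section [measurable]: "v x \<in> borel_measurable P"
  using measurable_compose[OF measurable_Pair1' v_measurable, of x] by simp

lemma v_bound: "AE s in P. norm (v x s) \<le> \<kappa> s * (1 + norm x ^ q0)"
  using v_selection[of x] obj.D_bound by eventually_elim auto

lemma v_integrable: "integrable P (v x)"
proof (rule Bochner_Integration.integrable_bound)
  show "integrable P (\<lambda>s. \<kappa> s * (1 + norm x ^ q0))" using obj.\<kappa>_integrable by auto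
  show "AE s in P. norm (v x s) \<le> norm (\<kappa> s * (1 + norm x ^ q0))"
    using v_bound[of x] by eventually_elim (metis abs_ge_self order_trans real_norm_def)
qed measurable

lemma H_bound: "norm (H x) \<le> obj.K * (1 + norm x ^ q0)"
proof -
  have "norm (H x) \<le> (\<integral>s. norm (v x s) \<partial>P)" unfolding H_def by (rule integral_norm_bound)
  also have "\<dots> \<le> (\<integral>s. \<kappa> s * (1 + norm x ^ q0) \<partial>P)"
    by (rule integral_mono_AE) (use v_integrable v_bound obj.\<kappa>_integrable in auto)
  also have "\<dots> = obj.K * (1 + norm x ^ q0)" by (simp add: obj.K_def)
  finally show ?thesis .
qed

text \<open>As \<open>v x\<close> lies in \<open>D x\<close> only almost everywhere,
  \<open>H x\<close> is not at once an element of the Aumann integral; for this inequality almost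
  everywhere is enough.\<close>

lemma H_support: "H x \<bullet> p \<le> obj.g x p"
proof -
  have "H x \<bullet> p = (\<integral>s. v x s \<bullet> p \<partial>P)" unfolding H_def using v_integrable by simp
  also have "\<dots> \<le> obj.g x p"
    unfolding obj.g_def
  proof (rule integral_mono_AE)
    show "AE s in P. v x s \<bullet> p \<le> support (D x s) p"
      using v_selection[of x] AE_space by eventually_elim (auto intro: support_upper obj.D_compact)
  qed (use v_integrable obj.support_integrable in auto)
  finally show ?thesis .
qed

lemma H_measurable: "H \<in> borel_measurable borel"
  unfolding H_def[abs_def] using v_measurable by (rule obj.borel_measurable_lebesgue_integral)

lemma w_past: "w k \<in> past k \<rightarrow>\<^sub>M borel"
proof (induction k)
  case 0
  have "w 0 \<in> past 0 \<rightarrow>\<^sub>M borel \<longleftrightarrow> (\<lambda>_. w0) \<in> past 0 \<rightarrow>\<^sub>M borel"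
    by (rule measurable_cong) (simp add: w_0)
  then show ?case by simp
next
  case (Suc k)
  have wk: "w k \<in> past (Suc k) \<rightarrow>\<^sub>M borel" by (rule past_mono[OF _ Suc]) simp
  have \<xi>k: "\<xi> k \<in> past (Suc k) \<rightarrow>\<^sub>M P" by (rule \<xi>_measurable_past) simp
  have "(\<lambda>\<omega>. v (w k \<omega>) (\<xi> k \<omega>)) \<in> past (Suc k) \<rightarrow>\<^sub>M borel"
    using measurable_compose[OF measurable_Pair[OF wk \<xi>k] v_measurable] by simp
  then have "(\<lambda>\<omega>. w k \<omega> - \<alpha> k *\<^sub>R v (w k \<omega>) (\<xi> k \<omega>)) \<in> past (Suc k) \<rightarrow>\<^sub>M borel"
    using wk by simp
  moreover have "w (Suc k) \<in> past (Suc k) \<rightarrow>\<^sub>M borel \<longleftrightarrow>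
      (\<lambda>\<omega>. w k \<omega> - \<alpha> k *\<^sub>R v (w k \<omega>) (\<xi> k \<omega>)) \<in> past (Suc k) \<rightarrow>\<^sub>M borel"
    by (rule measurable_cong) (simp add: w_Suc)
  ultimately show ?case by simp
qed

lemma N_bound:
  assumes "0 \<le> R"
  shows "AE s in P. norm (N R x s) \<le> (\<kappa> s + obj.K) * (1 + R ^ q0)"
  using v_bound[of x] AE_space
proof eventually_elim
  case (elim s)
  have nonneg: "0 \<le> \<kappa> s" "0 \<le> obj.K" using obj.\<kappa>_nonneg[OF elim(2)] obj.K_nonneg by auto
  show ?case
  proof (cases "norm x \<le> R")
    case True
    have "norm (v x s - H x) \<le> norm (v x s) + norm (H x)" by (rule norm_triangle_ineq4)
    also have "\<dots> \<le> (\<kappa> s + obj.K) * (1 + norm x ^ q0)"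
      using elim(1) H_bound[of x] by (simp add: distrib_right)
    also have "\<dots> \<le> (\<kappa> s + obj.K) * (1 + R ^ q0)"
      using True nonneg by (intro mult_left_mono add_left_mono power_mono) auto
    finally show ?thesis using True by (simp add: N_def)
  next
    case False
    then show ?thesis using nonneg assms by (simp add: N_def)
  qed
qed

lemma adapted: "adapted_noise M P \<xi> \<alpha> w (N R)"
proof
  show "(\<lambda>(z, s). N R z s) \<in> borel \<Otimes>\<^sub>M P \<rightarrow>\<^sub>M borel"
  proof -
    have "(\<lambda>x. v (fst x) (snd x)) \<in> borel_measurable (borel \<Otimes>\<^sub>M P)"
      using v_measurable by (simp add: case_prod_beta)
    moreover have "(\<lambda>x. H (fst x)) \<in> borel_measurable (borel \<Otimes>\<^sub>M P)"
      by (rule measurable_compose[OF measurable_fst H_measurable])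
    moreover have "(\<lambda>x. indicator (cball 0 R) (fst x) :: real) \<in> borel_measurable (borel \<Otimes>\<^sub>M P)"
      by (rule measurable_compose[OF measurable_fst borel_measurable_indicator]) (simp add: borel_closed)
    ultimately show ?thesis
      unfolding N_def case_prod_beta' by (intro borel_measurable_scaleR borel_measurable_diff)
  qed
  show "integrable P (N R z)" for z
    unfolding N_def[abs_def] using v_integrable by auto
  show "(\<integral>s. N R z s \<partial>P) = 0" for z
    unfolding N_def using v_integrable by (simp add: H_def obj.prob_space)
qed (rule w_past)

lemma square_integrable:
  assumes R: "0 \<le> R"
  shows "square_integrable_noise M P \<xi> \<alpha> w (N R) (\<integral>s. ((\<kappa> s + obj.K) * (1 + R ^ q0))\<^sup>2 \<partial>P)"
proof -
  interpret adapted_noise M P \<xi> \<alpha> w "N R" by (rule adapted)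
  have int: "integrable P (\<lambda>s. ((\<kappa> s + obj.K) * (1 + R ^ q0))\<^sup>2)"
    using obj.\<kappa>_square_integrable obj.\<kappa>_integrable by (simp add: power_mult_distrib power2_sum)
  have sq: "AE s in P. (norm (N R z s))\<^sup>2 \<le> ((\<kappa> s + obj.K) * (1 + R ^ q0))\<^sup>2" for z
    using N_bound[OF R, of z] by eventually_elim (auto intro: power_mono)
  show ?thesis
  proof
    have [measurable]: "N R z \<in> borel_measurable P" for z using N_integrable by auto
    show sq_int: "integrable P (\<lambda>s. (norm (N R z s))\<^sup>2)" for z
      by (rule Bochner_Integration.integrable_bound[OF int])
        (use sq[of z] in \<open>auto elim: eventually_mono\<close>)
    show "(\<integral>s. (norm (N R z s))\<^sup>2 \<partial>P) \<le> (\<integral>s. ((\<kappa> s + obj.K) * (1 + R ^ q0))\<^sup>2 \<partial>P)" for z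
      using sq by (intro integral_mono_AE sq_int int)
  qed
qed

abbreviation loud_path :: "real \<Rightarrow> 'o \<Rightarrow> real \<Rightarrow> nat \<Rightarrow> bool" where
  "loud_path R \<omega> e n \<equiv> \<exists>j\<in>{win n..win (Suc n)}. norm (noise (\<lambda>i. N R (w i \<omega>) (\<xi> i \<omega>)) (win n) j) > e"

lemma perturbed:
  assumes \<omega>: "\<omega> \<in> space M" and R: "\<And>k. norm (w k \<omega>) \<le> R"
  shows "perturbed_descent (expected_fun P f) obj.g \<alpha> (\<lambda>k. w k \<omega>) (\<lambda>k. H (w k \<omega>))
    (\<lambda>k. N R (w k \<omega>) (\<xi> k \<omega>)) R (obj.K * (1 + R ^ q0))"
proof
  fix k
  show "w (Suc k) \<omega> = w k \<omega> - \<alpha> k *\<^sub>R (H (w k \<omega>) + N R (w k \<omega>) (\<xi> k \<omega>))"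
    using R[of k] by (simp add: w_Suc[OF \<omega>] N_def)
  show "norm (w k \<omega>) \<le> R" by (rule R)
  have "obj.K * (1 + norm (w k \<omega>) ^ q0) \<le> obj.K * (1 + R ^ q0)"
    using obj.K_nonneg R by (intro mult_left_mono add_left_mono power_mono) auto
  then show "norm (H (w k \<omega>)) \<le> obj.K * (1 + R ^ q0)" using H_bound order_trans by blast
  show "H (w k \<omega>) \<bullet> p \<le> obj.g (w k \<omega>) p" for p by (rule H_support)
qed

text \<open>The bound of a path is random, so results for fixed truncation radii are collected over
  all natural radii and the radius is chosen afterwards.\<close>

lemma AE_bounded_path:
  assumes bdd: "AE \<omega> in M. bdd_above (range (\<lambda>k. norm (w k \<omega>)))"
    and Q: "\<And>R. 0 \<le> R \<Longrightarrow> AE \<omega> in M. Q R \<omega>"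
    and step: "\<And>R \<omega>. \<omega> \<in> space M \<Longrightarrow> (\<And>k. norm (w k \<omega>) \<le> R) \<Longrightarrow> Q R \<omega> \<Longrightarrow> Z \<omega>"
  shows "AE \<omega> in M. Z \<omega>"
proof -
  have "AE \<omega> in M. \<forall>R::nat. Q (real R) \<omega>" unfolding AE_all_countable using Q by simp
  with bdd show ?thesis
    using AE_space
  proof eventually_elim
    case (elim \<omega>)
    obtain B where B: "\<And>k. norm (w k \<omega>) \<le> B" using elim(1) by (auto simp: bdd_above_def)
    obtain R :: nat where "B \<le> real R" using real_arch_simple by blast
    then have "norm (w k \<omega>) \<le> real R" for k using B[of k] by simp
    from step[OF elim(3) this] elim(2) show ?case by blast
  qed
qed

lemma essential_accumulation_points:
  assumes bdd: "AE \<omega> in M. bdd_above (range (\<lambda>k. norm (w k \<omega>)))"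
  shows "AE \<omega> in M. \<forall>x. essential_accumulation_point \<alpha> (\<lambda>k. w k \<omega>) x \<longrightarrow> 0 \<in> expected_map P D x"
proof (rule AE_bounded_path[OF bdd])
  fix R :: real assume R: "0 \<le> R"
  interpret square_integrable_noise M P \<xi> \<alpha> w "N R" "\<integral>s. ((\<kappa> s + obj.K) * (1 + R ^ q0))\<^sup>2 \<partial>P"
    using R by (rule square_integrable)
  show "AE \<omega> in M. \<forall>e>0. (\<lambda>K. real (card {n. n < K \<and> loud_path R \<omega> e n}) / real K) \<longlonglongrightarrow> 0"
    using loud_density AE_space
  proof eventually_elim
    case (elim \<omega>)
    then show ?case unfolding loud_count_def loud_set_def S_def by simp
  qed
next
  fix R \<omega>
  assume "\<omega> \<in> space M" "\<And>k. norm (w k \<omega>) \<le> R"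
    and quiet: "\<forall>e>0. (\<lambda>K. real (card {n. n < K \<and> loud_path R \<omega> e n}) / real K) \<longlonglongrightarrow> 0"
  then interpret perturbed_descent "expected_fun P f" obj.g \<alpha> "\<lambda>k. w k \<omega>" "\<lambda>k. H (w k \<omega>)"
    "\<lambda>k. N R (w k \<omega>) (\<xi> k \<omega>)" R "obj.K * (1 + R ^ q0)"
    by (intro perturbed)
  show "\<forall>x. essential_accumulation_point \<alpha> (\<lambda>k. w k \<omega>) x \<longrightarrow> 0 \<in> expected_map P D x"
    using essential_accumulation_critical quiet obj.zero_in_expected_map by blast
qed

lemma convergence:
  assumes bdd: "AE \<omega> in M. bdd_above (range (\<lambda>k. norm (w k \<omega>)))"
    and crit: "interior (expected_fun P f ` crit (expected_map P D)) = {}"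
    and quiet: "\<And>R. 0 \<le> R \<Longrightarrow> AE \<omega> in M. \<forall>e>0. \<forall>\<^sub>F n in sequentially. \<not> loud_path R \<omega> e n"
  shows "AE \<omega> in M. convergent (\<lambda>k. expected_fun P f (w k \<omega>))
            \<and> (\<forall>x. accumulation_point (\<lambda>k. w k \<omega>) x \<longrightarrow> 0 \<in> expected_map P D x)
            \<and> connected {x. accumulation_point (\<lambda>k. w k \<omega>) x}"
proof (rule AE_bounded_path[OF bdd quiet])
  fix R \<omega>
  assume "\<omega> \<in> space M" "\<And>k. norm (w k \<omega>) \<le> R"
    and q: "\<forall>e>0. \<forall>\<^sub>F n in sequentially. \<not> loud_path R \<omega> e n"
  then interpret perturbed_descent "expected_fun P f" obj.g \<alpha> "\<lambda>k. w k \<omega>" "\<lambda>k. H (w k \<omega>)"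
    "\<lambda>k. N R (w k \<omega>) (\<xi> k \<omega>)" R "obj.K * (1 + R ^ q0)"
    by (intro perturbed)
  have q': "\<forall>\<^sub>F n in sequentially. \<not> loud e n" if "e > 0" for e
    using q that by blast
  \<comment> \<open>Points that are critical in terms of the support function belong to
    \<open>crit\<close>, so their values inherit the empty interior.\<close>
  have "expected_fun P f ` {x. \<forall>p. 0 \<le> obj.g x p} \<subseteq> expected_fun P f ` crit (expected_map P D)"
    using obj.zero_in_expected_map by (auto simp: crit_def)
  then have "interior (expected_fun P f ` {x. \<forall>p. 0 \<le> obj.g x p}) = {}"
    using interior_mono crit by blast
  from J_convergent[OF q' this] have conv: "convergent (\<lambda>k. expected_fun P f (w k \<omega>))" .
  moreover have "0 \<in> expected_map P D x" if "accumulation_point (\<lambda>k. w k \<omega>) x" for x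
    using accumulation_critical[OF q' conv that] by (rule obj.zero_in_expected_map)
  moreover have "connected {x. accumulation_point (\<lambda>k. w k \<omega>) x}"
    by (rule connected_accumulation_points[OF w_bounded steps_vanish[OF q']])
  ultimately show "convergent (\<lambda>k. expected_fun P f (w k \<omega>))
            \<and> (\<forall>x. accumulation_point (\<lambda>k. w k \<omega>) x \<longrightarrow> 0 \<in> expected_map P D x)
            \<and> connected {x. accumulation_point (\<lambda>k. w k \<omega>) x}"
    by blast
qed

lemma quiet_square_summable:
  assumes "summable (\<lambda>k. (\<alpha> k)\<^sup>2)" "0 \<le> R"
  shows "AE \<omega> in M. \<forall>e>0. \<forall>\<^sub>F n in sequentially. \<not> loud_path R \<omega> e n"
proof -
  interpret square_integrable_noise M P \<xi> \<alpha> w "N R" "\<integral>s. ((\<kappa> s + obj.K) * (1 + R ^ q0))\<^sup>2 \<partial>P"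
    using assms(2) by (rule square_integrable)
  show ?thesis
    using eventually_quiet_summable[OF assms(1)] AE_space
  proof eventually_elim
    case (elim \<omega>)
    then show ?case unfolding loud_set_def S_def by simp
  qed
qed

text \<open>By compactness of the ball, finitely many local bounds give one bound for
  \<open>v\<close> over the ball and the set \<open>A\<close> of full measure; the average
  \<open>H\<close> obeys the same bound, whence the factor 2 for the noise.\<close>

lemma quiet_bounded:
  assumes supp: "emeasure P (A) = 1"
    and bdd: "locally_bounded_above (\<lambda>x. SUP s\<in>A. ereal (norm (v x s)))"
    and "\<alpha> \<in> o(\<lambda>k. 1 / ln (real k))"
  shows "AE \<omega> in M. \<forall>e>0. \<forall>\<^sub>F n in sequentially. \<not> loud_path R \<omega> e n"
proof -
  \<comment> \<open>A set outside the sigma-algebra has \<open>emeasure\<close> 0 by convention, so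
    measure 1 forces measurability.\<close>
  have "A \<in> sets P" using supp emeasure_notin_sets[of A P] by force
  then have "AE s in P. s \<in> A" using supp by (simp add: obj.AE_in_set_eq_1 measure_def)
  have "\<forall>x. \<exists>\<epsilon>>0. \<exists>C::real. \<forall>y\<in>ball x \<epsilon>. (SUP s\<in>A. ereal (norm (v y s))) \<le> ereal C"
    using bdd unfolding locally_bounded_above_def .
  then obtain \<epsilon> C where \<epsilon>: "\<And>x. \<epsilon> x > 0"
    and C: "\<And>x y. y \<in> ball x (\<epsilon> x) \<Longrightarrow> (SUP s\<in>A. ereal (norm (v y s))) \<le> ereal (C x)" by metis
  have cover: "cball 0 R \<subseteq> (\<Union>x\<in>cball 0 R. ball x (\<epsilon> x))" using \<epsilon> by force
  obtain X where "X \<subseteq> cball 0 R" and X: "finite X" "cball 0 R \<subseteq> (\<Union>x\<in>X. ball x (\<epsilon> x))"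
    by (rule compactE_image[OF compact_cball _ cover]) auto
  \<comment> \<open>The summand 1 makes the bound positive, as \<open>bounded_noise\<close> demands;
    absolute values let each local bound be dominated by the sum.\<close>
  define B where "B = 1 + (\<Sum>x\<in>X. \<bar>C x\<bar>)"
  have "B > 0" unfolding B_def by (intro add_pos_nonneg sum_nonneg) auto
  have v_le: "norm (v y s) \<le> B" if y: "norm y \<le> R" and s: "s \<in> A" for y s
  proof -
    obtain x where x: "x \<in> X" "y \<in> ball x (\<epsilon> x)" using X(2) y by auto
    have "ereal (norm (v y s)) \<le> ereal (C x)"
      using C[OF x(2)] s by (auto simp: SUP_le_iff)
    then have "norm (v y s) \<le> \<bar>C x\<bar>" by simp
    also have "\<dots> \<le> (\<Sum>x\<in>X. \<bar>C x\<bar>)" using X(1) x(1) by (intro member_le_sum) auto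
    finally show ?thesis by (simp add: B_def)
  qed
  have bound: "AE s in P. norm (N R y s) \<le> 2 * B" for y
  proof (cases "norm y \<le> R")
    case True
    have v_AE: "AE s in P. norm (v y s) \<le> B"
      using \<open>AE s in P. s \<in> A\<close> by eventually_elim (rule v_le[OF True])
    have "norm (H y) \<le> (\<integral>s. norm (v y s) \<partial>P)" unfolding H_def by (rule integral_norm_bound)
    also have "\<dots> \<le> (\<integral>s. B \<partial>P)" by (rule integral_mono_AE) (use v_AE v_integrable in auto)
    finally have H_le: "norm (H y) \<le> B" by (simp add: obj.prob_space)
    show ?thesis
      using v_AE
    proof eventually_elim
      case (elim s)
      then show ?case using H_le norm_triangle_ineq4[of "v y s" "H y"] True by (simp add: N_def)
    qed
  next
    case False
    then show ?thesis using \<open>B > 0\<close> by (simp add: N_def)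
  qed
  interpret adapted_noise M P \<xi> \<alpha> w "N R" by (rule adapted)
  interpret bounded_noise M P \<xi> \<alpha> w "N R" "2 * B"
    by unfold_locales (use bound \<open>B > 0\<close> in auto)
  show ?thesis
    using eventually_quiet_bounded[OF assms(3)] AE_space
  proof eventually_elim
    case (elim \<omega>)
    then show ?case unfolding loud_set_def S_def by simp
  qed
qed

end

theorem theorem5:
  fixes P :: "'s measure" and M :: "'o measure" and T :: "'s topology"
    and f :: "'a::euclidean_space \<Rightarrow> 's \<Rightarrow> real"
    and D :: "'a \<Rightarrow> 's \<Rightarrow> 'a set"
    and v :: "'a \<Rightarrow> 's \<Rightarrow> 'a"
    and \<kappa> :: "'s \<Rightarrow> real" and q0 :: nat
    and \<alpha> :: "nat \<Rightarrow> real"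
    and \<xi> :: "nat \<Rightarrow> 'o \<Rightarrow> 's"
    and w0 :: 'a and w :: "nat \<Rightarrow> 'o \<Rightarrow> 'a"
  assumes P: "prob_space P"
    and D_values: "\<And>x s. s \<in> space P \<Longrightarrow> D x s \<noteq> {} \<and> compact (D x s)"
    and conservative: "AE s in P. locally_lipschitz (\<lambda>x. f x s)
          \<and> conservative_gradient (\<lambda>x. f x s) (\<lambda>x. D x s) \<and> (\<forall>x. convex (D x s))"
    and f_integrable: "\<And>x. integrable P (f x)"
    and J_bounded_below: "bdd_below (range (expected_fun P f))"
    and D_measurable: "(\<lambda>(x, s). D x s) \<in> borel \<Otimes>\<^sub>M P \<rightarrow>\<^sub>M hausdorff_borel"
    and \<kappa>_nonneg: "\<And>s. s \<in> space P \<Longrightarrow> \<kappa> s \<ge> 0"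
    and \<kappa>_measurable: "\<kappa> \<in> borel_measurable P"
    and \<kappa>_square_integrable: "integrable P (\<lambda>s. (\<kappa> s)\<^sup>2)"
    and D_growth: "AE s in P. \<forall>x. set_norm (D x s) \<le> \<kappa> s * (1 + norm x ^ q0)"
    and \<alpha>_pos: "\<And>k. \<alpha> k > 0"
    and \<alpha>_sum: "filterlim (\<lambda>n. \<Sum>k<n. \<alpha> k) at_top sequentially"
    and \<alpha>_null: "\<alpha> \<longlonglongrightarrow> 0"
    and v_measurable: "(\<lambda>(x, s). v x s) \<in> borel_measurable (borel \<Otimes>\<^sub>M P)"
    and v_selection: "\<And>x. AE s in P. v x s \<in> D x s"
    and M: "prob_space M"
    and \<xi>_indep: "prob_space.indep_vars M (\<lambda>_. P) \<xi> UNIV"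
    and \<xi>_law: "\<And>k. distr M P (\<xi> k) = P"
    and w_0: "\<And>\<omega>. \<omega> \<in> space M \<Longrightarrow> w 0 \<omega> = w0"
    and w_Suc: "\<And>k \<omega>. \<omega> \<in> space M \<Longrightarrow>
          w (Suc k) \<omega> = w k \<omega> - \<alpha> k *\<^sub>R v (w k \<omega>) (\<xi> k \<omega>)"
    and w_bounded: "AE \<omega> in M. bdd_above (range (\<lambda>k. norm (w k \<omega>)))"
  shows "(AE \<omega> in M. \<forall>x. essential_accumulation_point \<alpha> (\<lambda>k. w k \<omega>) x
            \<longrightarrow> 0 \<in> expected_map P D x)
    \<and> (interior (expected_fun P f ` crit (expected_map P D)) = {}
       \<and> (summable (\<lambda>k. (\<alpha> k)\<^sup>2)
          \<or> (borel_structure T P \<and> emeasure P (measure_support T P) = 1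
             \<and> locally_bounded_above (\<lambda>x. SUP s\<in>measure_support T P. ereal (norm (v x s)))
             \<and> \<alpha> \<in> o(\<lambda>k. 1 / ln (real k))))
       \<longrightarrow> (AE \<omega> in M. convergent (\<lambda>k. expected_fun P f (w k \<omega>))
            \<and> (\<forall>x. accumulation_point (\<lambda>k. w k \<omega>) x \<longrightarrow> 0 \<in> expected_map P D x)
            \<and> connected {x. accumulation_point (\<lambda>k. w k \<omega>) x}))"
proof -
  interpret iid: iid_sequence M P \<xi>
    using M P \<xi>_indep \<xi>_law by (intro iid_sequence.intro iid_sequence_axioms.intro)
  interpret stochastic_subgradient P M f D \<kappa> q0 \<xi> \<alpha> v w0 w
  proof (intro stochastic_subgradient.intro stochastic_subgradient_axioms.intro)
    show "stochastic_objective P f D \<kappa> q0"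
      by (intro stochastic_objective.intro stochastic_objective_axioms.intro)
        (fact P D_values conservative f_integrable D_measurable \<kappa>_nonneg \<kappa>_measurable
          \<kappa>_square_integrable D_growth)+
    show "iid_sequence M P \<xi>" by (rule iid.iid_sequence_axioms)
    show "step_sizes \<alpha>"
      by (intro step_sizes.intro) (fact \<alpha>_pos \<alpha>_null \<alpha>_sum)+
  qed (fact v_measurable v_selection w_0 w_Suc)+
  show ?thesis
  proof (intro conjI impI, goal_cases)
    case 1
    show ?case by (rule essential_accumulation_points[OF w_bounded])
  next
    case 2
    then have crit: "interior (expected_fun P f ` crit (expected_map P D)) = {}" by blast
    show ?case
    proof (rule convergence[OF w_bounded crit])
      fix R :: real assume "0 \<le> R"
      then show "AE \<omega> in M. \<forall>e>0. \<forall>\<^sub>F n in sequentially. \<not> loud_path R \<omega> e n"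
        using 2 quiet_square_summable quiet_bounded by blast
    qed
  qed
qed

end
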